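(* Let $\gamma\in(0,1)$, $\beta>1$, and $\alpha_n=1-\gamma/n^\beta$ for $n\in\mathbb{N}$. Let $(\sigma_n)$ be a sequence of positive numbers and, for each $n$, let $(X_{j,n})_{j\ge0}$ be the stationary process satisfying $X_{j,n}=\alpha_nX_{j-1,n}+\sigma_n\varepsilon_j$ for $j\ge1$, where $(\varepsilon_j)$ are i.i.d. $\mathcal{N}(0,1)$ independent of $X_{0,n}\sim\mathcal{N}(0,\sigma_n^2/(1-\alpha_n^2))$. Let $\hat S_{n,t}(f)$ be the standardized sequential additive functional defined in the context and let $Z\sim\mathcal{N}(0,1)$. (i) If $\sigma_n^2\gg1-\alpha_n^2$ and $f=\sum_{q=m}^pc_qH_q$ is a fixed polynomial with $p\ge1$ and $c_p\ne0$, then there are real constants $f_{p-2l}=f_{p-2l}(f)$, $0\le l\le\lfloor(p-1)/2\rfloor$, such that $$\big(\hat S_{n,t}(f)\big)_{t\in[0,1]}\longrightarrow_{\mathcal D}\Big(t\sum_{l=0}^{\lfloor(p-1)/2\rfloor}f_{p-2l}\frac{H_{p-2l}(Z)}{\sqrt{(p-2l)!}}\Big)_{t\in[0,1]}\quad\text{in }D[0,1]\text{ as }n\to\infty.$$ (ii) If $\sigma_n^2=1-\alpha_n^2$ and $f\in L^2(\mathcal{N}(0,1))$ is non-constant with Hermite rank $m$, then there are real constants $h_q=h_q(f)$, $q\ge m$, such that $$\big(\hat S_{n,t}(f)\big)_{t\in[0,1]}\longrightarrow_{\mathcal D}\Big(t\sum_{q=m}^{\infty}h_q\frac{H_q(Z)}{\sqrt{q!}}\Big)_{t\in[0,1]}\quad\text{in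 }D[0,1]\text{ as }n\to\infty$$ (the series being a limit in $L^2$). (iii) If $\sigma_n^2\ll1-\alpha_n^2$ and $f=\sum_{q=m}^pc_qH_q$ is a fixed non-constant polynomial with $p\ge1$ and $c_p\ne0$, then, with $m_*$ as defined in the context, there are real constants $l_q=l_q(f)$, $1\le q\le m_*$, such that $$\big(\hat S_{n,t}(f)\big)_{t\in[0,1]}\longrightarrow_{\mathcal D}\Big(t\sum_{q=1}^{m_*}l_q\frac{H_q(Z)}{\sqrt{q!}}\Big)_{t\in[0,1]}\quad\text{in }D[0,1]\text{ as }n\to\infty.$$
   Context: For $t\in[0,1]$, $S_{n,t}(f)=\sum_{k=1}^{\lfloor nt\rfloor}f(X_{k,n})$ and $\hat S_{n,t}(f)=\dfrac{S_{n,t}(f)-\mathbb{E}S_{n,t}(f)}{\sqrt{\mathrm{Var}\,S_{n,1}(f)}}$. $H_q$ is the (probabilists') Hermite polynomial of order $q$; any $f\in L^2(\mathcal{N}(0,1))$ has an $L^2$-expansion $f=\sum_{q\ge0}c_qH_q$, and its Hermite rank is $m=\min\{q\ge1:c_q\ne0\}$. $D[0,1]$ is the Skorokhod space with the Skorokhod topology; $\longrightarrow_{\mathcal D}$ is convergence in distribution. For positive sequences, $x_n\gg y_n$ (equivalently $y_n\ll x_n$) means $y_n=o(x_n)$. The constants in the limits do not depend on $n$ or $t$. Definition of $m_*$ for a polynomial $f=\sum_{q=m}^pc_qH_q$: with $C_{q,l}=\frac{q!}{l!\,(q-2l)!\,2^l}$, put $$D_r^{(w,m,p)}=\sum_{s=0}^{\lfloor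 p/2\rfloor}\mathbf{1}_{\{w=2s+r\}}\sum_{u=0}^{\lfloor p/2\rfloor}\mathbf{1}_{\{m\le w+2u\le p\}}\,c_{w+2u}\,C_{w+2u,s+u}\binom{s+u}{s}(-1)^u ,$$ and $m_*=\min\{w\ge1:\sum_{r=1}^pD_r^{(w,m,p)}\ne0\}$. *)

theory Defs
  imports "HOL-Probability.Probability"
begin

text \<open>The probabilists' normalisation: monic, orthogonal with respect to \<open>N(0,1)\<close>.\<close>

fun hermite :: "nat \<Rightarrow> real \<Rightarrow> real" where
  "hermite 0 x = 1"
| "hermite (Suc 0) x = x"
| "hermite (Suc (Suc q)) x = x * hermite (Suc q) x - real (Suc q) * hermite q x"

definition sq_integrable :: "'a measure \<Rightarrow> ('a \<Rightarrow> real) \<Rightarrow> bool" where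
  "sq_integrable M g \<longleftrightarrow> g \<in> borel_measurable M \<and> integrable M (\<lambda>x. (g x)\<^sup>2)"

definition L2_tendsto :: "'a measure \<Rightarrow> (nat \<Rightarrow> 'a \<Rightarrow> real) \<Rightarrow> ('a \<Rightarrow> real) \<Rightarrow> bool" where
  "L2_tendsto M F g \<longleftrightarrow>
     (\<forall>N. sq_integrable M (F N)) \<and> sq_integrable M g \<and>
     (\<lambda>N. LINT x|M. (F N x - g x)\<^sup>2) \<longlonglongrightarrow> 0"

text \<open>The coefficients of a function in \<open>L\<^sup>2(N(0,1))\<close> are unique by orthogonality.\<close>

definition hermite_coeffs :: "(real \<Rightarrow> real) \<Rightarrow> nat \<Rightarrow> real" where
  "hermite_coeffs f =
     (THE c. L2_tendsto std_normal_distribution (\<lambda>N x. \<Sum>q\<le>N. c q * hermite q x) f)"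

text \<open>The rank of \<open>f\<close> is \<open>hermite_rank c\<close> for the coefficient sequence \<open>c\<close> of \<open>f\<close>; \<open>c 0\<close> plays no role.\<close>

definition hermite_rank :: "(nat \<Rightarrow> real) \<Rightarrow> nat" where
  "hermite_rank c = (LEAST q. 1 \<le> q \<and> c q \<noteq> 0)"

definition hermite_poly :: "(nat \<Rightarrow> real) \<Rightarrow> nat \<Rightarrow> nat \<Rightarrow> real \<Rightarrow> real" where
  "hermite_poly c m p x = (\<Sum>q=m..p. c q * hermite q x)"

definition hermite_C :: "nat \<Rightarrow> nat \<Rightarrow> real" where
  "hermite_C q l = fact q / (fact l * fact (q - 2 * l) * 2 ^ l)"

text \<open>If \<open>m \<le> w + 2 * u \<le> p\<close> and \<open>w = 2 * s + r\<close>, then \<open>2 * (s + u) \<le> w + 2 * u\<close>, so the natural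
  subtraction in \<open>hermite_C\<close> does not truncate.\<close>

definition hermite_D :: "(nat \<Rightarrow> real) \<Rightarrow> nat \<Rightarrow> nat \<Rightarrow> nat \<Rightarrow> nat \<Rightarrow> real" where
  "hermite_D c m p w r =
     (\<Sum>s=0..p div 2. if w = 2 * s + r then
        (\<Sum>u=0..p div 2. if m \<le> w + 2 * u \<and> w + 2 * u \<le> p then
           c (w + 2 * u) * hermite_C (w + 2 * u) (s + u) * real ((s + u) choose s) * (-1) ^ u
         else 0)
      else 0)"

definition m_star :: "(nat \<Rightarrow> real) \<Rightarrow> nat \<Rightarrow> nat \<Rightarrow> nat" where
  "m_star c m p = (LEAST w. 1 \<le> w \<and> (\<Sum>r=1..p. hermite_D c m p w r) \<noteq> 0)"

text \<open>Functions on \<open>[0,1]\<close> are represented as extensional functions on the real line.\<close>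

definition cadlag :: "(real \<Rightarrow> real) set" where
  "cadlag = {x \<in> extensional {0..1}.
     (\<forall>t\<in>{0..<1}. (x \<longlongrightarrow> x t) (at_right t)) \<and>
     (\<forall>t\<in>{0<..1}. \<exists>l. (x \<longlongrightarrow> l) (at_left t))}"

definition time_changes :: "(real \<Rightarrow> real) set" where
  "time_changes = {\<tau>. strict_mono_on {0..1} \<tau> \<and> continuous_on {0..1} \<tau> \<and> \<tau> ` {0..1} = {0..1}}"

text \<open>The value outside \<open>cadlag\<close> is irrelevant; it is set to 0 so that the distance is
  nonnegative and symmetric everywhere, as the locale \<open>Metric_space\<close> demands.\<close>

definition skorokhod_dist :: "(real \<Rightarrow> real) \<Rightarrow> (real \<Rightarrow> real) \<Rightarrow> real" where
  "skorokhod_dist x y =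
     (if x \<in> cadlag \<and> y \<in> cadlag then
        Inf {e. 0 < e \<and> (\<exists>\<tau>\<in>time_changes. \<forall>t\<in>{0..1}. \<bar>\<tau> t - t\<bar> \<le> e \<and> \<bar>x t - y (\<tau> t)\<bar> \<le> e)}
      else 0)"

lemma cadlag_bounded:
  assumes "x \<in> cadlag"
  obtains B where "\<And>t. t \<in> {0..1} \<Longrightarrow> \<bar>x t\<bar> \<le> B"
proof -
  have "\<exists>U B. open U \<and> t \<in> U \<and> (\<forall>s\<in>U \<inter> {0..1}. \<bar>x s\<bar> \<le> B)" if t: "t \<in> {0..1}" for t
  proof -
    have "\<exists>b>t. \<exists>B. \<forall>s. t < s \<and> s < b \<and> s \<le> 1 \<longrightarrow> \<bar>x s\<bar> \<le> B"
    proof (cases "t < 1")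
      case True
      then have "(x \<longlongrightarrow> x t) (at_right t)"
        using assms t by (auto simp: cadlag_def)
      then have "\<forall>\<^sub>F s in at_right t. dist (x s) (x t) < 1"
        by (rule tendstoD) simp
      then obtain b where "b > t" "\<forall>s. t < s \<and> s < b \<longrightarrow> dist (x s) (x t) < 1"
        by (auto simp: eventually_at_right_field)
      moreover from this have "\<bar>x s\<bar> \<le> \<bar>x t\<bar> + 1" if "t < s" "s < b" for s
        using that by (smt (verit) dist_real_def)
      ultimately show ?thesis by blast
    next
      case False
      then show ?thesis using t by (intro exI[of _ "t + 1"]) auto
    qed
    then obtain b B where b: "b > t" "\<And>s. t < s \<Longrightarrow> s < b \<Longrightarrow> s \<le> 1 \<Longrightarrow> \<bar>x s\<bar> \<le> B" by blast
    have "\<exists>a<t. \<exists>A. \<forall>s. a < s \<and> s < t \<and> 0 \<le> s \<longrightarrow> \<bar>x s\<bar> \<le> A"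
    proof (cases "0 < t")
      case True
      then obtain l where "(x \<longlongrightarrow> l) (at_left t)"
        using assms t by (force simp: cadlag_def)
      then have "\<forall>\<^sub>F s in at_left t. dist (x s) l < 1"
        by (rule tendstoD) simp
      then obtain a where "a < t" "\<forall>s. a < s \<and> s < t \<longrightarrow> dist (x s) l < 1"
        by (auto simp: eventually_at_left_field)
      moreover from this have "\<bar>x s\<bar> \<le> \<bar>l\<bar> + 1" if "a < s" "s < t" for s
        using that by (smt (verit) dist_real_def)
      ultimately show ?thesis by blast
    next
      case False
      then show ?thesis using t by (intro exI[of _ "t - 1"]) auto
    qed
    then obtain a A where a: "a < t" "\<And>s. a < s \<Longrightarrow> s < t \<Longrightarrow> 0 \<le> s \<Longrightarrow> \<bar>x s\<bar> \<le> A" by blast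
    have "\<bar>x s\<bar> \<le> max (max A B) \<bar>x t\<bar>" if "s \<in> {a<..<b} \<inter> {0..1}" for s
    proof (cases s t rule: linorder_cases)
      case less
      then show ?thesis using a(2)[of s] that by auto
    next
      case greater
      then show ?thesis using b(2)[of s] that by auto
    qed auto
    then show ?thesis using a(1) b(1)
      by (intro exI[of _ "{a<..<b}"] exI[of _ "max (max A B) \<bar>x t\<bar>"]) auto
  qed
  then obtain U B where U: "\<And>t. t \<in> {0..1} \<Longrightarrow> open (U t)" "\<And>t. t \<in> {0..1} \<Longrightarrow> t \<in> U t"
    "\<And>t s. t \<in> {0..1} \<Longrightarrow> s \<in> U t \<inter> {0..1} \<Longrightarrow> \<bar>x s\<bar> \<le> B t"
    by metis
  have "compact {0..1::real}" by simp
  then obtain C where C: "C \<subseteq> {0..1}" "finite C" "{0..1} \<subseteq> (\<Union>t\<in>C. U t)"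
    by (rule compactE_image[of _ "{0..1}" U]) (use U in auto)
  show ?thesis
  proof (rule that)
    fix s :: real assume s: "s \<in> {0..1}"
    then obtain t where t: "t \<in> C" "s \<in> U t" using C by blast
    then have "\<bar>x s\<bar> \<le> B t" using U(3)[of t s] s C(1) by blast
    then have "\<bar>x s\<bar> \<le> \<bar>B t\<bar>" by linarith
    also have "\<dots> \<le> (\<Sum>t\<in>C. \<bar>B t\<bar>)" using t C by (intro member_le_sum) auto
    finally show "\<bar>x s\<bar> \<le> (\<Sum>t\<in>C. \<bar>B t\<bar>)" .
  qed
qed

lemma time_changes_id: "(\<lambda>t. t) \<in> time_changes"
  by (auto simp: time_changes_def strict_mono_on_def)

lemma time_changes_comp:
  assumes "\<sigma> \<in> time_changes" "\<tau> \<in> time_changes"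
  shows "\<sigma> \<circ> \<tau> \<in> time_changes"
proof -
  have s: "strict_mono_on {0..1} \<sigma>" "continuous_on {0..1} \<sigma>" "\<sigma> ` {0..1} = {0..1}"
    and t: "strict_mono_on {0..1} \<tau>" "continuous_on {0..1} \<tau>" "\<tau> ` {0..1} = {0..1}"
    using assms by (simp_all add: time_changes_def)
  have "\<sigma> (\<tau> a) < \<sigma> (\<tau> b)" if "a \<in> {0..1}" "b \<in> {0..1}" "a < b" for a b
  proof (rule strict_mono_onD[OF s(1)])
    show "\<tau> a \<in> {0..1}" "\<tau> b \<in> {0..1}" using t(3) that by blast+
    show "\<tau> a < \<tau> b" using strict_mono_onD[OF t(1)] that by blast
  qed
  then have "strict_mono_on {0..1} (\<sigma> \<circ> \<tau>)" by (simp add: strict_mono_on_def)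
  moreover have "continuous_on {0..1} (\<sigma> \<circ> \<tau>)"
    by (rule continuous_on_compose) (simp_all add: s t)
  moreover have "(\<sigma> \<circ> \<tau>) ` {0..1} = {0..1}"
    by (simp only: image_comp[symmetric] s t)
  ultimately show ?thesis by (simp add: time_changes_def)
qed

lemma time_changes_inverse:
  assumes \<tau>: "\<tau> \<in> time_changes"
  obtains \<sigma> where "\<sigma> \<in> time_changes" "\<And>t. t \<in> {0..1} \<Longrightarrow> \<tau> (\<sigma> t) = t"
proof
  let ?\<sigma> = "inv_into {0..1} \<tau>"
  have m: "strict_mono_on {0..1} \<tau>" and c: "continuous_on {0..1} \<tau>" and im: "\<tau> ` {0..1} = {0..1}"
    using \<tau> by (auto simp: time_changes_def)
  have inj: "inj_on \<tau> {0..1}" by (rule strict_mono_on_imp_inj_on[OF m])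
  show r: "\<tau> (?\<sigma> t) = t" if "t \<in> {0..1}" for t using that im by (simp add: f_inv_into_f)
  have mem: "?\<sigma> t \<in> {0..1}" if "t \<in> {0..1}" for t using that im by (metis inv_into_into)
  have "continuous_on (\<tau> ` {0..1}) ?\<sigma>"
    by (rule continuous_on_inv[OF c]) (auto simp: inj)
  moreover have "?\<sigma> ` {0..1} = {0..1}" using inv_into_image_cancel[OF inj order_refl] im by simp
  moreover have "strict_mono_on {0..1} ?\<sigma>"
  proof (rule strict_mono_onI)
    fix s t :: real assume st: "s \<in> {0..1}" "t \<in> {0..1}" "s < t"
    have "\<tau> (?\<sigma> s) < \<tau> (?\<sigma> t)" using r st by simp
    then show "?\<sigma> s < ?\<sigma> t" using strict_mono_on_less[OF m] mem st by blast
  qed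
  ultimately show "?\<sigma> \<in> time_changes" using im by (simp add: time_changes_def)
qed

definition skorokhod_close :: "(real \<Rightarrow> real) \<Rightarrow> (real \<Rightarrow> real) \<Rightarrow> real set" where
  "skorokhod_close x y =
    {e. 0 < e \<and> (\<exists>\<tau>\<in>time_changes. \<forall>t\<in>{0..1}. \<bar>\<tau> t - t\<bar> \<le> e \<and> \<bar>x t - y (\<tau> t)\<bar> \<le> e)}"

lemma skorokhod_closeI:
  assumes "0 < e" "\<tau> \<in> time_changes"
    and "\<And>t. t \<in> {0..1} \<Longrightarrow> \<bar>\<tau> t - t\<bar> \<le> e \<and> \<bar>x t - y (\<tau> t)\<bar> \<le> e"
  shows "e \<in> skorokhod_close x y"
  using assms unfolding skorokhod_close_def by blast

lemma skorokhod_closeE: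
  assumes "e \<in> skorokhod_close x y"
  obtains \<tau> where "0 < e" "\<tau> \<in> time_changes"
    "\<And>t. t \<in> {0..1} \<Longrightarrow> \<bar>\<tau> t - t\<bar> \<le> e \<and> \<bar>x t - y (\<tau> t)\<bar> \<le> e"
  using assms unfolding skorokhod_close_def by blast

lemma skorokhod_close_symD:
  assumes "e \<in> skorokhod_close x y" shows "e \<in> skorokhod_close y x"
proof -
  from assms obtain \<tau> where e: "0 < e" and \<tau>: "\<tau> \<in> time_changes"
    "\<And>t. t \<in> {0..1} \<Longrightarrow> \<bar>\<tau> t - t\<bar> \<le> e \<and> \<bar>x t - y (\<tau> t)\<bar> \<le> e"
    using skorokhod_closeE by blast
  obtain \<sigma> where \<sigma>: "\<sigma> \<in> time_changes" "\<And>t. t \<in> {0..1} \<Longrightarrow> \<tau> (\<sigma> t) = t"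
    using time_changes_inverse[OF \<tau>(1)] by blast
  have "\<sigma> t \<in> {0..1}" if "t \<in> {0..1}" for t using \<sigma>(1) that unfolding time_changes_def by blast
  then have "\<bar>\<sigma> t - t\<bar> \<le> e \<and> \<bar>y t - x (\<sigma> t)\<bar> \<le> e" if "t \<in> {0..1}" for t
    using \<tau>(2)[of "\<sigma> t"] \<sigma>(2) that by (simp add: abs_minus_commute)
  with e \<sigma>(1) show ?thesis by (rule skorokhod_closeI)
qed

lemma skorokhod_close_add:
  assumes "a \<in> skorokhod_close x y" "b \<in> skorokhod_close y z"
  shows "a + b \<in> skorokhod_close x z"
proof -
  from assms obtain \<sigma> \<tau> where ab: "0 < a" "0 < b" and \<sigma>: "\<sigma> \<in> time_changes"
    "\<And>t. t \<in> {0..1} \<Longrightarrow> \<bar>\<sigma> t - t\<bar> \<le> a \<and> \<bar>x t - y (\<sigma> t)\<bar> \<le> a"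
    and \<tau>: "\<tau> \<in> time_changes"
    "\<And>t. t \<in> {0..1} \<Longrightarrow> \<bar>\<tau> t - t\<bar> \<le> b \<and> \<bar>y t - z (\<tau> t)\<bar> \<le> b"
    unfolding skorokhod_close_def by blast
  have *: "\<sigma> t \<in> {0..1}" if "t \<in> {0..1}" for t using \<sigma>(1) that unfolding time_changes_def by blast
  have "\<bar>(\<tau> \<circ> \<sigma>) t - t\<bar> \<le> a + b \<and> \<bar>x t - z ((\<tau> \<circ> \<sigma>) t)\<bar> \<le> a + b" if "t \<in> {0..1}" for t
    using \<tau>(2)[OF *[OF that]] \<sigma>(2)[OF that] unfolding comp_apply by linarith
  with add_pos_pos[OF ab] time_changes_comp[OF \<tau>(1) \<sigma>(1)] show ?thesis by (rule skorokhod_closeI)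
qed

lemma skorokhod_close_nonempty:
  assumes "x \<in> cadlag" "y \<in> cadlag"
  shows "skorokhod_close x y \<noteq> {}"
proof -
  obtain A where A: "\<And>t. t \<in> {0..1} \<Longrightarrow> \<bar>x t\<bar> \<le> A" using cadlag_bounded[OF assms(1)] by blast
  obtain B where B: "\<And>t. t \<in> {0..1} \<Longrightarrow> \<bar>y t\<bar> \<le> B" using cadlag_bounded[OF assms(2)] by blast
  have "0 \<le> A" "0 \<le> B" using A[of 0] B[of 0] by auto
  moreover have "\<bar>x t - y t\<bar> \<le> A + B + 1" if "t \<in> {0..1}" for t using A[OF that] B[OF that] by linarith
  ultimately have "A + B + 1 \<in> skorokhod_close x y"
    by (intro skorokhod_closeI[OF _ time_changes_id]) auto
  then show ?thesis by blast
qed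

lemma skorokhod_close_bdd_below: "bdd_below (skorokhod_close x y)"
  by (rule bdd_belowI[of _ 0]) (simp add: skorokhod_close_def)

lemma skorokhod_dist_eq:
  "x \<in> cadlag \<Longrightarrow> y \<in> cadlag \<Longrightarrow> skorokhod_dist x y = Inf (skorokhod_close x y)"
  by (simp add: skorokhod_dist_def skorokhod_close_def)

lemma skorokhod_dist_nonneg: "0 \<le> skorokhod_dist x y"
proof (cases "x \<in> cadlag \<and> y \<in> cadlag")
  case True
  then show ?thesis
    using cInf_greatest[OF skorokhod_close_nonempty, of x y 0] skorokhod_closeE less_imp_le
    unfolding skorokhod_dist_eq[OF conjunct1[OF True] conjunct2[OF True]] by metis
qed (auto simp: skorokhod_dist_def)

lemma skorokhod_dist_commute: "skorokhod_dist x y = skorokhod_dist y x"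
proof -
  have "skorokhod_close x y = skorokhod_close y x" using skorokhod_close_symD by blast
  then show ?thesis
    unfolding skorokhod_dist_def skorokhod_close_def[symmetric] by simp
qed

lemma skorokhod_dist_less_imp_close:
  assumes "x \<in> cadlag" "y \<in> cadlag" "skorokhod_dist x y < r"
  obtains e where "e \<in> skorokhod_close x y" "e < r"
  using cInf_lessD[OF skorokhod_close_nonempty[OF assms(1,2)], of r] assms(3)
  unfolding skorokhod_dist_eq[OF assms(1,2)] by blast

lemma skorokhod_dist_triangle:
  assumes "x \<in> cadlag" "y \<in> cadlag" "z \<in> cadlag"
  shows "skorokhod_dist x z \<le> skorokhod_dist x y + skorokhod_dist y z"
proof (rule field_le_epsilon)
  fix r :: real assume r: "r > 0"
  obtain a where a: "a \<in> skorokhod_close x y" "a < skorokhod_dist x y + r / 2"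
    by (rule skorokhod_dist_less_imp_close[OF assms(1,2), of "skorokhod_dist x y + r / 2"]) (use r in auto)
  obtain b where b: "b \<in> skorokhod_close y z" "b < skorokhod_dist y z + r / 2"
    by (rule skorokhod_dist_less_imp_close[OF assms(2,3), of "skorokhod_dist y z + r / 2"]) (use r in auto)
  have "skorokhod_dist x z \<le> a + b"
    unfolding skorokhod_dist_eq[OF assms(1,3)]
    by (rule cInf_lower[OF skorokhod_close_add[OF a(1) b(1)] skorokhod_close_bdd_below])
  then show "skorokhod_dist x z \<le> skorokhod_dist x y + skorokhod_dist y z + r"
    using a(2) b(2) by linarith
qed

lemma skorokhod_dist_eq_0:
  assumes x: "x \<in> cadlag" and y: "y \<in> cadlag" and 0: "skorokhod_dist x y = 0"
  shows "x = y"
proof (rule extensionalityI[of _ "{0..1}"])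
  fix t :: real assume t: "t \<in> {0..1}"
  show "x t = y t"
  proof (rule ccontr)
    assume "x t \<noteq> y t"
    define r where "r = \<bar>x t - y t\<bar> / 3"
    have r: "r > 0" using \<open>x t \<noteq> y t\<close> by (simp add: r_def)
    show False
    proof (cases "t < 1")
      case True
      have "(x \<longlongrightarrow> x t) (at_right t)" "(y \<longlongrightarrow> y t) (at_right t)"
        using x y t True by (auto simp: cadlag_def)
      then have "\<forall>\<^sub>F s in at_right t. dist (x s) (x t) < r \<and> dist (y s) (y t) < r"
        using r by (intro eventually_conj tendstoD)
      then obtain b where b: "b > t"
        "\<And>s. t < s \<Longrightarrow> s < b \<Longrightarrow> dist (x s) (x t) < r \<and> dist (y s) (y t) < r"
        by (auto simp: eventually_at_right_field)
      define d where "d = min (b - t) (1 - t)"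
      have d: "d > 0" "t + d \<le> b" "t + d \<le> 1" using b True by (auto simp: d_def)
      obtain e where "e \<in> skorokhod_close x y" and e: "e < min r (d / 2)"
        by (rule skorokhod_dist_less_imp_close[OF x y, of "min r (d / 2)"]) (use 0 r d in auto)
      then obtain \<tau> where \<tau>: "\<And>s. s \<in> {0..1} \<Longrightarrow> \<bar>\<tau> s - s\<bar> \<le> e \<and> \<bar>x s - y (\<tau> s)\<bar> \<le> e"
        using skorokhod_closeE by blast
      define s where "s = t + d / 2"
      have s: "s \<in> {0..1}" "t < s" "s < b" using t d by (auto simp: s_def)
      have e': "e < r" "e < d / 2" using e by auto
      have ts: "\<bar>\<tau> s - s\<bar> \<le> e" "\<bar>x s - y (\<tau> s)\<bar> \<le> e" using \<tau>[OF s(1)] by auto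
      have "t < \<tau> s" using ts e' unfolding s_def by linarith
      moreover have "\<tau> s < b" using ts e' d unfolding s_def by linarith
      ultimately have "\<bar>y (\<tau> s) - y t\<bar> < r" using b(2) unfolding dist_real_def by blast
      moreover have "\<bar>x s - x t\<bar> < r" using b(2)[OF s(2,3)] unfolding dist_real_def by blast
      moreover have "\<bar>x s - y (\<tau> s)\<bar> < r" using ts e' by linarith
      ultimately
      have "\<bar>x t - y t\<bar> < 3 * r" by linarith
      then show False by (simp add: r_def)
    next
      case False
      then have t1: "t = 1" using t by simp
      obtain e where "e \<in> skorokhod_close x y" and e: "e < r"
        by (rule skorokhod_dist_less_imp_close[OF x y, of r]) (use 0 r in auto)
      then obtain \<tau> where \<tau>: "\<tau> \<in> time_changes" and
        close: "\<And>s. s \<in> {0..1} \<Longrightarrow> \<bar>\<tau> s - s\<bar> \<le> e \<and> \<bar>x s - y (\<tau> s)\<bar> \<le> e"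
        using skorokhod_closeE by blast
      have xy: "\<bar>x 1 - y (\<tau> 1)\<bar> \<le> e" using close[of 1] by simp
      obtain u where u: "u \<in> {0..1}" "\<tau> u = 1"
      proof -
        have "1 \<in> \<tau> ` {0..1}" using \<tau> by (simp add: time_changes_def)
        then show ?thesis using that by (metis imageE)
      qed
      have "\<tau> 1 \<in> \<tau> ` {0..1}" by simp
      then have "\<tau> 1 \<in> {0..1}" using \<tau> unfolding time_changes_def by blast
      moreover have "\<tau> u \<le> \<tau> 1"
        using \<tau> u(1) strict_mono_on_leD[of "{0..1}" \<tau> u 1] by (auto simp: time_changes_def)
      ultimately have "\<tau> 1 = 1" using u(2) by simp
      then show False using xy e t1 r by (simp add: r_def)
    qed
  qed
qed (use x y in \<open>auto simp: cadlag_def\<close>)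

global_interpretation skorokhod: Metric_space cadlag skorokhod_dist
proof
  fix x y z :: "real \<Rightarrow> real"
  show "0 \<le> skorokhod_dist x y" by (rule skorokhod_dist_nonneg)
  show "skorokhod_dist x y = skorokhod_dist y x" by (rule skorokhod_dist_commute)
  show "skorokhod_dist x z \<le> skorokhod_dist x y + skorokhod_dist y z"
    if "x \<in> cadlag" "y \<in> cadlag" "z \<in> cadlag"
    using that by (rule skorokhod_dist_triangle)
  show "skorokhod_dist x y = 0 \<longleftrightarrow> x = y" if xy: "x \<in> cadlag" "y \<in> cadlag"
  proof
    assume "x = y"
    have "skorokhod_dist x x \<le> r" if "r > 0" for r
    proof -
      have "r \<in> skorokhod_close x x"
        using that by (intro skorokhod_closeI[OF _ time_changes_id]) auto
      then show ?thesis
        unfolding skorokhod_dist_eq[OF xy(1) xy(1)] by (rule cInf_lower[OF _ skorokhod_close_bdd_below])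
    qed
    then have "skorokhod_dist x x \<le> 0" by (rule dense_ge)
    then show "skorokhod_dist x y = 0" using skorokhod_dist_nonneg[of x x] \<open>x = y\<close> by simp
  qed (rule skorokhod_dist_eq_0[OF xy])
qed

abbreviation skorokhod_topology :: "(real \<Rightarrow> real) topology" where
  "skorokhod_topology \<equiv> skorokhod.mtopology"

definition borel_of :: "'s topology \<Rightarrow> 's measure" where
  "borel_of T = sigma (topspace T) {U. openin T U}"

text \<open>Weak convergence of the laws of random elements \<open>Y n\<close> on \<open>M\<close> to the law of the random
  element \<open>L\<close> on a possibly different probability space \<open>N\<close>.\<close>

definition converges_in_distribution ::
  "'s topology \<Rightarrow> 'a measure \<Rightarrow> (nat \<Rightarrow> 'a \<Rightarrow> 's) \<Rightarrow> 'b measure \<Rightarrow> ('b \<Rightarrow> 's) \<Rightarrow> bool" where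
  "converges_in_distribution T M Y N L \<longleftrightarrow>
     (\<forall>n. Y n \<in> measurable M (borel_of T)) \<and> L \<in> measurable N (borel_of T) \<and>
     (\<forall>g. continuous_map T euclideanreal g \<and> bounded (g ` topspace T) \<longrightarrow>
        (\<lambda>n. LINT \<omega>|M. g (Y n \<omega>)) \<longlonglongrightarrow> (LINT \<omega>|N. g (L \<omega>)))"

definition ar_coeff :: "real \<Rightarrow> real \<Rightarrow> nat \<Rightarrow> real" where
  "ar_coeff \<gamma> \<beta> n = 1 - \<gamma> / real n powr \<beta>"

text \<open>\<open>X j n\<close> is \<open>X\<^bsub>j,n\<^esub>\<close>. The row index \<open>n\<close> starts at 1 and the innovations \<open>\<epsilon> j\<close> at \<open>j = 1\<close>.
  The law of \<open>X 0 n\<close> is the one for which the recursion has a stationary solution, and assumption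
  \<open>indep\<close> is the joint independence of \<open>X 0 n, \<epsilon> 1, \<epsilon> 2, \<dots>\<close>, that is, the innovations are
  independent of each other and, as a sequence, of \<open>X 0 n\<close>.\<close>

locale nearly_unstable_ar1 = prob_space M
  for M :: "'a measure" +
  fixes \<gamma> \<beta> :: real and \<sigma> :: "nat \<Rightarrow> real"
    and \<epsilon> :: "nat \<Rightarrow> 'a \<Rightarrow> real" and X :: "nat \<Rightarrow> nat \<Rightarrow> 'a \<Rightarrow> real"
  assumes gamma: "0 < \<gamma>" "\<gamma> < 1"
    and beta: "1 < \<beta>"
    and sigma_pos: "\<And>n. 1 \<le> n \<Longrightarrow> 0 < \<sigma> n"
    and innovations_normal: "\<And>j. 1 \<le> j \<Longrightarrow> distributed M lborel (\<epsilon> j) std_normal_density"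
    and X_measurable: "\<And>j n. 1 \<le> n \<Longrightarrow> random_variable borel (X j n)"
    and initial_normal: "\<And>n. 1 \<le> n \<Longrightarrow>
          distributed M lborel (X 0 n)
            (normal_density 0 (sqrt ((\<sigma> n)\<^sup>2 / (1 - (ar_coeff \<gamma> \<beta> n)\<^sup>2))))"
    and indep: "\<And>n. 1 \<le> n \<Longrightarrow>
          indep_vars (\<lambda>_. borel) (\<lambda>j. if j = 0 then X 0 n else \<epsilon> j) UNIV"
    and recursion: "\<And>j n. 1 \<le> n \<Longrightarrow> 1 \<le> j \<Longrightarrow>
          AE \<omega> in M. X j n \<omega> = ar_coeff \<gamma> \<beta> n * X (j - 1) n \<omega> + \<sigma> n * \<epsilon> j \<omega>"

definition additive_functional ::
  "(nat \<Rightarrow> nat \<Rightarrow> 'a \<Rightarrow> real) \<Rightarrow> (real \<Rightarrow> real) \<Rightarrow> nat \<Rightarrow> real \<Rightarrow> 'a \<Rightarrow> real" where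
  "additive_functional X f n t \<omega> = (\<Sum>k=1..nat \<lfloor>real n * t\<rfloor>. f (X k n \<omega>))"

definition standardized_functional ::
  "'a measure \<Rightarrow> (nat \<Rightarrow> nat \<Rightarrow> 'a \<Rightarrow> real) \<Rightarrow> (real \<Rightarrow> real) \<Rightarrow> nat \<Rightarrow> 'a \<Rightarrow> real \<Rightarrow> real" where
  "standardized_functional M X f n \<omega> =
     (\<lambda>t\<in>{0..1}. (additive_functional X f n t \<omega> - prob_space.expectation M (additive_functional X f n t))
        / sqrt (prob_space.variance M (additive_functional X f n 1)))"

definition linear_path :: "('b \<Rightarrow> real) \<Rightarrow> 'b \<Rightarrow> real \<Rightarrow> real" where
  "linear_path W \<omega> = (\<lambda>t\<in>{0..1}. t * W \<omega>)"

end

theory Submission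
  imports Defs "HOL-Computational_Algebra.Polynomial"
begin

text \<open>
  Divided by its stationary standard deviation \<open>s\<^sub>n\<close>, row \<open>n\<close> of the process is a standard normal
  sequence whose correlation over \<open>k \<le> n\<close> steps is \<open>\<alpha>\<^sub>n\<^sup>k \<ge> 1 - \<gamma> n powr (1 - \<beta>)\<close>. Since \<open>\<beta> > 1\<close> this tends
  to 1, so the whole row is asymptotically one standard normal variable \<open>Y\<^sub>n\<close>, repeated \<open>n\<close> times.
  Hence a sum over \<open>\<lfloor>n t\<rfloor>\<close> terms behaves like \<open>n t\<close> times a single term, and the standardized path is
  close to the line with slope \<open>g (Y\<^sub>n)\<close>, where \<open>g\<close> is the mean-square limit of the standardized
  functions \<open>y \<mapsto> f (s\<^sub>n y)\<close>. Lemma \<open>X_std_L2_increment\<close> makes the first assertion quantitative for every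
  square-integrable function, and \<open>standardized_functional_converges\<close> is the resulting general limit
  theorem, which reduces everything to the existence of \<open>g\<close>.

  The law of \<open>g (Y\<^sub>n)\<close> is the same for all \<open>n\<close>. This is what allows one to pass from mean-square
  closeness to weak convergence although a continuous functional on the Skorokhod space need not be
  uniformly continuous: the paths at which its modulus of continuity is bad form an event whose
  probability does not depend on \<open>n\<close> and can be made small (\<open>converges_in_distribution_to_line\<close>).

  The three regimes differ only in the identification of \<open>g\<close>. If \<open>s\<^sub>n \<rightarrow> \<infinity>\<close>, the highest power of a
  polynomial \<open>f\<close> dominates; if \<open>s\<^sub>n \<rightarrow> 0\<close>, the lowest nonconstant power dominates
  (\<open>dominant_power_converges\<close>); if \<open>s\<^sub>n = 1\<close>, then \<open>g\<close> is \<open>f\<close> itself, centred and scaled. Hermite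
  polynomials enter when \<open>g\<close> is expanded. A centred power \<open>x\<^sup>w\<close> involves only orders between 1 and \<open>w\<close>
  of the parity of \<open>w\<close>, which gives the sums in the first and third case; the order of the dominating
  power in the third case is \<open>m_star\<close>, because the defining sum of \<open>m_star\<close> is a positive multiple of the
  coefficient of \<open>x\<^sup>w\<close> in \<open>f\<close> (\<open>sum_hermite_D\<close>). The series in the second case requires that the Hermite
  polynomials are complete in \<open>L\<^sup>2(N(0,1))\<close> (\<open>hermite_expansion\<close>); completeness also provides the density of
  polynomials on which \<open>X_std_L2_increment\<close> rests.
\<close>

section \<open>Hermite polynomials and monomials\<close>

fun hermite_polynomial :: "nat \<Rightarrow> real poly" where
  "hermite_polynomial 0 = 1"
| "hermite_polynomial (Suc 0) = [:0, 1:]"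
| "hermite_polynomial (Suc (Suc q)) =
     pCons 0 (hermite_polynomial (Suc q)) - smult (real (Suc q)) (hermite_polynomial q)"

lemma poly_hermite_polynomial: "poly (hermite_polynomial q) x = hermite q x"
  by (induction q rule: hermite_polynomial.induct) auto

lemma coeff_hermite_polynomial_eq_0:
  "odd (q + w) \<or> q < w \<Longrightarrow> coeff (hermite_polynomial q) w = 0"
proof (induction q arbitrary: w rule: hermite_polynomial.induct)
  case 1
  then show ?case by (cases w) auto
next
  case 2
  then show ?case by (cases w; cases "w - 1") auto
next
  case (3 q)
  have "coeff (hermite_polynomial q) w = 0"
    using 3(3) by (intro 3(2)) auto
  moreover have "coeff (pCons 0 (hermite_polynomial (Suc q))) w = 0"
  proof (cases w)
    case (Suc v)
    have "coeff (hermite_polynomial (Suc q)) v = 0"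
      using 3(3) unfolding Suc by (intro 3(1)) auto
    then show ?thesis by (simp add: Suc)
  qed simp
  ultimately show ?case
    unfolding hermite_polynomial.simps coeff_diff coeff_smult by simp
qed

text \<open>Writing the degree as \<open>w + 2 * u\<close> keeps all factorials free of truncated subtraction. The induction
  is on the degree, along the three-term recurrence, and decreases \<open>w\<close> or \<open>u\<close>.\<close>

lemma coeff_hermite_polynomial:
  "coeff (hermite_polynomial (w + 2 * u)) w = (-1) ^ u * (fact (w + 2 * u) / (fact u * fact w * 2 ^ u))"
proof (induction "w + 2 * u" arbitrary: w u rule: less_induct)
  case less
  show ?case
  proof (cases u)
    case 0
    then show ?thesis
    proof (cases w)
      case 0
      then show ?thesis using \<open>u = 0\<close> by simp
    next
      case w: (Suc v)
      show ?thesis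
      proof (cases v)
        case (Suc v')
        have "coeff (hermite_polynomial (v + 2 * 0)) v = 1"
          using less.hyps[of v 0] w 0 by simp
        then show ?thesis
          using Suc w 0 by (simp add: coeff_hermite_polynomial_eq_0)
      qed (use w 0 in simp)
    qed
  next
    case u: (Suc u')
    have q: "w + 2 * u = Suc (Suc (w + 2 * u'))" using u by simp
    have IH: "coeff (hermite_polynomial (w + 2 * u')) w
        = (-1) ^ u' * (fact (w + 2 * u') / (fact u' * fact w * 2 ^ u'))"
      by (rule less.hyps) (simp add: u)
    show ?thesis
    proof (cases w)
      case 0
      show ?thesis
      proof -
        define A C where "A = (fact (2 * u') :: real)" and "C = (fact u' :: real)"
        have nz: "A \<noteq> 0" "C \<noteq> 0" by (simp_all add: A_def C_def)
        have ff: "fact (Suc (Suc (2 * u'))) = (2 * real u' + 2) * (2 * real u' + 1) * A"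
          "fact u = (real u' + 1) * C"
          by (simp_all add: A_def C_def u algebra_simps)
        have "coeff (hermite_polynomial (w + 2 * u)) w
            = - (2 * real u' + 1) * coeff (hermite_polynomial (w + 2 * u')) w"
          unfolding q by (simp add: 0 algebra_simps)
        also have "\<dots> = (-1) ^ u * (fact (w + 2 * u) / (fact u * fact w * 2 ^ u))"
          unfolding IH q using nz unfolding 0 add_0 ff A_def[symmetric] C_def[symmetric]
          by (simp add: u divide_simps) (simp add: algebra_simps)
        finally show ?thesis .
      qed
    next
      case (Suc v)
      have IH': "coeff (hermite_polynomial (v + 2 * u)) v
          = (-1) ^ u * (fact (v + 2 * u) / (fact u * fact v * 2 ^ u))"
        by (rule less.hyps) (simp add: u Suc)
      have e: "v + 2 * u = Suc (w + 2 * u')" using u Suc by simp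
      have ff: "fact (Suc (Suc (w + 2 * u'))) = (real (w + 2 * u') + 2) * (real (w + 2 * u') + 1) * fact (w + 2 * u')"
        "fact (Suc (w + 2 * u')) = (real (w + 2 * u') + 1) * (fact (w + 2 * u') :: real)"
        "fact w = (real v + 1) * (fact v :: real)" "fact u = (real u' + 1) * (fact u' :: real)"
        by (simp_all add: Suc u algebra_simps)
      define A B C where "A = (fact (w + 2 * u') :: real)" and "B = (fact v :: real)" and "C = (fact u' :: real)"
      have nz': "real v + 1 \<noteq> 0" "real u' + 1 \<noteq> 0" by linarith+
      have nz: "A \<noteq> 0" "B \<noteq> 0" "C \<noteq> 0" by (simp_all add: A_def B_def C_def)
      have "coeff (hermite_polynomial (w + 2 * u)) w
          = coeff (hermite_polynomial (Suc (w + 2 * u'))) v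
            - (real (w + 2 * u') + 1) * coeff (hermite_polynomial (w + 2 * u')) w"
        unfolding q by (simp add: Suc add.commute)
      also have "\<dots> = (-1) ^ u * (fact (w + 2 * u) / (fact u * fact w * 2 ^ u))"
        unfolding IH IH'[unfolded e] q ff A_def[symmetric] B_def[symmetric] C_def[symmetric]
        using nz nz' by (simp add: u Suc divide_simps) (simp add: algebra_simps)
      finally show ?thesis .
    qed
  qed
qed

lemma hermite_uminus: "hermite q (- x) = (-1) ^ q * hermite q x"
  by (induction q x rule: hermite.induct) (auto simp: algebra_simps)

text \<open>The Hermite polynomials are monic with one polynomial in each degree, so leading terms can be
  removed one after the other.\<close>

lemma polynomial_hermite_expansion:
  assumes "degree F \<le> p"
  shows "\<exists>a. \<forall>x. poly F x = (\<Sum>q\<le>p. a q * hermite q x)"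
  using assms
proof (induction p arbitrary: F)
  case 0
  then obtain k where "F = [:k:]" by (metis le_zero_eq degree_eq_zeroE)
  then show ?case by (intro exI[of _ "\<lambda>_. k"]) simp
next
  case (Suc p)
  let ?k = "coeff F (Suc p)"
  define G where "G = F - smult ?k (hermite_polynomial (Suc p))"
  have "coeff G i = 0" if "p < i" for i
  proof (cases "i = Suc p")
    case True
    then show ?thesis using coeff_hermite_polynomial[of "Suc p" 0] by (simp add: G_def)
  next
    case False
    then have "Suc p < i" using that by simp
    then show ?thesis using Suc.prems
      by (simp add: G_def coeff_hermite_polynomial_eq_0 coeff_eq_0)
  qed
  then have "degree G \<le> p" by (intro degree_le) auto
  then obtain a where a: "\<And>x. poly G x = (\<Sum>q\<le>p. a q * hermite q x)" using Suc.IH by blast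
  have "poly F x = (\<Sum>q\<le>Suc p. (a(Suc p := ?k)) q * hermite q x)" for x
  proof -
    have "poly F x = poly G x + ?k * hermite (Suc p) x"
      by (simp add: G_def poly_hermite_polynomial)
    then show ?thesis by (simp add: a)
  qed
  then show ?case by blast
qed

text \<open>The parity restriction comes for free from any expansion: average it with its reflection \<open>x \<mapsto> -x\<close>,
  under which the terms of the wrong parity cancel.\<close>

lemma power_hermite_expansion:
  "\<exists>a. \<forall>x::real. x ^ p = (\<Sum>q\<le>p. a q * hermite q x) \<and> (\<forall>q. odd (p + q) \<longrightarrow> a q = 0)"
proof -
  have "degree (monom (1::real) p) \<le> p" by (rule degree_monom_le)
  from polynomial_hermite_expansion[OF this]
  obtain a where a: "\<And>x. x ^ p = (\<Sum>q\<le>p. a q * hermite q x)" by (auto simp: poly_monom)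
  define a' where "a' q = (if even (p + q) then a q else 0)" for q
  have "x ^ p = (\<Sum>q\<le>p. a' q * hermite q x)" for x
  proof -
    have "2 * x ^ p = x ^ p + (-1) ^ p * (- x) ^ p"
      by (simp flip: power_mult_distrib)
    also have "\<dots> = (\<Sum>q\<le>p. a q * hermite q x + (-1) ^ p * (a q * hermite q (- x)))"
      unfolding a by (simp add: sum.distrib sum_distrib_left)
    also have "\<dots> = (\<Sum>q\<le>p. 2 * (a' q * hermite q x))"
      by (intro sum.cong refl) (auto simp: a'_def hermite_uminus uminus_power_if)
    finally show ?thesis by (simp flip: sum_distrib_left)
  qed
  then show ?thesis by (intro exI[of _ a']) (auto simp: a'_def)
qed

definition hermite_sum :: "(nat \<Rightarrow> real) \<Rightarrow> nat \<Rightarrow> nat \<Rightarrow> real poly" where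
  "hermite_sum c m p = (\<Sum>q=m..p. smult (c q) (hermite_polynomial q))"

lemma poly_hermite_sum: "poly (hermite_sum c m p) = hermite_poly c m p"
  by (rule ext) (simp add: hermite_sum_def hermite_poly_def poly_sum poly_hermite_polynomial)

lemma coeff_hermite_sum:
  "coeff (hermite_sum c m p) w = (\<Sum>q=m..p. c q * coeff (hermite_polynomial q) w)"
  by (simp add: hermite_sum_def coeff_sum)

lemma degree_hermite_sum: "degree (hermite_sum c m p) \<le> p"
  by (rule degree_le) (simp add: coeff_hermite_sum coeff_hermite_polynomial_eq_0)

lemma coeff_hermite_sum_top:
  assumes "m \<le> p"
  shows "coeff (hermite_sum c m p) p = c p"
proof -
  have "coeff (hermite_sum c m p) p = (\<Sum>q\<in>{p}. c q * coeff (hermite_polynomial q) p)"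
    unfolding coeff_hermite_sum
    by (rule sum.mono_neutral_right) (use assms in \<open>auto simp: coeff_hermite_polynomial_eq_0\<close>)
  then show ?thesis using coeff_hermite_polynomial[of p 0] by simp
qed

text \<open>Only degrees \<open>q = w + 2 * u\<close> contribute to the coefficient of \<open>x\<^sup>w\<close>; indexing by \<open>u\<close> gives the inner
  sum in the definition of \<open>hermite_D\<close>.\<close>

lemma coeff_hermite_sum_alt:
  "coeff (hermite_sum c m p) w =
    (\<Sum>u=0..p div 2. if m \<le> w + 2 * u \<and> w + 2 * u \<le> p
       then c (w + 2 * u) * coeff (hermite_polynomial (w + 2 * u)) w else 0)"
proof -
  let ?U = "{u \<in> {0..p div 2}. m \<le> w + 2 * u \<and> w + 2 * u \<le> p}"
  have "coeff (hermite_sum c m p) w = (\<Sum>q\<in>(\<lambda>u. w + 2 * u) ` ?U. c q * coeff (hermite_polynomial q) w)"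
    unfolding coeff_hermite_sum
  proof (rule sum.mono_neutral_right)
    show "\<forall>q\<in>{m..p} - (\<lambda>u. w + 2 * u) ` ?U. c q * coeff (hermite_polynomial q) w = 0"
    proof
      fix q assume q: "q \<in> {m..p} - (\<lambda>u. w + 2 * u) ` ?U"
      have "odd (q + w) \<or> q < w"
      proof (rule ccontr)
        assume "\<not> ?thesis"
        then have "w \<le> q" "even (q + w)" by auto
        then obtain u where "q = w + 2 * u" by (metis even_diff_nat evenE le_add_diff_inverse not_less)
        then have "q \<in> (\<lambda>u. w + 2 * u) ` ?U" using q by auto
        then show False using q by simp
      qed
      then show "c q * coeff (hermite_polynomial q) w = 0"
        by (simp add: coeff_hermite_polynomial_eq_0)
    qed
  qed auto
  also have "\<dots> = (\<Sum>u\<in>?U. c (w + 2 * u) * coeff (hermite_polynomial (w + 2 * u)) w)"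
    by (subst sum.reindex) (auto simp: inj_on_def)
  also have "\<dots> = (\<Sum>u=0..p div 2. if m \<le> w + 2 * u \<and> w + 2 * u \<le> p
       then c (w + 2 * u) * coeff (hermite_polynomial (w + 2 * u)) w else 0)"
    by (subst sum.inter_filter) auto
  finally show ?thesis .
qed

text \<open>The summand of \<open>hermite_D\<close> is the coefficient of \<open>\<sigma>\<^sup>w H\<^sub>r(y)\<close> contributed by \<open>H\<^bsub>w+2u\<^esub>(\<sigma> y)\<close>. Computing
  the same quantity through powers of \<open>\<sigma> y\<close> factorizes it: the first factor is the coefficient of
  \<open>x\<^sup>w\<close> in \<open>H\<^bsub>w+2u\<^esub>\<close>, the second is the coefficient of \<open>H\<^sub>r\<close> in \<open>x\<^sup>w\<close>, where \<open>r = w - 2 * s\<close>.\<close>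

lemma hermite_C_factor:
  assumes "2 * s \<le> w"
  shows "hermite_C (w + 2 * u) (s + u) * real ((s + u) choose s) * (-1) ^ u
    = coeff (hermite_polynomial (w + 2 * u)) w * hermite_C w s"
proof -
  have "(s + u) choose s = fact (s + u) / (fact s * fact u :: real)"
    by (simp add: binomial_fact)
  moreover have "w + 2 * u - 2 * (s + u) = w - 2 * s" using assms by simp
  ultimately show ?thesis
    unfolding coeff_hermite_polynomial hermite_C_def by (simp add: field_simps power_add)
qed

text \<open>The second factor is positive: its terms are nonnegative, and the one for \<open>s = 0\<close> is positive. Consequently the sum that defines
  \<open>m_star\<close> detects exactly whether \<open>x\<^sup>w\<close> occurs in the polynomial.\<close>

lemma sum_hermite_D:
  assumes "1 \<le> w" "w \<le> p"
  shows "(\<Sum>r=1..p. hermite_D c m p w r)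
    = coeff (hermite_sum c m p) w * (\<Sum>s=0..p div 2. if 2 * s < w then hermite_C w s else 0)"
proof -
  define I where "I s = (\<Sum>u=0..p div 2. if m \<le> w + 2 * u \<and> w + 2 * u \<le> p then
           c (w + 2 * u) * hermite_C (w + 2 * u) (s + u) * real ((s + u) choose s) * (-1) ^ u
         else 0)" for s
  have I: "I s = coeff (hermite_sum c m p) w * hermite_C w s" if "2 * s < w" for s
    unfolding I_def coeff_hermite_sum_alt sum_distrib_right
    using hermite_C_factor[of s w] that by (intro sum.cong refl) (simp add: mult.assoc)
  have "(\<Sum>r=1..p. hermite_D c m p w r) = (\<Sum>s=0..p div 2. \<Sum>r=1..p. if w = 2 * s + r then I s else 0)"
    unfolding hermite_D_def I_def[symmetric] by (rule sum.swap)
  also have "\<dots> = (\<Sum>s=0..p div 2. if 2 * s < w then I s else 0)"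
  proof (rule sum.cong[OF refl])
    fix s
    show "(\<Sum>r=1..p. if w = 2 * s + r then I s else 0) = (if 2 * s < w then I s else 0)"
    proof (cases "2 * s < w")
      case True
      have "(\<Sum>r=1..p. if w = 2 * s + r then I s else 0) = (\<Sum>r=1..p. if r = w - 2 * s then I s else 0)"
        using True by (intro sum.cong refl) auto
      moreover have "w - 2 * s \<in> {1..p}" using True assms by auto
      ultimately show ?thesis using True by (simp only: sum.delta finite_atLeastAtMost if_True)
    qed (auto intro!: sum.neutral)
  qed
  also have "\<dots> = coeff (hermite_sum c m p) w * (\<Sum>s=0..p div 2. if 2 * s < w then hermite_C w s else 0)"
    unfolding sum_distrib_left by (intro sum.cong refl) (simp add: I)
  finally show ?thesis .
qed

lemma sum_hermite_D_eq_0_iff: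
  assumes "1 \<le> w" "w \<le> p"
  shows "(\<Sum>r=1..p. hermite_D c m p w r) = 0 \<longleftrightarrow> coeff (hermite_sum c m p) w = 0"
proof -
  have "0 < (\<Sum>s=0..p div 2. if 2 * s < w then hermite_C w s else 0)"
    by (rule sum_pos2[where i = 0]) (use assms in \<open>auto simp: hermite_C_def\<close>)
  then show ?thesis unfolding sum_hermite_D[OF assms] by simp
qed

lemma m_star_lowest_coeff:
  assumes "1 \<le> p" "m \<le> p" "c p \<noteq> 0"
  shows "1 \<le> m_star c m p" "m_star c m p \<le> p" "coeff (hermite_sum c m p) (m_star c m p) \<noteq> 0"
    "\<And>w. 1 \<le> w \<Longrightarrow> w < m_star c m p \<Longrightarrow> coeff (hermite_sum c m p) w = 0"
proof -
  let ?P = "\<lambda>w. 1 \<le> w \<and> (\<Sum>r=1..p. hermite_D c m p w r) \<noteq> 0"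
  have P: "?P p" using assms sum_hermite_D_eq_0_iff[of p p c m] coeff_hermite_sum_top[of m p c] by auto
  have *: "?P (m_star c m p)" unfolding m_star_def by (rule LeastI[of ?P, OF P])
  show 1: "1 \<le> m_star c m p" using * by blast
  show 2: "m_star c m p \<le> p" unfolding m_star_def by (rule Least_le[of ?P, OF P])
  show "coeff (hermite_sum c m p) (m_star c m p) \<noteq> 0"
    using * sum_hermite_D_eq_0_iff[OF 1 2] by blast
  fix w assume w: "1 \<le> w" "w < m_star c m p"
  then have "\<not> ?P w" unfolding m_star_def by (intro not_less_Least)
  then show "coeff (hermite_sum c m p) w = 0" using w 2 sum_hermite_D_eq_0_iff[of w p c m] by auto
qed

section \<open>Mean-square calculus\<close>

lemma sq_integrable_mult:
  assumes "sq_integrable M f" "sq_integrable M g"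
  shows "integrable M (\<lambda>x. f x * g x)"
proof (rule Bochner_Integration.integrable_bound)
  show "integrable M (\<lambda>x. (f x)\<^sup>2 + (g x)\<^sup>2)"
    using assms by (auto simp: sq_integrable_def)
  show "(\<lambda>x. f x * g x) \<in> borel_measurable M"
    using assms by (auto simp: sq_integrable_def)
  have "\<bar>a * b\<bar> \<le> a\<^sup>2 + b\<^sup>2" for a b :: real
  proof -
    have "0 \<le> (\<bar>a\<bar> - \<bar>b\<bar>)\<^sup>2" "0 \<le> \<bar>a\<bar> * \<bar>b\<bar>" by simp_all
    moreover have "(\<bar>a\<bar> - \<bar>b\<bar>)\<^sup>2 = a\<^sup>2 + b\<^sup>2 - 2 * (\<bar>a\<bar> * \<bar>b\<bar>)" by (simp add: power2_diff)
    ultimately show ?thesis unfolding abs_mult by linarith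
  qed
  then show "AE x in M. norm (f x * g x) \<le> norm ((f x)\<^sup>2 + (g x)\<^sup>2)"
    by simp
qed

lemma sq_integrable_add:
  assumes "sq_integrable M f" "sq_integrable M g"
  shows "sq_integrable M (\<lambda>x. f x + g x)"
  using assms integrable_mult_right[OF sq_integrable_mult[OF assms], of 2]
  by (auto simp: sq_integrable_def power2_sum mult.assoc)

lemma sq_integrable_cmult: "sq_integrable M f \<Longrightarrow> sq_integrable M (\<lambda>x. a * f x)"
  by (auto simp: sq_integrable_def power_mult_distrib)

lemma sq_integrable_diff:
  assumes "sq_integrable M f" "sq_integrable M g"
  shows "sq_integrable M (\<lambda>x. f x - g x)"
  using sq_integrable_add[OF assms(1) sq_integrable_cmult[OF assms(2), of "-1"]] by simp

lemma sq_integrable_abs: "sq_integrable M f \<Longrightarrow> sq_integrable M (\<lambda>x. \<bar>f x\<bar>)"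
  by (auto simp: sq_integrable_def intro: borel_measurable_abs)

lemma sq_integrable_sum:
  "(\<And>i. i \<in> I \<Longrightarrow> sq_integrable M (f i)) \<Longrightarrow> sq_integrable M (\<lambda>x. \<Sum>i\<in>I. f i x)"
proof (induction I rule: infinite_finite_induct)
  case (insert i I)
  then show ?case by (auto intro!: sq_integrable_add)
qed (auto simp: sq_integrable_def)

lemma (in finite_measure) sq_integrable_const: "sq_integrable M (\<lambda>_. a)"
  by (simp add: sq_integrable_def)

lemma (in finite_measure) sq_integrable_imp_integrable:
  "sq_integrable M f \<Longrightarrow> integrable M f"
  using sq_integrable_mult[OF _ sq_integrable_const[of 1]] by simp

lemma sq_integrable_measurable: "sq_integrable M f \<Longrightarrow> f \<in> borel_measurable M"
  by (simp add: sq_integrable_def)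

lemma sq_integrable_square: "sq_integrable M f \<Longrightarrow> integrable M (\<lambda>x. (f x)\<^sup>2)"
  by (simp add: sq_integrable_def)

lemma integral_square_triangle:
  assumes "sq_integrable M f" "sq_integrable M g"
  shows "(LINT x|M. (f x + g x)\<^sup>2) \<le> 2 * (LINT x|M. (f x)\<^sup>2) + 2 * (LINT x|M. (g x)\<^sup>2)"
proof -
  note int = sq_integrable_square[OF assms(1)] sq_integrable_square[OF assms(2)]
    sq_integrable_square[OF sq_integrable_add[OF assms]]
  have "(LINT x|M. (f x + g x)\<^sup>2) \<le> (LINT x|M. 2 * (f x)\<^sup>2 + 2 * (g x)\<^sup>2)"
  proof (intro integral_mono)
    show "(f x + g x)\<^sup>2 \<le> 2 * (f x)\<^sup>2 + 2 * (g x)\<^sup>2" for x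
      using sum_squares_bound[of "f x" "g x"] by (simp add: power2_sum)
  qed (use int in auto)
  then show ?thesis using int by simp
qed

lemma integral_square_sum_le:
  assumes "finite I" "\<And>i. i \<in> I \<Longrightarrow> sq_integrable M (f i)"
  shows "(LINT x|M. (\<Sum>i\<in>I. f i x)\<^sup>2) \<le> card I * (\<Sum>i\<in>I. LINT x|M. (f i x)\<^sup>2)"
proof -
  have "(LINT x|M. (\<Sum>i\<in>I. f i x)\<^sup>2) \<le> (LINT x|M. card I * (\<Sum>i\<in>I. (f i x)\<^sup>2))"
  proof (intro integral_mono integrable_mult_right Bochner_Integration.integrable_sum)
    show "(\<Sum>i\<in>I. f i x)\<^sup>2 \<le> card I * (\<Sum>i\<in>I. (f i x)\<^sup>2)" for x
      using sum_squared_le_sum_of_squares[of "\<lambda>i. f i x" I] by (simp add: mult.commute)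
  qed (use assms sq_integrable_square[OF sq_integrable_sum[OF assms(2)]] in
      \<open>auto intro: sq_integrable_square\<close>)
  also have "\<dots> = card I * (\<Sum>i\<in>I. LINT x|M. (f i x)\<^sup>2)"
    using assms by (simp add: sq_integrable_square)
  finally show ?thesis .
qed

lemma integral_square_eq_0_iff:
  assumes "sq_integrable M f"
  shows "(LINT x|M. (f x)\<^sup>2) = 0 \<longleftrightarrow> (AE x in M. f x = 0)"
  using integral_nonneg_eq_0_iff_AE[OF sq_integrable_square[OF assms]] by simp

text \<open>The Riesz-Fischer theorem: a subsequence with summable mean absolute increments converges almost everywhere,
  and Fatou's lemma shows that its limit is also the mean-square limit of the full sequence.\<close>

lemma (in finite_measure) L2_complete:
  assumes F: "\<And>n. sq_integrable M (F n)"
    and Cauchy: "\<And>e. 0 < e \<Longrightarrow> \<exists>N. \<forall>m\<ge>N. \<forall>n\<ge>N. (LINT x|M. (F m x - F n x)\<^sup>2) < e"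
  obtains g where "L2_tendsto M F g"
proof -
  have [measurable]: "F n \<in> borel_measurable M" for n
    using F by (rule sq_integrable_measurable)
  have "\<exists>N. \<forall>k. \<forall>m\<ge>N k. \<forall>n\<ge>N k. (LINT x|M. (F m x - F n x)\<^sup>2) < (1 / 4) ^ k"
    by (intro choice allI Cauchy) simp
  then obtain N :: "nat \<Rightarrow> nat" where N: "\<And>k m n. N k \<le> m \<Longrightarrow> N k \<le> n \<Longrightarrow>
      (LINT x|M. (F m x - F n x)\<^sup>2) < (1 / 4) ^ k"
    by blast
  \<comment> \<open>Summing the thresholds makes \<open>r\<close> monotone and at least \<open>N k\<close> at \<open>k\<close>.\<close>
  define r where "r k = (\<Sum>i\<le>k. N i)" for k
  have r_ge: "N k \<le> r k" for k
    unfolding r_def by (rule member_le_sum) auto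
  have r_Suc: "N k \<le> r (Suc k)" for k
    using r_ge[of k] unfolding r_def by simp
  let ?D = "\<lambda>k x. F (r (Suc k)) x - F (r k) x"
  have D_sq: "sq_integrable M (?D k)" for k
    by (intro sq_integrable_diff F)
  have D_le: "(LINT x|M. \<bar>?D k x\<bar>) \<le> (1 / 2) ^ k * (1 + measure M (space M))" for k
  proof -
    have *: "\<bar>a\<bar> \<le> 2 ^ k * a\<^sup>2 + (1 / 2) ^ k" for a :: real
    proof -
      have "0 \<le> (1 - 2 ^ k * \<bar>a\<bar>)\<^sup>2" by simp
      then have "2 * (2 ^ k * \<bar>a\<bar>) \<le> 1 + (2 ^ k)\<^sup>2 * a\<^sup>2"
        by (simp add: power2_diff power_mult_distrib)
      moreover have "0 \<le> 2 ^ k * \<bar>a\<bar>" by simp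
      ultimately have "2 ^ k * \<bar>a\<bar> \<le> 1 + (2 ^ k)\<^sup>2 * a\<^sup>2" by linarith
      then have "(1/2)^k * (2 ^ k * \<bar>a\<bar>) \<le> (1/2)^k * (1 + (2 ^ k)\<^sup>2 * a\<^sup>2)"
        by (rule mult_left_mono) simp
      then show ?thesis by (simp add: power2_eq_square algebra_simps power_one_over)
    qed
    have "(LINT x|M. \<bar>?D k x\<bar>) \<le> (LINT x|M. 2 ^ k * (?D k x)\<^sup>2 + (1 / 2) ^ k)"
      using sq_integrable_imp_integrable[OF D_sq] sq_integrable_square[OF D_sq]
      by (intro integral_mono *) auto
    also have "\<dots> = 2 ^ k * (LINT x|M. (?D k x)\<^sup>2) + (1 / 2) ^ k * measure M (space M)"
      using sq_integrable_square[OF D_sq] by simp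
    also have "\<dots> \<le> 2 ^ k * (1 / 4) ^ k + (1 / 2) ^ k * measure M (space M)"
      using N[OF r_Suc r_ge, of k] by simp
    also have "2 ^ k * (1 / 4) ^ k = (1 / 2 :: real) ^ k"
      by (simp flip: power_mult_distrib)
    finally show ?thesis by (simp add: algebra_simps)
  qed
  have "(\<integral>\<^sup>+ x. (\<Sum>k. ennreal \<bar>?D k x\<bar>) \<partial>M) = (\<Sum>k. \<integral>\<^sup>+ x. ennreal \<bar>?D k x\<bar> \<partial>M)"
    by (rule nn_integral_suminf) measurable
  also have "\<dots> = (\<Sum>k. ennreal (LINT x|M. \<bar>?D k x\<bar>))"
    by (intro suminf_cong nn_integral_eq_integral)
       (use sq_integrable_imp_integrable[OF D_sq] in auto)
  also have "\<dots> \<le> (\<Sum>k. ennreal ((1 / 2) ^ k * (1 + measure M (space M))))"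
    by (intro suminf_le ennreal_leI D_le) auto
  also have "\<dots> = ennreal (\<Sum>k. (1 / 2) ^ k * (1 + measure M (space M)))"
    by (intro suminf_ennreal2 summable_mult2 summable_geometric) auto
  also have "\<dots> < \<infinity>" by simp
  finally have "(\<integral>\<^sup>+ x. (\<Sum>k. ennreal \<bar>?D k x\<bar>) \<partial>M) \<noteq> \<infinity>" by simp
  then have "AE x in M. (\<Sum>k. ennreal \<bar>?D k x\<bar>) \<noteq> \<infinity>"
    by (intro nn_integral_PInf_AE) measurable
  then have conv: "AE x in M. (\<lambda>k. F (r k) x) \<longlonglongrightarrow> lim (\<lambda>k. F (r k) x)"
  proof eventually_elim
    case (elim x)
    then have "summable (\<lambda>k. \<bar>?D k x\<bar>)"
      by (intro summable_suminf_not_top) auto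
    then have "summable (\<lambda>k. ?D k x)" by (rule summable_rabs_cancel)
    then have "convergent (\<lambda>k. \<Sum>i<k. ?D i x)" by (simp add: summable_iff_convergent)
    moreover have "(\<Sum>i<k. ?D i x) = F (r k) x - F (r 0) x" for k
      by (rule sum_lessThan_telescope)
    ultimately have "convergent (\<lambda>k. F (r k) x - F (r 0) x)" by simp
    then have "convergent (\<lambda>k. F (r k) x)" by (simp add: convergent_diff_const_right_iff)
    then show ?case by (simp add: convergent_LIMSEQ_iff)
  qed
  define g where "g x = lim (\<lambda>k. F (r k) x)" for x
  have g_meas [measurable]: "g \<in> borel_measurable M"
    unfolding g_def by measurable
  have bound: "\<exists>n0. \<forall>n\<ge>n0. (\<integral>\<^sup>+ x. ennreal ((F n x - g x)\<^sup>2) \<partial>M) \<le> ennreal e" if "0 < e" for e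
  proof -
    obtain n0 where n0: "\<And>m n. n0 \<le> m \<Longrightarrow> n0 \<le> n \<Longrightarrow> (LINT x|M. (F m x - F n x)\<^sup>2) < e"
      using Cauchy[OF \<open>0 < e\<close>] by blast
    obtain k0 where k0: "(1 / 4) ^ k0 < e" using \<open>0 < e\<close> real_arch_pow_inv[of e "1/4"] by auto
    let ?n = "max n0 (N k0)"
    have "(\<integral>\<^sup>+ x. ennreal ((F n x - g x)\<^sup>2) \<partial>M) \<le> ennreal e" if n: "?n \<le> n" for n
    proof -
      have "(\<integral>\<^sup>+ x. ennreal ((F n x - g x)\<^sup>2) \<partial>M)
          = (\<integral>\<^sup>+ x. liminf (\<lambda>k. ennreal ((F n x - F (r k) x)\<^sup>2)) \<partial>M)"
      proof (rule nn_integral_cong_AE, use conv in eventually_elim)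
        case (elim x)
        then have "(\<lambda>k. ennreal ((F n x - F (r k) x)\<^sup>2)) \<longlonglongrightarrow> ennreal ((F n x - g x)\<^sup>2)"
          unfolding g_def by (intro tendsto_ennrealI tendsto_intros)
        then show ?case by (rule lim_imp_Liminf[symmetric, rotated]) simp
      qed
      also have "\<dots> \<le> liminf (\<lambda>k. \<integral>\<^sup>+ x. ennreal ((F n x - F (r k) x)\<^sup>2) \<partial>M)"
        by (rule nn_integral_liminf) measurable
      also have "\<dots> \<le> limsup (\<lambda>k. \<integral>\<^sup>+ x. ennreal ((F n x - F (r k) x)\<^sup>2) \<partial>M)"
        by (rule Liminf_le_Limsup) simp
      also have "\<dots> \<le> ennreal e"
      proof (rule Limsup_bounded, rule eventually_sequentiallyI[of k0])
        fix k assume "k0 \<le> k"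
        then have "r k0 \<le> r k" unfolding r_def by (intro sum_mono2) auto
        then have "N k0 \<le> r k" using r_ge[of k0] by simp
        then have "(LINT x|M. (F n x - F (r k) x)\<^sup>2) < e"
          using N[of k0 n "r k"] n k0 by simp
        moreover have "(\<integral>\<^sup>+ x. ennreal ((F n x - F (r k) x)\<^sup>2) \<partial>M)
            = ennreal (LINT x|M. (F n x - F (r k) x)\<^sup>2)"
          by (intro nn_integral_eq_integral sq_integrable_square sq_integrable_diff F) simp
        ultimately show "(\<integral>\<^sup>+ x. ennreal ((F n x - F (r k) x)\<^sup>2) \<partial>M) \<le> ennreal e"
          by (simp add: ennreal_leI)
      qed
      finally show ?thesis .
    qed
    then show ?thesis by blast
  qed
  have sq: "\<exists>n0. \<forall>n\<ge>n0. sq_integrable M (\<lambda>x. F n x - g x) \<and> (LINT x|M. (F n x - g x)\<^sup>2) \<le> e"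
    if e: "0 < e" for e
  proof -
    obtain n0 where n0: "\<And>n. n0 \<le> n \<Longrightarrow> (\<integral>\<^sup>+ x. ennreal ((F n x - g x)\<^sup>2) \<partial>M) \<le> ennreal e"
      using bound[OF e] by blast
    have "sq_integrable M (\<lambda>x. F n x - g x) \<and> (LINT x|M. (F n x - g x)\<^sup>2) \<le> e" if n: "n0 \<le> n" for n
    proof
      have "(\<integral>\<^sup>+ x. ennreal ((F n x - g x)\<^sup>2) \<partial>M) < \<infinity>"
        using n0[OF n] by (rule order.strict_trans1) simp
      then have int: "integrable M (\<lambda>x. (F n x - g x)\<^sup>2)"
        by (intro integrableI_nonneg) auto
      then show "sq_integrable M (\<lambda>x. F n x - g x)" by (simp add: sq_integrable_def)
      show "(LINT x|M. (F n x - g x)\<^sup>2) \<le> e"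
        using n0[OF n] e by (subst (asm) nn_integral_eq_integral[OF int]) auto
    qed
    then show ?thesis by blast
  qed
  obtain n0 where "sq_integrable M (\<lambda>x. F n0 x - g x)" using sq[of 1] by auto
  from sq_integrable_diff[OF F[of n0] this] have "sq_integrable M g" by simp
  moreover have "(\<lambda>n. LINT x|M. (F n x - g x)\<^sup>2) \<longlonglongrightarrow> 0"
  proof (rule LIMSEQ_I)
    fix e :: real assume "0 < e"
    then obtain n0 where "\<And>n. n0 \<le> n \<Longrightarrow> (LINT x|M. (F n x - g x)\<^sup>2) \<le> e / 2"
      using sq[of "e / 2"] by auto
    then show "\<exists>no. \<forall>n\<ge>no. norm ((LINT x|M. (F n x - g x)\<^sup>2) - 0) < e"
      using \<open>0 < e\<close> by (intro exI[of _ n0]) (fastforce simp: abs_of_nonneg)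
  qed
  ultimately show ?thesis using F by (intro that) (simp add: L2_tendsto_def)
qed

lemma L2_tendsto_inner:
  assumes "L2_tendsto M F f" "sq_integrable M h"
  shows "(\<lambda>n. LINT x|M. F n x * h x) \<longlonglongrightarrow> (LINT x|M. f x * h x)"
proof (rule LIMSEQ_I)
  fix e :: real assume e: "0 < e"
  have F: "sq_integrable M (F n)" and f: "sq_integrable M f"
    and lim: "(\<lambda>n. LINT x|M. (F n x - f x)\<^sup>2) \<longlonglongrightarrow> 0" for n
    using assms(1) by (auto simp: L2_tendsto_def)
  define B where "B = (LINT x|M. (h x)\<^sup>2)"
  have B: "0 \<le> B" by (simp add: B_def)
  \<comment> \<open>The weight in \<open>\<bar>a b\<bar> \<le> a\<^sup>2 / d + d b\<^sup>2\<close>, small enough for the second part to stay below \<open>e / 2\<close>.\<close>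
  define d where "d = e / (2 * (B + 1))"
  have d: "0 < d" "d * B < e / 2"
    using e B by (auto simp: d_def field_simps)
  have "0 < d * (e / 2)" using d e by simp
  from LIMSEQ_D[OF lim this] obtain n0 where
    n0: "\<And>n. n0 \<le> n \<Longrightarrow> (LINT x|M. (F n x - f x)\<^sup>2) < d * (e / 2)" by auto
  have "\<bar>(LINT x|M. F n x * h x) - (LINT x|M. f x * h x)\<bar> < e" if "n0 \<le> n" for n
  proof -
    have Ff: "sq_integrable M (\<lambda>x. F n x - f x)" by (intro sq_integrable_diff F f)
    have *: "\<bar>a * b\<bar> \<le> a\<^sup>2 / d + d * b\<^sup>2" for a b
    proof -
      have "0 \<le> (\<bar>a\<bar> - d * \<bar>b\<bar>)\<^sup>2" by simp
      then have "2 * (d * \<bar>a * b\<bar>) \<le> a\<^sup>2 + d\<^sup>2 * b\<^sup>2"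
        by (simp add: power2_diff power_mult_distrib abs_mult mult.assoc mult.left_commute)
      moreover have "0 \<le> d * \<bar>a * b\<bar>" using d by simp
      ultimately have "d * \<bar>a * b\<bar> \<le> a\<^sup>2 + d\<^sup>2 * b\<^sup>2" by linarith
      then show ?thesis using d by (simp add: field_simps power2_eq_square)
    qed
    have "\<bar>(LINT x|M. F n x * h x) - (LINT x|M. f x * h x)\<bar> = \<bar>LINT x|M. (F n x - f x) * h x\<bar>"
      using sq_integrable_mult[OF F assms(2)] sq_integrable_mult[OF f assms(2)]
      by (simp add: left_diff_distrib)
    also have "\<dots> \<le> (LINT x|M. \<bar>(F n x - f x) * h x\<bar>)"
      by (rule integral_abs_bound)
    also have "\<dots> \<le> (LINT x|M. (F n x - f x)\<^sup>2 / d + d * (h x)\<^sup>2)"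
      using sq_integrable_mult[OF Ff assms(2)] sq_integrable_square[OF Ff] sq_integrable_square[OF assms(2)]
      by (intro integral_mono *) auto
    also have "\<dots> = (LINT x|M. (F n x - f x)\<^sup>2) / d + d * B"
      using sq_integrable_square[OF Ff] sq_integrable_square[OF assms(2)] by (simp add: B_def)
    also have "\<dots> < e / 2 + e / 2"
      using n0[OF that] d by (intro add_strict_mono) (auto simp: field_simps)
    finally show ?thesis by simp
  qed
  then show "\<exists>no. \<forall>n\<ge>no. norm ((LINT x|M. F n x * h x) - (LINT x|M. f x * h x)) < e"
    by auto
qed

text \<open>For the variance of the full sum: its comparison variable \<open>g (X_std 0 n)\<close> varies with \<open>n\<close>, but has a
  fixed law and hence a fixed second moment.\<close>

lemma integral_square_tendsto:
  assumes F: "\<And>n. 1 \<le> n \<Longrightarrow> sq_integrable M (F n)" and H: "\<And>n. 1 \<le> n \<Longrightarrow> sq_integrable M (H n)"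
    and lim: "(\<lambda>n. LINT x|M. (F n x - H n x)\<^sup>2) \<longlonglongrightarrow> 0"
    and c: "\<And>n. 1 \<le> n \<Longrightarrow> (LINT x|M. (H n x)\<^sup>2) = c"
  shows "(\<lambda>n. LINT x|M. (F n x)\<^sup>2) \<longlonglongrightarrow> c"
proof (rule LIMSEQ_I)
  fix e :: real assume e: "0 < e"
  have c0: "0 \<le> c" unfolding c[OF order_refl, symmetric] by simp
  \<comment> \<open>The weight \<open>d\<close> splits \<open>a\<^sup>2 - b\<^sup>2 = (a - b)\<^sup>2 + 2 * (a - b) * b\<close> so that the part with \<open>b\<^sup>2\<close> stays below \<open>e / 2\<close>.\<close>
  define d where "d = e / (2 * (c + 1))"
  have d: "0 < d" "d * c < e / 2"
    using e c0 by (auto simp: d_def field_simps)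
  have "0 < (e / 2) / (1 + 1 / d)" using d e by (simp add: add_pos_pos)
  from LIMSEQ_D[OF lim this] obtain n0 where
    n0: "\<And>n. n0 \<le> n \<Longrightarrow> (LINT x|M. (F n x - H n x)\<^sup>2) < (e / 2) / (1 + 1 / d)" by auto
  have "\<bar>(LINT x|M. (F n x)\<^sup>2) - c\<bar> < e" if n: "max 1 n0 \<le> n" for n
  proof -
    have n1: "1 \<le> n" using n by simp
    note FH = sq_integrable_diff[OF F[OF n1] H[OF n1]]
    have *: "\<bar>a\<^sup>2 - b\<^sup>2\<bar> \<le> (1 + 1 / d) * (a - b)\<^sup>2 + d * b\<^sup>2" for a b
    proof -
      have "0 \<le> (\<bar>a - b\<bar> - d * \<bar>b\<bar>)\<^sup>2" by simp
      then have "2 * (d * \<bar>(a - b) * b\<bar>) \<le> (a - b)\<^sup>2 + d\<^sup>2 * b\<^sup>2"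
        unfolding power2_diff[of "\<bar>a - b\<bar>"] by (simp add: power_mult_distrib abs_mult mult.assoc mult.left_commute)
      then have "2 * \<bar>(a - b) * b\<bar> \<le> (a - b)\<^sup>2 / d + d * b\<^sup>2"
        using d by (simp add: field_simps power2_eq_square)
      moreover have "a\<^sup>2 - b\<^sup>2 = (a - b)\<^sup>2 + 2 * ((a - b) * b)"
        by (simp add: power2_eq_square algebra_simps)
      moreover have "\<bar>(a - b)\<^sup>2 + 2 * ((a - b) * b)\<bar> \<le> (a - b)\<^sup>2 + 2 * \<bar>(a - b) * b\<bar>"
        by (rule order_trans[OF abs_triangle_ineq]) simp
      ultimately show ?thesis by (simp add: algebra_simps)
    qed
    have "\<bar>(LINT x|M. (F n x)\<^sup>2) - c\<bar> = \<bar>LINT x|M. (F n x)\<^sup>2 - (H n x)\<^sup>2\<bar>"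
      using sq_integrable_square[OF F[OF n1]] sq_integrable_square[OF H[OF n1]] c[OF n1] by simp
    also have "\<dots> \<le> (LINT x|M. \<bar>(F n x)\<^sup>2 - (H n x)\<^sup>2\<bar>)"
      by (rule integral_abs_bound)
    also have "\<dots> \<le> (LINT x|M. (1 + 1 / d) * (F n x - H n x)\<^sup>2 + d * (H n x)\<^sup>2)"
      using sq_integrable_square[OF F[OF n1]] sq_integrable_square[OF H[OF n1]] sq_integrable_square[OF FH]
      by (intro integral_mono * Bochner_Integration.integrable_add integrable_mult_right) auto
    also have "\<dots> = (1 + 1 / d) * (LINT x|M. (F n x - H n x)\<^sup>2) + d * c"
      using sq_integrable_square[OF H[OF n1]] sq_integrable_square[OF FH] c[OF n1] by simp
    also have "\<dots> < e / 2 + e / 2"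
    proof (intro add_strict_mono d(2))
      have "0 < 1 + 1 / d" using d by (simp add: add_pos_pos)
      then show "(1 + 1 / d) * (LINT x|M. (F n x - H n x)\<^sup>2) < e / 2"
        using n0[of n] n by (simp only: pos_less_divide_eq mult.commute[of "1 + 1 / d"] max.bounded_iff)
    qed
    finally show ?thesis by simp
  qed
  then show "\<exists>no. \<forall>n\<ge>no. norm ((LINT x|M. (F n x)\<^sup>2) - c) < e"
    by (intro exI[of _ "max 1 n0"]) auto
qed

section \<open>Hermite polynomials under the standard normal law\<close>

abbreviation (input) "gauss \<equiv> std_normal_distribution"

lemma prob_space_gauss: "prob_space gauss"
  by (rule prob_space_normal_density) simp

interpretation gauss: prob_space gauss
  by (rule prob_space_gauss)

lemma integrable_gauss_poly [simp]: "integrable gauss (poly F)"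
  unfolding poly_altdef
  by (intro Bochner_Integration.integrable_sum integrable_mult_right
      integrable_std_normal_distribution_moment)

lemma borel_measurable_poly [measurable]: "(poly F :: real \<Rightarrow> real) \<in> borel_measurable borel"
  unfolding poly_altdef by measurable

lemma sq_integrable_gauss_poly [simp]: "sq_integrable gauss (poly F)"
  using integrable_gauss_poly[of "F * F"] unfolding poly_mult[abs_def]
  by (auto simp: sq_integrable_def power2_eq_square simp del: integrable_gauss_poly)

lemma sq_integrable_gauss_hermite [simp]: "sq_integrable gauss (hermite q)"
  using sq_integrable_gauss_poly[of "hermite_polynomial q"] by (simp add: poly_hermite_polynomial[abs_def])

lemma sq_integrable_gauss_power [simp]: "sq_integrable gauss (\<lambda>x. x ^ k)"
  using sq_integrable_gauss_poly[of "monom 1 k"] by (simp add: poly_monom[abs_def])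

lemma gauss_power_Suc: "(LINT x|gauss. x ^ Suc k) = real k * (LINT x|gauss. x ^ (k - 1))"
proof (cases "even k")
  case True
  then show ?thesis
    using integral_std_normal_distribution_moment_odd[of "Suc k"]
      integral_std_normal_distribution_moment_odd[of "k - 1"] by (cases "k = 0") auto
next
  case False
  then obtain j where j: "k = 2 * j + 1" by (elim oddE)
  have "Suc k = 2 * Suc j" "k - 1 = 2 * j" by (simp_all add: j)
  then show ?thesis
  proof -
    have "fact (2 * Suc j) = (2 * real j + 2) * (2 * real j + 1) * fact (2 * j)"
      "fact (Suc j) = (real j + 1) * (fact j :: real)"
      by (simp_all add: algebra_simps)
    moreover have "real j + 1 \<noteq> 0" by linarith
    ultimately show ?thesis
      unfolding \<open>Suc k = 2 * Suc j\<close> \<open>k - 1 = 2 * j\<close> std_normal_distribution_even_moments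
      by (simp add: j divide_simps del: fact_Suc)
  qed
qed

text \<open>Gaussian integration by parts; for polynomials it is the recursion of the moments.\<close>

lemma gauss_stein:
  "(LINT x|gauss. x * poly F x) = (LINT x|gauss. poly (pderiv F) x)"
proof -
  have m: "(LINT x|gauss. x * poly (monom a i) x) = (LINT x|gauss. poly (pderiv (monom a i)) x)" for a i
  proof -
    have "(LINT x|gauss. x * poly (monom a i) x) = (LINT x|gauss. a * x ^ Suc i)"
      by (simp add: poly_monom ac_simps)
    also have "\<dots> = a * (LINT x|gauss. x ^ Suc i)" by (rule integral_mult_right_zero)
    also have "\<dots> = (LINT x|gauss. (of_nat i * a) * x ^ (i - 1))"
      unfolding gauss_power_Suc integral_mult_right_zero by simp
    finally show ?thesis by (simp add: pderiv_monom poly_monom)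
  qed
  have int: "integrable gauss (\<lambda>x. x * poly G x)" for G
    using integrable_gauss_poly[of "pCons 0 G"] by (simp add: poly_pCons[abs_def] del: integrable_gauss_poly)
  let ?m = "\<lambda>i. monom (coeff F i) i"
  have F: "F = (\<Sum>i\<le>degree F. ?m i)" by (simp add: poly_as_sum_of_monoms)
  have "(LINT x|gauss. x * poly F x) = (LINT x|gauss. (\<Sum>i\<le>degree F. x * poly (?m i) x))"
    by (subst F) (simp add: poly_sum sum_distrib_left)
  also have "\<dots> = (\<Sum>i\<le>degree F. LINT x|gauss. poly (pderiv (?m i)) x)"
    using int by (subst Bochner_Integration.integral_sum) (auto simp: m)
  also have "\<dots> = (LINT x|gauss. poly (\<Sum>i\<le>degree F. pderiv (?m i)) x)"
    by (simp add: poly_sum)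
  also have "(\<Sum>i\<le>degree F. pderiv (?m i)) = pderiv F"
  proof -
    have "pderiv (\<Sum>i\<in>I. ?m i) = (\<Sum>i\<in>I. pderiv (?m i))" for I
      by (induction I rule: infinite_finite_induct) (auto simp: pderiv_add)
    then show ?thesis using F by metis
  qed
  finally show ?thesis .
qed

lemma pderiv_hermite_polynomial:
  "pderiv (hermite_polynomial (Suc q)) = smult (real (Suc q)) (hermite_polynomial q)"
proof (induction q rule: hermite_polynomial.induct)
  case (3 q)
  have "pderiv (hermite_polynomial (Suc (Suc (Suc q))))
    = hermite_polynomial (Suc (Suc q)) + pCons 0 (pderiv (hermite_polynomial (Suc (Suc q))))
      - smult (real (Suc (Suc q))) (pderiv (hermite_polynomial (Suc q)))"
    by (simp only: hermite_polynomial.simps(3)[of "Suc q"] pderiv_diff pderiv_smult pderiv_pCons)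
  also have "\<dots> = hermite_polynomial (Suc (Suc q)) + smult (real (Suc (Suc q)))
      (pCons 0 (hermite_polynomial (Suc q)) - smult (real (Suc q)) (hermite_polynomial q))"
    unfolding 3 by (simp add: smult_diff_right mult.commute)
  also have "\<dots> = smult (real (Suc (Suc (Suc q)))) (hermite_polynomial (Suc (Suc q)))"
    unfolding hermite_polynomial.simps(3)[of q, symmetric]
    using smult_add_left[of 1 "real (Suc (Suc q))" "hermite_polynomial (Suc (Suc q))"]
    by (simp del: hermite_polynomial.simps)
  finally show ?case .
qed (auto simp: pderiv_pCons)

lemma hermite_polynomial_Suc:
  "hermite_polynomial (Suc q) = pCons 0 (hermite_polynomial q) - pderiv (hermite_polynomial q)"
  by (cases q) (auto simp: pderiv_hermite_polynomial)

text \<open>The operator \<open>F \<mapsto> x F - F'\<close>, which raises the order of a Hermite polynomial, is adjoint to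
  differentiation.\<close>

lemma gauss_hermite_Suc:
  "(LINT x|gauss. hermite (Suc q) x * poly F x) = (LINT x|gauss. hermite q x * poly (pderiv F) x)"
proof -
  let ?H = "hermite_polynomial q"
  have int: "integrable gauss (\<lambda>x. x * poly G x)" for G
    using integrable_gauss_poly[of "pCons 0 G"] by (simp add: poly_pCons[abs_def] del: integrable_gauss_poly)
  have "(LINT x|gauss. hermite (Suc q) x * poly F x)
    = (LINT x|gauss. x * poly (?H * F) x - poly (pderiv ?H * F) x)"
    by (simp flip: poly_hermite_polynomial add: hermite_polynomial_Suc algebra_simps)
  also have "\<dots> = (LINT x|gauss. poly (pderiv (?H * F)) x) - (LINT x|gauss. poly (pderiv ?H * F) x)"
    unfolding gauss_stein[symmetric] by (intro Bochner_Integration.integral_diff int integrable_gauss_poly)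
  also have "\<dots> = (LINT x|gauss. poly (pderiv (?H * F)) x - poly (pderiv ?H * F) x)"
    by (intro Bochner_Integration.integral_diff[symmetric] integrable_gauss_poly)
  also have "\<dots> = (LINT x|gauss. hermite q x * poly (pderiv F) x)"
    by (simp add: pderiv_mult poly_hermite_polynomial algebra_simps)
  finally show ?thesis .
qed

lemma gauss_hermite_orthogonal:
  "(LINT x|gauss. hermite p x * hermite q x) = (if p = q then fact q else 0)"
proof (induction p arbitrary: q)
  case 0
  show ?case
  proof (cases q)
    case (Suc q')
    then show ?thesis using gauss_hermite_Suc[of q' 1] by simp
  qed (use gauss.prob_space in simp)
next
  case (Suc p)
  have "(LINT x|gauss. hermite (Suc p) x * hermite q x)
      = (LINT x|gauss. hermite p x * poly (pderiv (hermite_polynomial q)) x)"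
    using gauss_hermite_Suc[of p "hermite_polynomial q"] by (simp add: poly_hermite_polynomial)
  also have "\<dots> = (if Suc p = q then fact q else 0)"
  proof (cases q)
    case (Suc q')
    have "(LINT x|gauss. hermite p x * poly (pderiv (hermite_polynomial q)) x)
      = (LINT x|gauss. real q * (hermite p x * hermite q' x))"
      unfolding Suc pderiv_hermite_polynomial by (simp add: poly_hermite_polynomial ac_simps)
    then show ?thesis using Suc.IH[of q'] by (simp add: Suc)
  qed simp
  finally show ?case .
qed

section \<open>Completeness of the Hermite polynomials\<close>

lemma integrable_gauss_exp: "integrable gauss (\<lambda>x. exp (a * x))"
proof -
  have "std_normal_density x * exp (a * x) = exp (a\<^sup>2 / 2) * normal_density a 1 x" for x
    by (simp add: normal_density_def exp_add[symmetric] power2_eq_square field_simps)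
  moreover have "integrable lborel (\<lambda>x. exp (a\<^sup>2 / 2) * normal_density a 1 x)"
    by (intro integrable_mult_right integrable_normal_density) simp
  ultimately show ?thesis by (subst integrable_density) auto
qed

lemma sq_integrable_gauss_exp_abs: "sq_integrable gauss (\<lambda>x. exp \<bar>a * x\<bar>)"
proof -
  have "integrable gauss (\<lambda>x. (exp \<bar>a * x\<bar>)\<^sup>2)"
  proof (rule Bochner_Integration.integrable_bound)
    show "integrable gauss (\<lambda>x. exp ((2 * a) * x) + exp ((- 2 * a) * x))"
      by (intro Bochner_Integration.integrable_add integrable_gauss_exp)
    show "AE x in gauss. norm ((exp \<bar>a * x\<bar>)\<^sup>2) \<le> norm (exp ((2 * a) * x) + exp ((- 2 * a) * x))"
    proof (rule AE_I2)
      fix x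
      have "(exp \<bar>a * x\<bar>)\<^sup>2 = exp (2 * \<bar>a * x\<bar>)" by (simp flip: exp_of_nat_mult)
      also have "\<dots> \<le> exp ((2 * a) * x) + exp ((- 2 * a) * x)"
        by (cases "0 \<le> a * x") (auto simp: abs_if mult.assoc)
      finally show "norm ((exp \<bar>a * x\<bar>)\<^sup>2) \<le> norm (exp ((2 * a) * x) + exp ((- 2 * a) * x))"
        by simp
    qed
  qed simp
  then show ?thesis by (simp add: sq_integrable_def)
qed

text \<open>The exponential series may be integrated term by term because \<open>exp \<bar>t x\<bar>\<close> is square integrable under
  the normal law.\<close>

lemma gauss_fourier_eq_0:
  assumes f: "sq_integrable gauss f" and orth: "\<And>k. (LINT x|gauss. f x * x ^ k) = 0"
  shows "(CLINT x|gauss. of_real (f x) * iexp (t * x)) = 0"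
proof -
  have [measurable]: "f \<in> borel_measurable borel" using sq_integrable_measurable[OF f] by simp
  define s where "s n x = complex_of_real (f x) * (\<Sum>k<n. (\<i> * of_real (t * x)) ^ k / fact k)" for n x
  have "(\<lambda>n. CLINT x|gauss. s n x) \<longlonglongrightarrow> (CLINT x|gauss. of_real (f x) * iexp (t * x))"
  proof (rule integral_dominated_convergence)
    show "integrable gauss (\<lambda>x. \<bar>f x\<bar> * exp \<bar>t * x\<bar>)"
      using integrable_norm[OF sq_integrable_mult[OF f sq_integrable_gauss_exp_abs[of t]]]
      by (simp add: abs_mult)
    show "AE x in gauss. (\<lambda>n. s n x) \<longlonglongrightarrow> of_real (f x) * iexp (t * x)"
    proof (rule AE_I2)
      fix x
      have "(\<lambda>k. (\<i> * of_real (t * x)) ^ k / fact k) sums iexp (t * x)"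
        using exp_converges[of "\<i> * complex_of_real (t * x)"] by (simp add: scaleR_conv_of_real field_simps)
      then show "(\<lambda>n. s n x) \<longlonglongrightarrow> of_real (f x) * iexp (t * x)"
        unfolding s_def sums_def by (rule tendsto_mult_left)
    qed
    show "AE x in gauss. norm (s n x) \<le> \<bar>f x\<bar> * exp \<bar>t * x\<bar>" for n
    proof (rule AE_I2)
      fix x
      have "norm (\<Sum>k<n. (\<i> * complex_of_real (t * x)) ^ k / fact k) \<le> (\<Sum>k<n. \<bar>t * x\<bar> ^ k / fact k)"
        by (rule order_trans[OF norm_sum])
           (simp add: norm_divide norm_power norm_mult abs_mult power_mult_distrib)
      also have "\<dots> \<le> exp \<bar>t * x\<bar>"
      proof -
        have "(\<lambda>k. \<bar>t * x\<bar> ^ k / fact k) sums exp \<bar>t * x\<bar>"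
          using exp_converges[of "\<bar>t * x\<bar>"] by (simp add: field_simps)
        then show ?thesis by (intro sum_le_suminf[THEN order_trans]) (auto simp: sums_iff)
      qed
      finally show "norm (s n x) \<le> \<bar>f x\<bar> * exp \<bar>t * x\<bar>"
        by (simp add: s_def norm_mult mult_left_mono)
    qed
  qed (simp_all add: s_def)
  moreover have "(CLINT x|gauss. s n x) = 0" for n
  proof -
    have "s n x = (\<Sum>k<n. ((\<i> * of_real t) ^ k / fact k) * of_real (f x * x ^ k))" for x
      unfolding s_def sum_distrib_left by (intro sum.cong refl) (simp add: power_mult_distrib)
    then have "(CLINT x|gauss. s n x)
      = (CLINT x|gauss. \<Sum>k<n. ((\<i> * of_real t) ^ k / fact k) * of_real (f x * x ^ k))"
      by simp
    also have "\<dots> = (\<Sum>k<n. CLINT x|gauss. ((\<i> * of_real t) ^ k / fact k) * of_real (f x * x ^ k))"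
      by (intro Bochner_Integration.integral_sum integrable_mult_right integrable_of_real
          sq_integrable_mult[OF f] sq_integrable_gauss_power)
    also have "\<dots> = (\<Sum>k<n. ((\<i> * of_real t) ^ k / fact k) * (CLINT x|gauss. of_real (f x * x ^ k)))"
      by (simp only: integral_mult_right_zero)
    also have "\<dots> = 0" unfolding integral_complex_of_real orth by simp
    finally show ?thesis .
  qed
  ultimately show ?thesis by (simp add: LIMSEQ_const_iff)
qed

text \<open>The signed measure with density \<open>f\<close> has a vanishing Fourier transform, so uniqueness of
  characteristic functions applies. That result is about probability measures; therefore the positive
  and the negative part of \<open>f\<close> are compared after adding 1 and normalizing, which makes both of
  them probability densities even if \<open>f\<close> vanishes.\<close>

lemma gauss_orthogonal_to_powers_imp_0:
  assumes f: "sq_integrable gauss f" and orth: "\<And>k. (LINT x|gauss. f x * x ^ k) = 0"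
  shows "AE x in gauss. f x = 0"
proof -
  have f_meas [measurable]: "f \<in> borel_measurable borel" using sq_integrable_measurable[OF f] by simp
  have int: "integrable gauss f" by (rule gauss.sq_integrable_imp_integrable[OF f])
  define k where "k = (LINT x|gauss. max (f x) 0)"
  have k: "0 \<le> k" by (simp add: k_def)
  have k': "(LINT x|gauss. max (- f x) 0) = k"
  proof -
    have "(LINT x|gauss. max (f x) 0) - (LINT x|gauss. max (- f x) 0)
        = (LINT x|gauss. max (f x) 0 - max (- f x) 0)"
      using int by (intro Bochner_Integration.integral_diff[symmetric]) auto
    also have "\<dots> = (LINT x|gauss. f x)"
      by (intro Bochner_Integration.integral_cong refl) (simp add: max_def)
    also have "\<dots> = 0" using orth[of 0] by simp
    finally show ?thesis by (simp add: k_def)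
  qed
  have int_pm: "integrable gauss (\<lambda>x. max (f x) 0)" "integrable gauss (\<lambda>x. max (- f x) 0)"
    using int by auto
  define u v where "u x = (1 + max (f x) 0) / (1 + k)" and "v x = (1 + max (- f x) 0) / (1 + k)" for x
  have uv_meas [measurable]: "u \<in> borel_measurable borel" "v \<in> borel_measurable borel"
    unfolding u_def v_def by measurable
  have uv_nn: "0 \<le> u x" "0 \<le> v x" for x using k by (auto simp: u_def v_def)
  have uv_int: "integrable gauss u" "integrable gauss v"
    unfolding u_def v_def using int_pm by auto
  have uv1: "(LINT x|gauss. u x) = 1" "(LINT x|gauss. v x) = 1"
    unfolding u_def v_def using int_pm k k' gauss.prob_space by (auto simp: k_def[symmetric] simp del: gauss.prob_space)
  have rd: "real_distribution (density gauss w)"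
    if "integrable gauss w" "\<And>x. 0 \<le> w x" "(LINT x|gauss. w x) = 1" "w \<in> borel_measurable borel" for w :: "real \<Rightarrow> real"
  proof -
    have "emeasure (density gauss w) (space (density gauss w)) = 1"
      using that by (simp add: emeasure_density nn_integral_eq_integral)
    then show ?thesis
      by (auto simp: real_distribution_def real_distribution_axioms_def intro!: prob_spaceI)
  qed
  have "char (density gauss u) = char (density gauss v)"
  proof (rule ext)
    fix t
    have ci: "integrable gauss (\<lambda>x. w x *\<^sub>R iexp (t * x))" if "integrable gauss w" for w :: "real \<Rightarrow> real"
      using that by (rule Bochner_Integration.integrable_bound) (use borel_measurable_integrable[OF that] in auto)
    have "char (density gauss u) t - char (density gauss v) t
      = (CLINT x|gauss. u x *\<^sub>R iexp (t * x)) - (CLINT x|gauss. v x *\<^sub>R iexp (t * x))"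
      unfolding char_def using uv_nn by (simp add: integral_density)
    also have "\<dots> = (CLINT x|gauss. u x *\<^sub>R iexp (t * x) - v x *\<^sub>R iexp (t * x))"
      by (intro Bochner_Integration.integral_diff[symmetric] ci uv_int)
    also have "\<dots> = (CLINT x|gauss. of_real (1 / (1 + k)) * (of_real (f x) * iexp (t * x)))"
    proof (intro Bochner_Integration.integral_cong refl)
      fix x
      have "u x - v x = 1 / (1 + k) * f x" by (simp add: u_def v_def max_def diff_divide_distrib[symmetric])
      then show "u x *\<^sub>R iexp (t * x) - v x *\<^sub>R iexp (t * x) = of_real (1 / (1 + k)) * (of_real (f x) * iexp (t * x))"
        by (simp only: scaleR_left_diff_distrib[symmetric]) (simp add: scaleR_conv_of_real)
    qed
    also have "\<dots> = 0" by (simp only: integral_mult_right_zero gauss_fourier_eq_0[OF f orth] mult_zero_right)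
    finally show "char (density gauss u) t = char (density gauss v) t" by simp
  qed
  then have "density gauss u = density gauss v"
    by (intro Levy_uniqueness rd uv_int uv_nn uv1 uv_meas)
  then have "AE x in gauss. ennreal (u x) = ennreal (v x)"
    by (intro gauss.density_unique) auto
  then show ?thesis
  proof eventually_elim
    case (elim x)
    then have "u x = v x" using uv_nn by simp
    then show ?case using k by (simp add: u_def v_def max_def split: if_splits)
  qed
qed

lemma gauss_hermite_sum_square:
  assumes "finite I"
  shows "(LINT x|gauss. (\<Sum>q\<in>I. a q * hermite q x)\<^sup>2) = (\<Sum>q\<in>I. (a q)\<^sup>2 * fact q)"
proof -
  have int: "integrable gauss (\<lambda>x. (a p * a q) * (hermite p x * hermite q x))" for p q
    by (intro integrable_mult_right sq_integrable_mult sq_integrable_gauss_hermite)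
  have "(LINT x|gauss. (\<Sum>q\<in>I. a q * hermite q x)\<^sup>2)
    = (LINT x|gauss. (\<Sum>p\<in>I. \<Sum>q\<in>I. (a p * a q) * (hermite p x * hermite q x)))"
    by (simp add: power2_eq_square sum_product ac_simps)
  also have "\<dots> = (\<Sum>p\<in>I. \<Sum>q\<in>I. (a p * a q) * (LINT x|gauss. hermite p x * hermite q x))"
    using int by (simp add: Bochner_Integration.integral_sum Bochner_Integration.integrable_sum)
  also have "\<dots> = (\<Sum>p\<in>I. \<Sum>q\<in>I. if p = q then (a p * a q) * fact q else 0)"
    unfolding gauss_hermite_orthogonal by (intro sum.cong refl) auto
  also have "\<dots> = (\<Sum>q\<in>I. (a q)\<^sup>2 * fact q)"
    using assms by (simp add: power2_eq_square)
  finally show ?thesis .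
qed

lemma gauss_hermite_sum_inner:
  "(LINT x|gauss. (\<Sum>q\<le>N. a q * hermite q x) * hermite p x) = (if p \<le> N then a p * fact p else 0)"
proof -
  have "(LINT x|gauss. (\<Sum>q\<le>N. a q * hermite q x) * hermite p x)
    = (LINT x|gauss. (\<Sum>q\<le>N. a q * (hermite q x * hermite p x)))"
    by (simp add: sum_distrib_right mult.assoc)
  also have "\<dots> = (\<Sum>q\<le>N. a q * (LINT x|gauss. hermite q x * hermite p x))"
    by (simp add: Bochner_Integration.integral_sum sq_integrable_mult)
  also have "\<dots> = (\<Sum>q\<le>N. if q = p then a q * fact q else 0)"
    unfolding gauss_hermite_orthogonal by (intro sum.cong refl) auto
  finally show ?thesis by simp
qed

text \<open>By Bessel's inequality the partial sums are Cauchy; their limit differs from \<open>f\<close> by a function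
  orthogonal to all Hermite polynomials, hence to all powers.\<close>

lemma hermite_expansion:
  assumes f: "sq_integrable gauss f"
  shows "L2_tendsto gauss (\<lambda>N x. \<Sum>q\<le>N. (LINT y|gauss. f y * hermite q y) / fact q * hermite q x) f"
proof -
  define a where "a q = (LINT y|gauss. f y * hermite q y) / fact q" for q
  define S where "S N x = (\<Sum>q\<le>N. a q * hermite q x)" for N x
  have S: "sq_integrable gauss (S N)" for N
    unfolding S_def by (intro sq_integrable_sum sq_integrable_cmult sq_integrable_gauss_hermite)
  have fS: "(LINT x|gauss. f x * S N x) = (\<Sum>q\<le>N. (a q)\<^sup>2 * fact q)" for N
  proof -
    have "(LINT x|gauss. f x * S N x) = (LINT x|gauss. (\<Sum>q\<le>N. a q * (f x * hermite q x)))"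
      by (simp add: S_def sum_distrib_left ac_simps)
    also have "\<dots> = (\<Sum>q\<le>N. a q * (LINT x|gauss. f x * hermite q x))"
      by (simp add: Bochner_Integration.integral_sum sq_integrable_mult[OF f])
    also have "\<dots> = (\<Sum>q\<le>N. (a q)\<^sup>2 * fact q)"
      by (simp add: a_def power2_eq_square)
    finally show ?thesis .
  qed
  let ?P = "\<lambda>N. \<Sum>q\<le>N. (a q)\<^sup>2 * fact q"
  have bessel: "?P N \<le> (LINT x|gauss. (f x)\<^sup>2)" for N
  proof -
    have "0 \<le> (LINT x|gauss. (f x - S N x)\<^sup>2)" by simp
    also have "\<dots> = (LINT x|gauss. (f x)\<^sup>2 - 2 * (f x * S N x) + (S N x)\<^sup>2)"
      by (intro Bochner_Integration.integral_cong refl) (simp add: power2_diff)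
    also have "\<dots> = (LINT x|gauss. (f x)\<^sup>2) - 2 * ?P N + (LINT x|gauss. (S N x)\<^sup>2)"
      using sq_integrable_square[OF f] sq_integrable_mult[OF f S[of N]] sq_integrable_square[OF S[of N]]
      by (simp add: fS)
    also have "(LINT x|gauss. (S N x)\<^sup>2) = ?P N"
      unfolding S_def by (rule gauss_hermite_sum_square) simp
    finally show ?thesis by simp
  qed
  have "Bseq ?P"
    by (rule BseqI'[of _ "LINT x|gauss. (f x)\<^sup>2"]) (use bessel in \<open>simp add: sum_nonneg\<close>)
  moreover have "incseq ?P" by (rule incseq_SucI) simp
  ultimately have "convergent ?P" by (intro Bseq_monoseq_convergent) (auto simp: monoseq_iff)
  then have Cau: "Cauchy ?P" by (rule convergent_Cauchy)
  have SS: "(LINT x|gauss. (S m x - S n x)\<^sup>2) = ?P m - ?P n" if "n \<le> m" for m n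
  proof -
    have d: "(\<Sum>q\<le>m. g q) - (\<Sum>q\<le>n. g q) = (\<Sum>q\<in>{..m} - {..n}. g q)" for g :: "nat \<Rightarrow> real"
      using that by (subst sum_diff) auto
    show ?thesis unfolding S_def d by (rule gauss_hermite_sum_square) simp
  qed
  obtain s where s: "L2_tendsto gauss S s"
  proof (rule gauss.L2_complete[OF S])
    fix e :: real assume "0 < e"
    then obtain N where N: "\<And>m n. N \<le> m \<Longrightarrow> N \<le> n \<Longrightarrow> norm (?P m - ?P n) < e"
      using Cau unfolding Cauchy_iff by blast
    have "(LINT x|gauss. (S m x - S n x)\<^sup>2) < e" if "N \<le> m" "N \<le> n" for m n
    proof (cases "n \<le> m")
      case True
      then show ?thesis using N[OF that] SS[OF True] by simp
    next
      case False
      then have "(LINT x|gauss. (S n x - S m x)\<^sup>2) < e" using N[OF that(2,1)] SS[of m n] by simp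
      then show ?thesis by (simp add: power2_commute)
    qed
    then show "\<exists>N. \<forall>m\<ge>N. \<forall>n\<ge>N. (LINT x|gauss. (S m x - S n x)\<^sup>2) < e" by blast
  qed (use that in blast)
  have s_sq: "sq_integrable gauss s" using s by (simp add: L2_tendsto_def)
  have fs: "sq_integrable gauss (\<lambda>x. f x - s x)" by (rule sq_integrable_diff[OF f s_sq])
  have orth: "(LINT x|gauss. (f x - s x) * hermite q x) = 0" for q
  proof -
    have "(\<lambda>N. LINT x|gauss. S N x * hermite q x) \<longlonglongrightarrow> (LINT x|gauss. s x * hermite q x)"
      by (rule L2_tendsto_inner[OF s sq_integrable_gauss_hermite])
    moreover have "(\<lambda>N. LINT x|gauss. S N x * hermite q x) \<longlonglongrightarrow> a q * fact q"
      unfolding S_def gauss_hermite_sum_inner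
      by (rule tendsto_eventually) (use eventually_ge_at_top[of q] in eventually_elim, simp)
    ultimately have "(LINT x|gauss. s x * hermite q x) = a q * fact q" by (rule LIMSEQ_unique)
    then show ?thesis
      using sq_integrable_mult[OF f] sq_integrable_mult[OF s_sq]
      by (simp add: left_diff_distrib a_def)
  qed
  have "(LINT x|gauss. (f x - s x) * x ^ k) = 0" for k
  proof -
    obtain b where b: "\<And>x::real. x ^ k = (\<Sum>q\<le>k. b q * hermite q x)"
      using power_hermite_expansion[of k] by blast
    have "(LINT x|gauss. (f x - s x) * x ^ k) = (LINT x|gauss. (\<Sum>q\<le>k. b q * ((f x - s x) * hermite q x)))"
      by (simp add: b sum_distrib_left ac_simps)
    also have "\<dots> = (\<Sum>q\<le>k. b q * (LINT x|gauss. (f x - s x) * hermite q x))"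
      by (simp add: Bochner_Integration.integral_sum sq_integrable_mult[OF fs])
    finally show ?thesis by (simp add: orth)
  qed
  from gauss_orthogonal_to_powers_imp_0[OF fs this]
  have ae: "AE x in gauss. f x = s x" by simp
  have "(LINT x|gauss. (S N x - f x)\<^sup>2) = (LINT x|gauss. (S N x - s x)\<^sup>2)" for N
    by (rule integral_cong_AE) (use ae sq_integrable_measurable[OF f] sq_integrable_measurable[OF s_sq]
        sq_integrable_measurable[OF S] in auto)
  with s f have "L2_tendsto gauss S f" by (simp add: L2_tendsto_def)
  then show ?thesis unfolding S_def a_def .
qed

lemma gauss_polynomial_dense:
  assumes "sq_integrable gauss f" "0 < e"
  shows "\<exists>F. (LINT x|gauss. (poly F x - f x)\<^sup>2) < e"
proof -
  define c where "c q = (LINT y|gauss. f y * hermite q y) / fact q" for q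
  have "L2_tendsto gauss (\<lambda>N x. \<Sum>q\<le>N. c q * hermite q x) f"
    unfolding c_def by (rule hermite_expansion[OF assms(1)])
  then have "(\<lambda>N. LINT x|gauss. (poly (hermite_sum c 0 N) x - f x)\<^sup>2) \<longlonglongrightarrow> 0"
    by (simp add: L2_tendsto_def poly_hermite_sum hermite_poly_def atMost_atLeast0)
  from LIMSEQ_D[OF this assms(2)] show ?thesis by fastforce
qed

text \<open>Inner products pass to the mean-square limit, so orthogonality leaves no choice for the coefficients.\<close>

lemma hermite_coeffs_eq:
  assumes f: "sq_integrable gauss f"
  shows "hermite_coeffs f = (\<lambda>q. (LINT y|gauss. f y * hermite q y) / fact q)"
  unfolding hermite_coeffs_def
proof (rule the_equality)
  show "L2_tendsto gauss (\<lambda>N x. \<Sum>q\<le>N. (LINT y|gauss. f y * hermite q y) / fact q * hermite q x) f"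
    by (rule hermite_expansion[OF f])
  fix c assume c: "L2_tendsto gauss (\<lambda>N x. \<Sum>q\<le>N. c q * hermite q x) f"
  show "c = (\<lambda>q. (LINT y|gauss. f y * hermite q y) / fact q)"
  proof
    fix q
    have "(\<lambda>N. LINT x|gauss. (\<Sum>q\<le>N. c q * hermite q x) * hermite q x) \<longlonglongrightarrow> (LINT x|gauss. f x * hermite q x)"
      by (rule L2_tendsto_inner[OF c sq_integrable_gauss_hermite])
    moreover have "(\<lambda>N. LINT x|gauss. (\<Sum>q\<le>N. c q * hermite q x) * hermite q x) \<longlonglongrightarrow> c q * fact q"
      unfolding gauss_hermite_sum_inner
      by (rule tendsto_eventually) (use eventually_ge_at_top[of q] in eventually_elim, simp)
    ultimately have "(LINT x|gauss. f x * hermite q x) = c q * fact q" by (rule LIMSEQ_unique)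
    then show "c q = (LINT y|gauss. f y * hermite q y) / fact q" by simp
  qed
qed

lemma hermite_coeffs_expansion:
  assumes "sq_integrable gauss f"
  shows "L2_tendsto gauss (\<lambda>N x. \<Sum>q\<le>N. hermite_coeffs f q * hermite q x) f"
  unfolding hermite_coeffs_eq[OF assms] by (rule hermite_expansion[OF assms])

section \<open>Weak convergence to a random line in the Skorokhod space\<close>

text \<open>A partial-sum path depends on the sample point only through the sequence \<open>V\<close> of its values, and
  continuously so. This reduces measurability in the Skorokhod space to that of real random variables.\<close>

definition step_path :: "nat \<Rightarrow> (nat \<Rightarrow> real) \<Rightarrow> real \<Rightarrow> real" where
  "step_path n V = (\<lambda>t\<in>{0..1}. V (nat \<lfloor>real n * t\<rfloor>))"

lemma step_path_cadlag: "step_path n V \<in> cadlag"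
  unfolding cadlag_def
proof (intro CollectI conjI ballI)
  show "step_path n V \<in> extensional {0..1}" by (simp add: step_path_def)
next
  fix t :: real assume t: "t \<in> {0..<1}"
  have "\<forall>\<^sub>F s in at_right t. step_path n V s = step_path n V t"
  proof (cases "n = 0")
    case True
    then show ?thesis
      using t by (auto simp: eventually_at_right_field step_path_def intro!: exI[of _ 1])
  next
    case False
    \<comment> \<open>The next jump after \<open>t\<close>, or the end of the interval.\<close>
    define b where "b = min 1 ((of_int \<lfloor>real n * t\<rfloor> + 1) / real n)"
    have "real n * t < of_int \<lfloor>real n * t\<rfloor> + 1" by linarith
    then have "t < b" using t False by (auto simp: b_def field_simps)
    moreover have "step_path n V s = step_path n V t" if s: "t < s" "s < b" for s
    proof -
      have "real n * t \<le> real n * s" using s by (intro mult_left_mono) auto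
      moreover have "real n * s < of_int \<lfloor>real n * t\<rfloor> + 1"
        using s False by (auto simp: b_def field_simps)
      ultimately have "\<lfloor>real n * s\<rfloor> = \<lfloor>real n * t\<rfloor>" by linarith
      then show ?thesis using s t by (auto simp: step_path_def b_def)
    qed
    ultimately show ?thesis by (auto simp: eventually_at_right_field)
  qed
  then show "(step_path n V \<longlongrightarrow> step_path n V t) (at_right t)" by (rule tendsto_eventually)
next
  fix t :: real assume t: "t \<in> {0<..1}"
  \<comment> \<open>The value of the floor just before \<open>t\<close>, also when \<open>real n * t\<close> is an integer.\<close>
  define j where "j = \<lceil>real n * t\<rceil> - 1"
  have "\<forall>\<^sub>F s in at_left t. step_path n V s = V (nat (if n = 0 then 0 else j))"
  proof (cases "n = 0")
    case True
    then show ?thesis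
      using t by (auto simp: eventually_at_left_field step_path_def intro!: exI[of _ 0])
  next
    case False
    define b where "b = max 0 (of_int j / real n)"
    have "of_int j < real n * t" unfolding j_def by linarith
    then have "b < t" using t False by (auto simp: b_def field_simps)
    moreover have "step_path n V s = V (nat j)" if s: "b < s" "s < t" for s
    proof -
      have "real n * s < real n * t" using s False by simp
      moreover have "of_int j < real n * s" using s False by (auto simp: b_def field_simps)
      ultimately have "\<lfloor>real n * s\<rfloor> = j" unfolding j_def by linarith
      then show ?thesis using s t by (auto simp: step_path_def b_def)
    qed
    ultimately show ?thesis using False by (auto simp: eventually_at_left_field)
  qed
  then show "\<exists>l. (step_path n V \<longlongrightarrow> l) (at_left t)" by (blast intro: tendsto_eventually)
qed

definition line :: "real \<Rightarrow> real \<Rightarrow> real" where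
  "line w = (\<lambda>t\<in>{0..1}. t * w)"

lemma linear_path_eq_line: "linear_path W \<omega> = line (W \<omega>)"
  by (simp add: linear_path_def line_def)

lemma line_cadlag: "line w \<in> cadlag"
  unfolding cadlag_def
proof (intro CollectI conjI ballI)
  show "line w \<in> extensional {0..1}" by (simp add: line_def)
next
  fix t :: real assume t: "t \<in> {0..<1}"
  have "\<forall>\<^sub>F s in at_right t. s * w = line w s"
    using t by (auto simp: eventually_at_right_field line_def intro!: exI[of _ 1])
  moreover have "((\<lambda>s. s * w) \<longlongrightarrow> t * w) (at_right t)" by (intro tendsto_intros)
  ultimately have "(line w \<longlongrightarrow> t * w) (at_right t)" by (rule Lim_transform_eventually[rotated])
  then show "(line w \<longlongrightarrow> line w t) (at_right t)" using t by (simp add: line_def)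
next
  fix t :: real assume t: "t \<in> {0<..1}"
  have "\<forall>\<^sub>F s in at_left t. s * w = line w s"
    using t by (auto simp: eventually_at_left_field line_def intro!: exI[of _ 0])
  moreover have "((\<lambda>s. s * w) \<longlongrightarrow> t * w) (at_left t)" by (intro tendsto_intros)
  ultimately have "(line w \<longlongrightarrow> t * w) (at_left t)" by (rule Lim_transform_eventually[rotated])
  then show "\<exists>l. (line w \<longlongrightarrow> l) (at_left t)" by blast
qed

lemma skorokhod_dist_le_uniform:
  assumes "x \<in> cadlag" "y \<in> cadlag" "0 < e" "\<And>t. t \<in> {0..1} \<Longrightarrow> \<bar>x t - y t\<bar> \<le> e"
  shows "skorokhod_dist x y \<le> e"
proof -
  have "e \<in> skorokhod_close x y"
    using assms by (intro skorokhod_closeI[OF _ time_changes_id]) auto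
  then show ?thesis
    unfolding skorokhod_dist_eq[OF assms(1,2)] by (rule cInf_lower[OF _ skorokhod_close_bdd_below])
qed

text \<open>The identity is an admissible time change, so uniform closeness implies closeness in the Skorokhod
  metric; it suffices to check continuity uniformly in time.\<close>

lemma continuous_map_skorokhodI:
  fixes f :: "'a::topological_space \<Rightarrow> real \<Rightarrow> real"
  assumes cadlag: "\<And>x. f x \<in> cadlag"
    and cont: "\<And>x e. 0 < e \<Longrightarrow> \<exists>T. open T \<and> x \<in> T \<and> (\<forall>y\<in>T. \<forall>t\<in>{0..1}. \<bar>f x t - f y t\<bar> \<le> e)"
  shows "continuous_map euclidean skorokhod_topology f"
proof (unfold continuous_map_def, intro conjI allI impI)
  show "f \<in> topspace euclidean \<rightarrow> topspace skorokhod_topology" using cadlag by auto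
  fix U assume U: "openin skorokhod_topology U"
  have "open {x. f x \<in> U}"
  proof (subst open_subopen, intro ballI)
    fix x assume "x \<in> {x. f x \<in> U}"
    then obtain r where r: "0 < r" "skorokhod.mball (f x) r \<subseteq> U"
      using U by (auto simp: skorokhod.openin_mtopology)
    obtain T where T: "open T" "x \<in> T" "\<And>y t. y \<in> T \<Longrightarrow> t \<in> {0..1} \<Longrightarrow> \<bar>f x t - f y t\<bar> \<le> r / 2"
      using cont[of "r / 2" x] r by auto
    have "f y \<in> U" if "y \<in> T" for y
    proof -
      have "skorokhod_dist (f x) (f y) \<le> r / 2"
        using r T(3)[OF that] by (intro skorokhod_dist_le_uniform cadlag) auto
      then have "f y \<in> skorokhod.mball (f x) r" using r cadlag by (simp add: skorokhod.in_mball)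
      then show ?thesis using r by blast
    qed
    then show "\<exists>T. open T \<and> x \<in> T \<and> T \<subseteq> {x. f x \<in> U}" using T by blast
  qed
  then show "openin euclidean {x \<in> topspace euclidean. f x \<in> U}" by simp
qed

lemma continuous_map_step_path:
  "continuous_map euclidean skorokhod_topology (step_path n)"
proof (rule continuous_map_skorokhodI[OF step_path_cadlag])
  fix V :: "nat \<Rightarrow> real" and e :: real assume e: "0 < e"
  let ?T = "\<Inter>j\<in>{..n}. {V'. \<bar>V j - V' j\<bar> < e}"
  have "open ?T"
    by (intro open_INT ballI open_Collect_less continuous_intros) auto
  moreover have "\<bar>step_path n V t - step_path n V' t\<bar> \<le> e" if "V' \<in> ?T" "t \<in> {0..1}" for V' t
  proof -
    have "real n * t \<le> real n * 1" using that by (intro mult_left_mono) auto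
    then have "nat \<lfloor>real n * t\<rfloor> \<le> n" by linarith
    then show ?thesis using that by (auto simp: step_path_def intro: less_imp_le)
  qed
  ultimately show "\<exists>T. open T \<and> V \<in> T \<and> (\<forall>V'\<in>T. \<forall>t\<in>{0..1}. \<bar>step_path n V t - step_path n V' t\<bar> \<le> e)"
    using e by (intro exI[of _ ?T]) auto
qed

lemma continuous_map_line: "continuous_map euclidean skorokhod_topology line"
proof (rule continuous_map_skorokhodI[OF line_cadlag])
  fix w e :: real assume e: "0 < e"
  have "\<bar>line w t - line w' t\<bar> \<le> e" if "w' \<in> ball w e" "t \<in> {0..1}" for w' t
  proof -
    have "\<bar>t * (w - w')\<bar> \<le> 1 * \<bar>w - w'\<bar>"
      unfolding abs_mult using that by (intro mult_right_mono) auto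
    also have "\<dots> \<le> e" using that by (simp add: dist_real_def)
    finally show ?thesis using that by (simp add: line_def algebra_simps)
  qed
  then show "\<exists>T. open T \<and> w \<in> T \<and> (\<forall>y\<in>T. \<forall>t\<in>{0..1}. \<bar>line w t - line y t\<bar> \<le> e)"
    using e by (intro exI[of _ "ball w e"]) auto
qed

lemma space_borel_of [simp]: "space (borel_of T) = topspace T"
  unfolding borel_of_def by (rule space_measure_of) (auto dest: openin_subset)

lemma openin_imp_sets_borel_of: "openin T U \<Longrightarrow> U \<in> sets (borel_of T)"
  unfolding borel_of_def by (subst sets_measure_of) (auto dest: openin_subset)

lemma measurable_borel_of_continuous:
  assumes "continuous_map euclidean T f"
  shows "f \<in> borel \<rightarrow>\<^sub>M borel_of T"
  unfolding borel_of_def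
proof (rule measurable_measure_of)
  show "{U. openin T U} \<subseteq> Pow (topspace T)" by (auto dest: openin_subset)
  show "f \<in> space borel \<rightarrow> topspace T" using assms by (auto simp: continuous_map_def)
  fix U assume "U \<in> {U. openin T U}"
  then have "open {x. f x \<in> U}" using assms by (simp add: continuous_map_def)
  then show "f -` U \<inter> space borel \<in> sets borel" by (simp add: vimage_def borel_open)
qed

lemma borel_measurable_continuous_map:
  assumes "continuous_map T euclideanreal g"
  shows "g \<in> borel_of T \<rightarrow>\<^sub>M borel"
proof (rule borel_measurableI)
  fix S :: "real set" assume "open S"
  then have "openin T {x \<in> topspace T. g x \<in> S}" using assms by (simp add: continuous_map_def)
  moreover have "{x \<in> topspace T. g x \<in> S} = g -` S \<inter> space (borel_of T)" by auto
  ultimately show "g -` S \<inter> space (borel_of T) \<in> sets (borel_of T)"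
    using openin_imp_sets_borel_of by metis
qed

lemma measurable_step_path:
  assumes "\<And>j. (\<lambda>\<omega>. V \<omega> j) \<in> borel_measurable M"
  shows "(\<lambda>\<omega>. step_path n (V \<omega>)) \<in> M \<rightarrow>\<^sub>M borel_of skorokhod_topology"
proof -
  have "V \<in> M \<rightarrow>\<^sub>M borel" using assms by (rule measurable_coordinatewise_then_product)
  then show ?thesis
    by (rule measurable_compose[OF _ measurable_borel_of_continuous[OF continuous_map_step_path]])
qed

text \<open>A form of Slutsky's theorem. Fix a continuous functional \<open>g\<close> bounded by \<open>B\<close>. The set \<open>A \<delta>\<close> of slopes \<open>w\<close> such that
  some path at distance less than \<open>\<delta>\<close> from \<open>line w\<close> changes \<open>g\<close> by more than \<open>\<eta>\<close> is open and decreases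
  to the empty set as \<open>\<delta>\<close> decreases to 0. As the law of the slopes \<open>U n\<close> does not depend on \<open>n\<close>,
  one \<open>\<delta>\<close> serves all \<open>n\<close> simultaneously.\<close>

lemma converges_in_distribution_to_line:
  assumes M: "prob_space M" and N: "prob_space N"
    and Y: "\<And>n. Y n \<in> M \<rightarrow>\<^sub>M borel_of skorokhod_topology"
    and U: "\<And>n. U n \<in> borel_measurable M" and W: "W \<in> borel_measurable N"
    and law: "\<forall>\<^sub>F n in sequentially. distr M borel (U n) = distr N borel W"
    and close: "\<forall>\<^sub>F n in sequentially. \<forall>\<omega>\<in>space M. \<forall>t\<in>{0..1}. \<bar>Y n \<omega> t - t * U n \<omega>\<bar> \<le> R n \<omega>"
    and R: "\<And>n. sq_integrable M (R n)" "(\<lambda>n. LINT \<omega>|M. (R n \<omega>)\<^sup>2) \<longlonglongrightarrow> 0"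
  shows "converges_in_distribution skorokhod_topology M Y N (linear_path W)"
proof -
  interpret M: prob_space M by fact
  interpret N: prob_space N by fact
  let ?\<nu> = "distr N borel W"
  interpret \<nu>: prob_space ?\<nu> using W by (rule N.prob_space_distr)
  note [measurable] = U W
  have line_meas: "line \<in> borel \<rightarrow>\<^sub>M borel_of skorokhod_topology"
    by (rule measurable_borel_of_continuous[OF continuous_map_line])
  have L: "linear_path W \<in> N \<rightarrow>\<^sub>M borel_of skorokhod_topology"
    unfolding linear_path_eq_line[abs_def] using W line_meas by (rule measurable_compose)
  have "(\<lambda>n. LINT \<omega>|M. g (Y n \<omega>)) \<longlonglongrightarrow> (LINT \<omega>|N. g (linear_path W \<omega>))"
    if g: "continuous_map skorokhod_topology euclideanreal g" "bounded (g ` topspace skorokhod_topology)" for g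
  proof -
    obtain B where B: "\<And>x. x \<in> cadlag \<Longrightarrow> \<bar>g x\<bar> \<le> B"
      using g(2) by (auto simp: bounded_iff)
    have B0: "0 \<le> B" using B[OF line_cadlag[of 0]] by linarith
    have g_meas: "g \<in> borel_of skorokhod_topology \<rightarrow>\<^sub>M borel"
      by (rule borel_measurable_continuous_map[OF g(1)])
    have Y_cadlag: "Y n \<omega> \<in> cadlag" if "\<omega> \<in> space M" for n \<omega>
      using measurable_space[OF Y that] by simp
    have gY [measurable]: "(\<lambda>\<omega>. g (Y n \<omega>)) \<in> borel_measurable M" for n
      using Y g_meas by (rule measurable_compose)
    have cont: "continuous_on UNIV (\<lambda>w. g (line w))"
      using continuous_map_compose[OF continuous_map_line g(1)] by (simp add: o_def)
    then have gl [measurable]: "(\<lambda>w. g (line w)) \<in> borel_measurable borel"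
      by (rule borel_measurable_continuous_onI)
    have int_gY: "integrable M (\<lambda>\<omega>. g (Y n \<omega>))" for n
      by (rule M.integrable_const_bound[of _ B]) (use B Y_cadlag in auto)
    have int_gU: "integrable M (\<lambda>\<omega>. g (line (U n \<omega>)))" for n
      by (rule M.integrable_const_bound[of _ B]) (use B line_cadlag in auto)
    show ?thesis
    proof (rule LIMSEQ_I)
      fix e :: real assume e: "0 < e"
      \<comment> \<open>The final estimate is \<open>\<eta> * (1 + 4 * B)\<close>.\<close>
      define \<eta> where "\<eta> = e / (2 + 4 * B)"
      have \<eta>: "0 < \<eta>" "\<eta> * (1 + 4 * B) < e"
        using e B0 by (auto simp: \<eta>_def field_simps)
      define A where "A \<delta> = {w. \<exists>y\<in>cadlag. skorokhod_dist (line w) y < \<delta> \<and> \<eta> < \<bar>g y - g (line w)\<bar>}" for \<delta>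
      have A_open: "open (A \<delta>)" for \<delta>
      proof -
        have "A \<delta> = (\<Union>y\<in>cadlag. {w. line w \<in> skorokhod.mball y \<delta>} \<inter> {w. \<eta> < \<bar>g y - g (line w)\<bar>})"
          using line_cadlag by (auto simp: A_def skorokhod.in_mball skorokhod_dist_commute)
        moreover have "open {w. line w \<in> skorokhod.mball y \<delta>}" for y
          using continuous_map_line skorokhod.openin_mball[of y \<delta>]
          by (simp add: continuous_map_def del: skorokhod.in_mball)
        moreover have "open {w. \<eta> < \<bar>g y - g (line w)\<bar>}" for y
          by (intro open_Collect_less continuous_intros cont)
        ultimately show ?thesis by (metis (no_types, lifting) open_Int open_UN)
      qed
      have A_empty: "(\<Inter>k. A (1 / real (Suc k))) = {}"
      proof (rule ccontr)
        assume "\<not> ?thesis"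
        then obtain w where w: "\<And>k. w \<in> A (1 / real (Suc k))" by auto
        have "openin skorokhod_topology {y \<in> topspace skorokhod_topology. g y \<in> ball (g (line w)) \<eta>}"
          using g(1) open_ball[of "g (line w)" \<eta>] unfolding continuous_map_def by (metis open_openin)
        moreover have "line w \<in> {y \<in> topspace skorokhod_topology. g y \<in> ball (g (line w)) \<eta>}"
          using line_cadlag \<eta> by simp
        ultimately obtain r where r: "0 < r"
          "skorokhod.mball (line w) r \<subseteq> {y \<in> topspace skorokhod_topology. g y \<in> ball (g (line w)) \<eta>}"
          unfolding skorokhod.openin_mtopology by blast
        obtain k where k: "1 / real (Suc k) < r" using nat_approx_posE[OF r(1)] by blast
        obtain y where y: "y \<in> cadlag" "skorokhod_dist (line w) y < 1 / real (Suc k)" "\<eta> < \<bar>g y - g (line w)\<bar>"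
          using w[of k] by (auto simp: A_def)
        then have "y \<in> skorokhod.mball (line w) r" using k line_cadlag by (simp add: skorokhod.in_mball)
        then have "\<bar>g y - g (line w)\<bar> < \<eta>" using r(2) by (auto simp: dist_real_def abs_minus_commute)
        then show False using y by simp
      qed
      have "decseq (\<lambda>k. A (1 / real (Suc k)))"
      proof (rule decseq_SucI)
        fix k
        have "1 / real (Suc (Suc k)) \<le> 1 / real (Suc k)" by (simp add: field_simps)
        then show "A (1 / real (Suc (Suc k))) \<subseteq> A (1 / real (Suc k))"
          unfolding A_def by (blast intro: order.strict_trans2)
      qed
      then have "(\<lambda>k. measure ?\<nu> (A (1 / real (Suc k)))) \<longlonglongrightarrow> measure ?\<nu> (\<Inter>k. A (1 / real (Suc k)))"
        by (intro \<nu>.finite_Lim_measure_decseq) (auto intro: borel_open A_open)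
      then have "(\<lambda>k. measure ?\<nu> (A (1 / real (Suc k)))) \<longlonglongrightarrow> 0" unfolding A_empty by simp
      from LIMSEQ_D[OF this \<eta>(1)] obtain k where k: "measure ?\<nu> (A (1 / real (Suc k))) < \<eta>" by auto
      define \<delta> where "\<delta> = 1 / real (Suc k)"
      have \<delta>: "0 < \<delta>" "measure ?\<nu> (A \<delta>) < \<eta>" using k by (auto simp: \<delta>_def)
      have "0 < \<delta>\<^sup>2 * \<eta>" using \<delta> \<eta> by simp
      from R(2) this have "\<forall>\<^sub>F n in sequentially. (LINT \<omega>|M. (R n \<omega>)\<^sup>2) < \<delta>\<^sup>2 * \<eta>"
        by (rule order_tendstoD)
      with law close have "\<forall>\<^sub>F n in sequentially. \<bar>(LINT \<omega>|M. g (Y n \<omega>)) - (LINT \<omega>|N. g (linear_path W \<omega>))\<bar> < e"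
      proof eventually_elim
        case (elim n)
        have "(LINT \<omega>|N. g (linear_path W \<omega>)) = (LINT w|?\<nu>. g (line w))"
          by (simp add: integral_distr linear_path_eq_line)
        also have "\<dots> = (LINT \<omega>|M. g (line (U n \<omega>)))"
          by (simp add: integral_distr flip: elim(1))
        finally have "\<bar>(LINT \<omega>|M. g (Y n \<omega>)) - (LINT \<omega>|N. g (linear_path W \<omega>))\<bar>
            = \<bar>LINT \<omega>|M. g (Y n \<omega>) - g (line (U n \<omega>))\<bar>"
          using int_gY int_gU by simp
        also have "\<dots> \<le> (LINT \<omega>|M. \<bar>g (Y n \<omega>) - g (line (U n \<omega>))\<bar>)"
          by (rule integral_abs_bound)
        also have "\<dots> \<le> (LINT \<omega>|M. \<eta> + 2 * B * indicator (A \<delta>) (U n \<omega>) + 2 * B / \<delta>\<^sup>2 * (R n \<omega>)\<^sup>2)"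
        proof (rule integral_mono)
          show "integrable M (\<lambda>\<omega>. \<bar>g (Y n \<omega>) - g (line (U n \<omega>))\<bar>)"
            using int_gY int_gU by simp
          have [measurable]: "A \<delta> \<in> sets borel" by (rule borel_open[OF A_open])
          have "integrable M (\<lambda>\<omega>. indicator (A \<delta>) (U n \<omega>) :: real)"
            by (rule M.integrable_const_bound[of _ 1]) auto
          then show "integrable M (\<lambda>\<omega>. \<eta> + 2 * B * indicator (A \<delta>) (U n \<omega>) + 2 * B / \<delta>\<^sup>2 * (R n \<omega>)\<^sup>2)"
            using sq_integrable_square[OF R(1)] by (intro Bochner_Integration.integrable_add integrable_mult_right) auto
          fix \<omega> assume \<omega>: "\<omega> \<in> space M"
          let ?d = "\<bar>g (Y n \<omega>) - g (line (U n \<omega>))\<bar>"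
          have d_le: "?d \<le> 2 * B" using B[OF Y_cadlag[OF \<omega>, of n]] B[OF line_cadlag[of "U n \<omega>"]] by linarith
          have terms: "0 \<le> 2 * B * indicator (A \<delta>) (U n \<omega>)" "0 \<le> 2 * B / \<delta>\<^sup>2 * (R n \<omega>)\<^sup>2"
            using B0 by auto
          show "?d \<le> \<eta> + 2 * B * indicator (A \<delta>) (U n \<omega>) + 2 * B / \<delta>\<^sup>2 * (R n \<omega>)\<^sup>2"
          \<comment> \<open>If \<open>\<delta> \<le> R n \<omega>\<close>, the last summand alone is at least \<open>2 * B\<close>, as in the inequality of Chebyshev.\<close>
          proof (cases "R n \<omega> < \<delta>")
            case False
            then have "\<delta>\<^sup>2 \<le> (R n \<omega>)\<^sup>2" using \<delta> by (intro power_mono) auto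
            then have "1 \<le> (R n \<omega>)\<^sup>2 / \<delta>\<^sup>2" using \<delta> by simp
            then have "2 * B * 1 \<le> 2 * B * ((R n \<omega>)\<^sup>2 / \<delta>\<^sup>2)" using B0 by (intro mult_left_mono) auto
            then have "2 * B \<le> 2 * B / \<delta>\<^sup>2 * (R n \<omega>)\<^sup>2" by simp
            then show ?thesis using d_le terms(1) \<eta>(1) by linarith
          next
            case True
            have R0: "0 \<le> R n \<omega>" using elim(2)[rule_format, OF \<omega>, of 0] by auto
            have "skorokhod_dist (line (U n \<omega>)) (Y n \<omega>) \<le> (R n \<omega> + \<delta>) / 2"
            proof (rule skorokhod_dist_le_uniform[OF line_cadlag Y_cadlag[OF \<omega>]])
              show "0 < (R n \<omega> + \<delta>) / 2" using R0 \<delta> by simp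
              fix t :: real assume t: "t \<in> {0..1}"
              have "\<bar>Y n \<omega> t - t * U n \<omega>\<bar> \<le> R n \<omega>" using elim(2) \<omega> t by blast
              then show "\<bar>line (U n \<omega>) t - Y n \<omega> t\<bar> \<le> (R n \<omega> + \<delta>) / 2"
                using True t by (simp add: line_def abs_minus_commute)
            qed
            then have "skorokhod_dist (line (U n \<omega>)) (Y n \<omega>) < \<delta>" using True by simp
            then have "U n \<omega> \<in> A \<delta> \<or> ?d \<le> \<eta>"
              using Y_cadlag[OF \<omega>, of n] unfolding A_def by (auto simp: not_less[symmetric])
            then show ?thesis
            proof
              assume "U n \<omega> \<in> A \<delta>"
              then have "indicator (A \<delta>) (U n \<omega>) = (1 :: real)" by simp
              then show ?thesis using d_le terms(2) \<eta>(1) by (simp only: mult_1_right)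
            qed (use terms in linarith)
          qed
        qed
        also have "\<dots> = \<eta> + 2 * B * measure ?\<nu> (A \<delta>) + 2 * B / \<delta>\<^sup>2 * (LINT \<omega>|M. (R n \<omega>)\<^sup>2)"
        proof -
          have [measurable]: "A \<delta> \<in> sets borel" by (rule borel_open[OF A_open])
          have i: "integrable M (\<lambda>\<omega>. indicator (A \<delta>) (U n \<omega>) :: real)"
            by (rule M.integrable_const_bound[of _ 1]) auto
          have "(LINT \<omega>|M. indicator (A \<delta>) (U n \<omega>)) = (LINT w|distr M borel (U n). indicator (A \<delta>) w :: real)"
            by (subst integral_distr) auto
          also have "\<dots> = measure ?\<nu> (A \<delta>)" unfolding elim(1) by simp
          finally show ?thesis
            using i sq_integrable_square[OF R(1)[of n]] M.prob_space by (simp add: integrable_mult_right)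
        qed
        also have "\<dots> \<le> \<eta> + 2 * B * \<eta> + 2 * B / \<delta>\<^sup>2 * (\<delta>\<^sup>2 * \<eta>)"
          using elim(3) \<delta> B0 by (intro add_mono mult_left_mono) auto
        also have "\<dots> = \<eta> * (1 + 4 * B)" using \<delta> by (simp add: algebra_simps)
        also have "\<dots> < e" by fact
        finally show ?case .
      qed
      then show "\<exists>no. \<forall>n\<ge>no. norm ((LINT \<omega>|M. g (Y n \<omega>)) - (LINT \<omega>|N. g (linear_path W \<omega>))) < e"
        by (simp add: eventually_sequentially)
    qed
  qed
  then show ?thesis unfolding converges_in_distribution_def using Y L by blast
qed

section \<open>Mean-square constancy of the normalized process\<close>

lemma distr_std_normal:
  assumes "distributed M lborel Z std_normal_density"
  shows "distr M borel Z = gauss"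
  using assms by (simp add: distributed_def cong: distr_cong)

lemma
  assumes Z: "distributed M lborel Z std_normal_density" and h: "h \<in> borel_measurable borel"
  shows integral_std_normal: "(LINT \<omega>|M. h (Z \<omega>)) = (LINT x|gauss. (h x :: real))"
    and integrable_std_normal: "integrable M (\<lambda>\<omega>. h (Z \<omega>)) \<longleftrightarrow> integrable gauss h"
proof -
  have [measurable]: "Z \<in> borel_measurable M" using Z by (simp add: distributed_def)
  show "(LINT \<omega>|M. h (Z \<omega>)) = (LINT x|gauss. h x)"
    unfolding distr_std_normal[OF Z, symmetric] using h by (simp add: integral_distr)
  show "integrable M (\<lambda>\<omega>. h (Z \<omega>)) \<longleftrightarrow> integrable gauss h"
    unfolding distr_std_normal[OF Z, symmetric] using h by (simp add: integrable_distr_eq)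
qed

lemma sq_integrable_std_normal:
  assumes Z: "distributed M lborel Z std_normal_density" and h: "sq_integrable gauss h"
  shows "sq_integrable M (\<lambda>\<omega>. h (Z \<omega>))"
proof -
  have [measurable]: "Z \<in> borel_measurable M" using Z by (simp add: distributed_def)
  have [measurable]: "h \<in> borel_measurable borel" using sq_integrable_measurable[OF h] by simp
  show ?thesis
    using integrable_std_normal[OF Z, of "\<lambda>x. (h x)\<^sup>2"] h by (simp add: sq_integrable_def)
qed

lemma distributed_AE_cong:
  assumes "distributed M N Z f" "Z' \<in> M \<rightarrow>\<^sub>M N" "AE \<omega> in M. Z' \<omega> = Z \<omega>"
  shows "distributed M N Z' f"
proof -
  have "distr M N Z' = distr M N Z"
    by (rule distr_cong_AE) (use assms in \<open>auto simp: distributed_def\<close>)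
  then show ?thesis using assms by (simp add: distributed_def)
qed

lemma square_diff_power_le:
  fixes a b :: real
  shows "(a ^ Suc m - b ^ Suc m)\<^sup>2 \<le> (real (Suc m))\<^sup>2 * ((a - b)\<^sup>2 * (a ^ (2 * m) + b ^ (2 * m)))"
proof -
  have "(a ^ Suc m - b ^ Suc m)\<^sup>2 = (a - b)\<^sup>2 * (\<Sum>i<Suc m. b ^ (Suc m - Suc i) * a ^ i)\<^sup>2"
    unfolding power_diff_sumr2 by (simp add: power_mult_distrib)
  also have "\<dots> \<le> (a - b)\<^sup>2 * ((\<Sum>i<Suc m. a ^ (2 * m) + b ^ (2 * m)) * real (card {..<Suc m}))"
  proof (intro mult_left_mono order_trans[OF sum_squared_le_sum_of_squares] mult_right_mono sum_mono)
    fix i assume i: "i \<in> {..<Suc m}"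
    define M where "M = max \<bar>a\<bar> \<bar>b\<bar>"
    have "(b ^ (Suc m - Suc i) * a ^ i)\<^sup>2 = (\<bar>b\<bar> ^ (m - i) * \<bar>a\<bar> ^ i)\<^sup>2"
      by (simp add: power_mult_distrib flip: power_abs)
    also have "\<dots> \<le> (M ^ (m - i) * M ^ i)\<^sup>2"
      by (intro power_mono mult_mono) (auto simp: M_def)
    also have "\<dots> = M ^ (2 * m)"
      using i by (simp flip: power_add power_mult add: mult.commute)
    also have "\<dots> \<le> \<bar>a\<bar> ^ (2 * m) + \<bar>b\<bar> ^ (2 * m)"
      unfolding M_def max_def by auto
    also have "\<dots> = a ^ (2 * m) + b ^ (2 * m)" by (simp add: power_even_abs)
    finally show "(b ^ (Suc m - Suc i) * a ^ i)\<^sup>2 \<le> a ^ (2 * m) + b ^ (2 * m)" .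
  qed auto
  also have "\<dots> = (real (Suc m))\<^sup>2 * ((a - b)\<^sup>2 * (a ^ (2 * m) + b ^ (2 * m)))"
    by (simp add: power2_eq_square)
  finally show ?thesis .
qed

context nearly_unstable_ar1
begin

abbreviation \<alpha> :: "nat \<Rightarrow> real" where "\<alpha> \<equiv> ar_coeff \<gamma> \<beta>"

definition stationary_sd :: "nat \<Rightarrow> real" where
  "stationary_sd n = sqrt ((\<sigma> n)\<^sup>2 / (1 - (\<alpha> n)\<^sup>2))"

text \<open>The process scaled to unit variance; all comparisons between different times are made on this
  scale, where the three regimes coincide.\<close>

definition X_std :: "nat \<Rightarrow> nat \<Rightarrow> 'a \<Rightarrow> real" where
  "X_std k n \<omega> = X k n \<omega> / stationary_sd n"

lemma ar_coeff_bounds: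
  assumes "1 \<le> n"
  shows "0 < \<alpha> n" "\<alpha> n < 1"
proof -
  have "1 \<le> real n powr \<beta>" using assms beta by (simp add: ge_one_powr_ge_zero)
  then have "\<gamma> / real n powr \<beta> \<le> \<gamma> / 1" using gamma assms by (intro divide_left_mono) auto
  then show "0 < \<alpha> n" using gamma by (simp add: ar_coeff_def)
  show "\<alpha> n < 1" using gamma assms by (simp add: ar_coeff_def)
qed

lemma stationary_variance:
  assumes "1 \<le> n"
  shows "0 < stationary_sd n" "(\<sigma> n)\<^sup>2 = (1 - (\<alpha> n)\<^sup>2) * (stationary_sd n)\<^sup>2"
proof -
  have "(\<alpha> n)\<^sup>2 < 1" using ar_coeff_bounds[OF assms] by (simp add: power_less_one_iff)
  moreover have "0 < (\<sigma> n)\<^sup>2" using sigma_pos[OF assms] by simp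
  ultimately show "0 < stationary_sd n" "(\<sigma> n)\<^sup>2 = (1 - (\<alpha> n)\<^sup>2) * (stationary_sd n)\<^sup>2"
    by (auto simp: stationary_sd_def)
qed

text \<open>Together with the variance \<open>\<alpha>\<^sub>n\<^bsup>2k\<^esup> s\<^sub>n\<^sup>2\<close> carried over from the initial value this adds up to
  \<open>s\<^sub>n\<^sup>2\<close>, which is stationarity.\<close>

lemma moving_average_variance:
  assumes "1 \<le> n"
  shows "(\<Sum>j=1..k. ((\<alpha> n) ^ (k - j) * \<sigma> n)\<^sup>2) = (1 - (\<alpha> n) ^ (2 * k)) * (stationary_sd n)\<^sup>2"
proof (induction k)
  case (Suc k)
  have "(\<Sum>j=1..Suc k. ((\<alpha> n) ^ (Suc k - j) * \<sigma> n)\<^sup>2)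
      = (\<Sum>j=1..k. (\<alpha> n)\<^sup>2 * ((\<alpha> n) ^ (k - j) * \<sigma> n)\<^sup>2) + (\<sigma> n)\<^sup>2"
  proof -
    have "((\<alpha> n) ^ (Suc k - j) * \<sigma> n)\<^sup>2 = (\<alpha> n)\<^sup>2 * ((\<alpha> n) ^ (k - j) * \<sigma> n)\<^sup>2" if "j \<in> {1..k}" for j
      using that by (simp add: Suc_diff_le power_mult_distrib)
    then have "(\<Sum>j=1..k. ((\<alpha> n) ^ (Suc k - j) * \<sigma> n)\<^sup>2) = (\<Sum>j=1..k. (\<alpha> n)\<^sup>2 * ((\<alpha> n) ^ (k - j) * \<sigma> n)\<^sup>2)"
      by (rule sum.cong[OF refl])
    then show ?thesis by simp
  qed
  also have "\<dots> = (\<alpha> n)\<^sup>2 * ((1 - (\<alpha> n) ^ (2 * k)) * (stationary_sd n)\<^sup>2) + (1 - (\<alpha> n)\<^sup>2) * (stationary_sd n)\<^sup>2"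
    unfolding sum_distrib_left[symmetric] Suc.IH stationary_variance(2)[OF assms] ..
  also have "\<dots> = (1 - (\<alpha> n) ^ (2 * Suc k)) * (stationary_sd n)\<^sup>2"
    by (simp add: algebra_simps power2_eq_square)
  finally show ?case .
qed simp

lemma moving_average_representation:
  assumes "1 \<le> n"
  shows "AE \<omega> in M. X k n \<omega> = (\<alpha> n) ^ k * X 0 n \<omega> + (\<Sum>j=1..k. (\<alpha> n) ^ (k - j) * \<sigma> n * \<epsilon> j \<omega>)"
proof (induction k)
  case (Suc k)
  from recursion[OF assms, of "Suc k"] have
    "AE \<omega> in M. X (Suc k) n \<omega> = \<alpha> n * X k n \<omega> + \<sigma> n * \<epsilon> (Suc k) \<omega>" by simp
  with Suc.IH show ?case
  proof eventually_elim
    case (elim \<omega>)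
    have "\<alpha> n * (\<Sum>j=1..k. (\<alpha> n) ^ (k - j) * \<sigma> n * \<epsilon> j \<omega>) = (\<Sum>j=1..k. (\<alpha> n) ^ (Suc k - j) * \<sigma> n * \<epsilon> j \<omega>)"
      unfolding sum_distrib_left by (intro sum.cong refl) (simp add: Suc_diff_le)
    then show ?case unfolding elim(2) elim(1) by (simp add: algebra_simps)
  qed
qed simp

text \<open>The common source of the law of \<open>X k n\<close> and of the law of the increment \<open>X k n - X 0 n\<close>: both are
  linear combinations of the same independent normal variables. The coefficients have to be nonzero
  because a degenerate normal variable has no density.\<close>

lemma distributed_linear_combination:
  assumes n: "1 \<le> n" and a: "a \<noteq> 0" and b: "\<And>j. j \<in> {1..k} \<Longrightarrow> b j \<noteq> 0"
  shows "distributed M lborel (\<lambda>\<omega>. a * X 0 n \<omega> + (\<Sum>j=1..k. b j * \<epsilon> j \<omega>))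
    (normal_density 0 (sqrt (a\<^sup>2 * (stationary_sd n)\<^sup>2 + (\<Sum>j=1..k. (b j)\<^sup>2))))"
proof -
  define S where "S j = (if j = 0 then \<bar>a\<bar> * stationary_sd n else \<bar>b j\<bar>)" for j
  define w where "w j = (if j = 0 then a else b j)" for j
  define \<xi> where "\<xi> j = (if j = 0 then X 0 n else \<epsilon> j)" for j
  have indep': "indep_vars (\<lambda>_. borel) (\<lambda>j \<omega>. w j * \<xi> j \<omega>) {0..k}"
  proof (rule indep_vars_compose2[where Y = "\<lambda>j x. w j * x"])
    show "indep_vars (\<lambda>_. borel) \<xi> {0..k}"
      using indep[OF n] unfolding \<xi>_def by (rule indep_vars_subset) auto
  qed simp
  have normal: "distributed M lborel (\<lambda>\<omega>. w j * \<xi> j \<omega>) (normal_density 0 (S j))" if "j \<in> {0..k}" for j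
  proof (cases "j = 0")
    case True
    have "distributed M lborel (\<lambda>\<omega>. 0 + a * X 0 n \<omega>) (normal_density (0 + a * 0) (\<bar>a\<bar> * stationary_sd n))"
      using initial_normal[OF n] stationary_variance[OF n] a
      unfolding stationary_sd_def by (intro normal_density_affine) auto
    then show ?thesis by (simp add: True w_def \<xi>_def S_def)
  next
    case False
    have "distributed M lborel (\<lambda>\<omega>. 0 + b j * \<epsilon> j \<omega>) (normal_density (0 + b j * 0) (\<bar>b j\<bar> * 1))"
      using innovations_normal[of j] b[of j] False that by (intro normal_density_affine) auto
    then show ?thesis using False by (simp add: w_def \<xi>_def S_def)
  qed
  have "distributed M lborel (\<lambda>\<omega>. \<Sum>j\<in>{0..k}. w j * \<xi> j \<omega>)
      (normal_density (\<Sum>j\<in>{0..k}. 0) (sqrt (\<Sum>j\<in>{0..k}. (S j)\<^sup>2)))"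
  proof (rule sum_indep_normal[OF _ _ indep' _ normal])
    show "0 < S j" if "j \<in> {0..k}" for j
      using that a b[of j] stationary_variance(1)[OF n] by (auto simp: S_def)
  qed auto
  moreover have "(\<Sum>j\<in>{0..k}. w j * \<xi> j \<omega>) = a * X 0 n \<omega> + (\<Sum>j=1..k. b j * \<epsilon> j \<omega>)" for \<omega>
    by (simp add: sum.atLeast_Suc_atMost w_def \<xi>_def)
  moreover have "(\<Sum>j\<in>{0..k}. (S j)\<^sup>2) = a\<^sup>2 * (stationary_sd n)\<^sup>2 + (\<Sum>j=1..k. (b j)\<^sup>2)"
    by (simp add: sum.atLeast_Suc_atMost S_def power_mult_distrib)
  ultimately show ?thesis by simp
qed

lemma X_distributed:
  assumes "1 \<le> n"
  shows "distributed M lborel (X k n) (normal_density 0 (stationary_sd n))"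
proof -
  have "(\<alpha> n ^ k)\<^sup>2 * (stationary_sd n)\<^sup>2 + (\<Sum>j=1..k. ((\<alpha> n) ^ (k - j) * \<sigma> n)\<^sup>2) = (stationary_sd n)\<^sup>2"
    unfolding moving_average_variance[OF assms] by (simp add: left_diff_distrib power_even_eq)
  then have "distributed M lborel (\<lambda>\<omega>. (\<alpha> n) ^ k * X 0 n \<omega> + (\<Sum>j=1..k. (\<alpha> n) ^ (k - j) * \<sigma> n * \<epsilon> j \<omega>))
      (normal_density 0 (stationary_sd n))"
    using distributed_linear_combination[OF assms, of "\<alpha> n ^ k" k "\<lambda>j. (\<alpha> n) ^ (k - j) * \<sigma> n"]
      ar_coeff_bounds[OF assms] sigma_pos[OF assms] stationary_variance(1)[OF assms]
    by auto
  then show ?thesis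
    by (rule distributed_AE_cong) (use X_measurable[OF assms] moving_average_representation[OF assms] in auto)
qed

lemma X_std_distributed:
  "1 \<le> n \<Longrightarrow> distributed M lborel (X_std k n) std_normal_density"
  using X_distributed stationary_variance(1) normal_standard_normal_convert[of "stationary_sd n" "X k n" 0]
  by (simp add: X_std_def[abs_def])

lemma X_std_measurable [measurable]: "1 \<le> n \<Longrightarrow> X_std k n \<in> borel_measurable M"
  using X_std_distributed[of n k] by (simp add: distributed_def)

text \<open>The increment is normal with variance \<open>2 * (1 - \<alpha>\<^sub>n\<^sup>k)\<close>, and the fourth moment of a centred normal
  variable is three times its squared variance.\<close>

lemma X_std_increment_fourth_moment:
  assumes n: "1 \<le> n" and k: "1 \<le> k"
  shows "integrable M (\<lambda>\<omega>. (X_std k n \<omega> - X_std 0 n \<omega>) ^ 4)"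
    "(LINT \<omega>|M. (X_std k n \<omega> - X_std 0 n \<omega>) ^ 4) = 12 * (1 - \<alpha> n ^ k)\<^sup>2"
proof -
  let ?s = "stationary_sd n" and ?a = "\<alpha> n ^ k"
  have a: "0 < ?a" "?a < 1"
    using ar_coeff_bounds[OF n] k by (auto simp: power_less_one_iff)
  \<comment> \<open>The standard deviation of \<open>X k n - X 0 n\<close>: its variance is \<open>(a - 1)\<^sup>2 s\<^sup>2 + (1 - a\<^sup>2) s\<^sup>2\<close>.\<close>
  define \<tau> where "\<tau> = ?s * sqrt (2 * (1 - ?a))"
  have \<tau>: "0 < \<tau>" using a stationary_variance(1)[OF n] by (simp add: \<tau>_def)
  have "(?a - 1)\<^sup>2 * ?s\<^sup>2 + (\<Sum>j=1..k. ((\<alpha> n) ^ (k - j) * \<sigma> n)\<^sup>2) = \<tau>\<^sup>2"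
    unfolding moving_average_variance[OF n] \<tau>_def using a
    by (simp add: power_mult_distrib power_even_eq power2_diff) (simp add: algebra_simps)
  then have "distributed M lborel (\<lambda>\<omega>. (?a - 1) * X 0 n \<omega> + (\<Sum>j=1..k. (\<alpha> n) ^ (k - j) * \<sigma> n * \<epsilon> j \<omega>))
      (normal_density 0 \<tau>)"
    using distributed_linear_combination[OF n, of "?a - 1" k "\<lambda>j. (\<alpha> n) ^ (k - j) * \<sigma> n"]
      ar_coeff_bounds[OF n] sigma_pos[OF n] \<tau> a
    by auto
  then have D: "distributed M lborel (\<lambda>\<omega>. X k n \<omega> - X 0 n \<omega>) (normal_density 0 \<tau>)"
  proof (rule distributed_AE_cong)
    show "AE \<omega> in M. X k n \<omega> - X 0 n \<omega> = (?a - 1) * X 0 n \<omega> + (\<Sum>j=1..k. (\<alpha> n) ^ (k - j) * \<sigma> n * \<epsilon> j \<omega>)"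
      using moving_average_representation[OF n, of k] by eventually_elim (simp add: algebra_simps)
  qed (use X_measurable[OF n] in auto)
  have eq: "(X_std k n \<omega> - X_std 0 n \<omega>) ^ 4 = (X k n \<omega> - X 0 n \<omega>) ^ (2 * 2) / ?s ^ 4" for \<omega>
    by (simp add: X_std_def diff_divide_distrib[symmetric] power_divide)
  have hb: "has_bochner_integral lborel (\<lambda>x. normal_density 0 \<tau> x * x ^ (2 * 2)) (3 * \<tau> ^ 4)"
  proof -
    have "fact (2 * 2) / ((2 / \<tau>\<^sup>2) ^ 2 * fact 2) = 3 * \<tau> ^ 4"
      using \<tau> by (simp add: fact_numeral power_divide field_simps flip: power_mult)
    then show ?thesis using normal_moment_even[OF \<tau>, of 0 2] by simp
  qed
  have i: "integrable M (\<lambda>\<omega>. (X k n \<omega> - X 0 n \<omega>) ^ (2 * 2))"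
    using distributed_integrable[OF D, of "\<lambda>x. x ^ (2 * 2)"] integrable.intros[OF hb] by simp
  then show "integrable M (\<lambda>\<omega>. (X_std k n \<omega> - X_std 0 n \<omega>) ^ 4)" unfolding eq by simp
  have "(LINT \<omega>|M. (X k n \<omega> - X 0 n \<omega>) ^ (2 * 2)) = 3 * \<tau> ^ 4"
    using distributed_integral[OF D, of "\<lambda>x. x ^ (2 * 2)"] has_bochner_integral_integral_eq[OF hb] by simp
  then have "(LINT \<omega>|M. (X_std k n \<omega> - X_std 0 n \<omega>) ^ 4) = 3 * \<tau> ^ 4 / ?s ^ 4" unfolding eq by simp
  also have "\<tau> ^ 4 = ?s ^ 4 * (2 * (1 - ?a))\<^sup>2"
  proof -
    have "sqrt (2 * (1 - ?a)) ^ 4 = (sqrt (2 * (1 - ?a)) ^ 2) ^ 2" by (simp flip: power_mult)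
    also have "\<dots> = (2 * (1 - ?a))\<^sup>2" using a by (subst real_sqrt_pow2) auto
    finally show ?thesis unfolding \<tau>_def power_mult_distrib[of ?s] by (rule arg_cong)
  qed
  also have "3 * (?s ^ 4 * (2 * (1 - ?a))\<^sup>2) / ?s ^ 4 = 12 * (1 - ?a)\<^sup>2"
    using stationary_variance(1)[OF n] unfolding power_mult_distrib by simp
  finally show "(LINT \<omega>|M. (X_std k n \<omega> - X_std 0 n \<omega>) ^ 4) = 12 * (1 - ?a)\<^sup>2" .
qed

text \<open>The increment enters \<open>a\<^sup>j - b\<^sup>j\<close> as a factor. Splitting the product of this factor with the remaining powers by
  the inequality between arithmetic and geometric means, weighted by \<open>\<theta> = 1 - \<alpha>\<^sub>n\<^sup>k\<close>, makes both parts
  of order \<open>\<theta>\<close>.\<close>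

lemma X_std_power_increment:
  assumes n: "1 \<le> n" and k: "1 \<le> k"
  shows "(LINT \<omega>|M. (X_std k n \<omega> ^ j - X_std 0 n \<omega> ^ j)\<^sup>2)
    \<le> (real j)\<^sup>2 * (6 + 2 * (LINT x|gauss. x ^ (4 * (j - 1)))) * (1 - \<alpha> n ^ k)"
proof (cases j)
  case (Suc m)
  define \<theta> where "\<theta> = 1 - \<alpha> n ^ k"
  have \<theta>: "0 < \<theta>"
    using ar_coeff_bounds[OF n] k by (auto simp: \<theta>_def power_less_one_iff)
  let ?\<mu> = "LINT x|gauss. x ^ (4 * m)"
  have mom: "integrable M (\<lambda>\<omega>. X_std i n \<omega> ^ (4 * m))" "(LINT \<omega>|M. X_std i n \<omega> ^ (4 * m)) = ?\<mu>" for i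
    using integrable_std_normal[OF X_std_distributed[OF n], of "\<lambda>x. x ^ (4 * m)" i]
      integral_std_normal[OF X_std_distributed[OF n], of "\<lambda>x. x ^ (4 * m)" i]
      integrable_std_normal_distribution_moment by auto
  note D4 = X_std_increment_fourth_moment[OF n k]
  have bound: "(a ^ Suc m - b ^ Suc m)\<^sup>2
      \<le> (real (Suc m))\<^sup>2 * ((a - b) ^ 4 / (2 * \<theta>) + \<theta> * (a ^ (4 * m) + b ^ (4 * m)))" for a b :: real
  proof -
    define P where "P = a ^ (2 * m) + b ^ (2 * m)"
    define Q where "Q = a ^ (4 * m) + b ^ (4 * m)"
    have pp: "x ^ (4 * m) = x ^ (2 * m) * x ^ (2 * m)" for x :: real by (simp flip: power_add)
    have "0 \<le> (a ^ (2 * m) - b ^ (2 * m))\<^sup>2" by simp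
    then have PQ: "P\<^sup>2 \<le> 2 * Q"
      unfolding P_def Q_def pp by (simp add: power2_eq_square ring_distribs)
    have "0 \<le> ((a - b)\<^sup>2 - \<theta> * P)\<^sup>2" by simp
    then have "2 * \<theta> * ((a - b)\<^sup>2 * P) \<le> ((a - b)\<^sup>2)\<^sup>2 + \<theta>\<^sup>2 * P\<^sup>2"
      by (simp add: power2_diff[of "(a - b)\<^sup>2"] power_mult_distrib ac_simps)
    also have "\<dots> \<le> (a - b) ^ 4 + \<theta>\<^sup>2 * (2 * Q)"
      using PQ by (intro add_mono mult_left_mono) (auto simp flip: power_mult)
    finally have "(a - b)\<^sup>2 * P \<le> (a - b) ^ 4 / (2 * \<theta>) + \<theta> * Q"
      using \<theta> by (simp add: field_simps power2_eq_square)
    then have "(real (Suc m))\<^sup>2 * ((a - b)\<^sup>2 * P) \<le> (real (Suc m))\<^sup>2 * ((a - b) ^ 4 / (2 * \<theta>) + \<theta> * Q)"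
      by (rule mult_left_mono) simp
    then show ?thesis using square_diff_power_le[of a m b] unfolding P_def Q_def by (rule order_trans[rotated])
  qed
  have "(LINT \<omega>|M. (X_std k n \<omega> ^ Suc m - X_std 0 n \<omega> ^ Suc m)\<^sup>2)
      \<le> (LINT \<omega>|M. (real (Suc m))\<^sup>2 * ((X_std k n \<omega> - X_std 0 n \<omega>) ^ 4 / (2 * \<theta>) + \<theta> * (X_std k n \<omega> ^ (4 * m) + X_std 0 n \<omega> ^ (4 * m))))"
    by (intro integral_mono bound sq_integrable_square sq_integrable_diff
          sq_integrable_std_normal[OF X_std_distributed[OF n], of "\<lambda>x. x ^ Suc m"] sq_integrable_gauss_power
          Bochner_Integration.integrable_add integrable_mult_right integrable_divide mom D4)
  also have "\<dots> = (real (Suc m))\<^sup>2 * ((LINT \<omega>|M. (X_std k n \<omega> - X_std 0 n \<omega>) ^ 4) / (2 * \<theta>)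
      + \<theta> * ((LINT \<omega>|M. X_std k n \<omega> ^ (4 * m)) + (LINT \<omega>|M. X_std 0 n \<omega> ^ (4 * m))))"
    using mom(1) D4(1) by simp
  also have "\<dots> = (real (Suc m))\<^sup>2 * (12 * \<theta>\<^sup>2 / (2 * \<theta>) + \<theta> * (?\<mu> + ?\<mu>))"
    unfolding mom(2) D4(2) \<theta>_def ..
  also have "\<dots> = (real (Suc m))\<^sup>2 * (6 + 2 * ?\<mu>) * \<theta>"
    using \<theta> by (simp add: power2_eq_square[of \<theta>] algebra_simps)
  finally show ?thesis by (simp add: Suc \<theta>_def)
qed simp

lemma X_std_polynomial_increment:
  "\<exists>C\<ge>0. \<forall>n\<ge>1. \<forall>k\<ge>1. (LINT \<omega>|M. (poly F (X_std k n \<omega>) - poly F (X_std 0 n \<omega>))\<^sup>2) \<le> C * (1 - \<alpha> n ^ k)"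
proof -
  define K where "K j = (real j)\<^sup>2 * (6 + 2 * (LINT x|gauss. x ^ (4 * (j - 1))))" for j
  have K: "0 \<le> K j" for j unfolding K_def by (intro mult_nonneg_nonneg add_nonneg_nonneg) (auto intro!: integral_nonneg simp: power_mult)
  define C where "C = real (card {..degree F}) * (\<Sum>j\<le>degree F. (coeff F j)\<^sup>2 * K j)"
  have "(LINT \<omega>|M. (poly F (X_std k n \<omega>) - poly F (X_std 0 n \<omega>))\<^sup>2) \<le> C * (1 - \<alpha> n ^ k)"
    if n: "1 \<le> n" and k: "1 \<le> k" for n k
  proof -
    have "(LINT \<omega>|M. (poly F (X_std k n \<omega>) - poly F (X_std 0 n \<omega>))\<^sup>2)
      = (LINT \<omega>|M. (\<Sum>j\<le>degree F. coeff F j * (X_std k n \<omega> ^ j - X_std 0 n \<omega> ^ j))\<^sup>2)"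
      by (simp add: poly_altdef right_diff_distrib sum_subtractf)
    also have "\<dots> \<le> real (card {..degree F}) * (\<Sum>j\<le>degree F. LINT \<omega>|M. (coeff F j * (X_std k n \<omega> ^ j - X_std 0 n \<omega> ^ j))\<^sup>2)"
      by (intro integral_square_sum_le sq_integrable_cmult sq_integrable_diff
          sq_integrable_std_normal[OF X_std_distributed[OF n]] sq_integrable_gauss_power) simp
    also have "\<dots> \<le> real (card {..degree F}) * (\<Sum>j\<le>degree F. (coeff F j)\<^sup>2 * (K j * (1 - \<alpha> n ^ k)))"
      unfolding power_mult_distrib integral_mult_right_zero
      using X_std_power_increment[OF n k] by (intro mult_left_mono sum_mono) (auto simp: K_def)
    also have "\<dots> = C * (1 - \<alpha> n ^ k)"
      by (simp add: C_def sum_distrib_right mult.assoc)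
    finally show ?thesis .
  qed
  moreover have "0 \<le> C" unfolding C_def by (intro mult_nonneg_nonneg sum_nonneg K) auto
  ultimately show ?thesis by blast
qed

lemma ar_coeff_power_ge:
  assumes "1 \<le> n" "k \<le> n"
  shows "1 - \<alpha> n ^ k \<le> \<gamma> * real n powr (1 - \<beta>)"
proof -
  let ?x = "\<gamma> / real n powr \<beta>"
  have x: "0 \<le> ?x" using gamma by simp
  have "-1 \<le> - ?x" using ar_coeff_bounds[OF assms(1)] by (simp add: ar_coeff_def)
  from Bernoulli_inequality[OF this, of k] have "1 - \<alpha> n ^ k \<le> real k * ?x"
    by (simp add: ar_coeff_def)
  also have "\<dots> \<le> real n * ?x" using assms x by (intro mult_right_mono) auto
  also have "\<dots> = \<gamma> * real n powr (1 - \<beta>)"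
    using assms by (simp add: powr_diff)
  finally show ?thesis .
qed

text \<open>For polynomials the bound is of order \<open>1 - \<alpha>\<^sub>n\<^sup>k \<le> \<gamma> n powr (1 - \<beta>)\<close>. A general function is
  approximated by a polynomial; since every \<open>X_std k n\<close> has the same law, the approximation error is
  the same at all times.\<close>

lemma X_std_L2_increment:
  assumes G: "sq_integrable gauss G" and e: "0 < e"
  shows "\<exists>n0. \<forall>n\<ge>n0. 1 \<le> n \<longrightarrow> (\<forall>k. 1 \<le> k \<and> k \<le> n \<longrightarrow> (LINT \<omega>|M. (G (X_std k n \<omega>) - G (X_std 0 n \<omega>))\<^sup>2) < e)"
proof -
  obtain F where F: "(LINT x|gauss. (poly F x - G x)\<^sup>2) < e / 12"
    using gauss_polynomial_dense[OF G, of "e / 12"] e by auto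
  obtain C where C: "0 \<le> C" "\<And>n k. 1 \<le> n \<Longrightarrow> 1 \<le> k \<Longrightarrow>
      (LINT \<omega>|M. (poly F (X_std k n \<omega>) - poly F (X_std 0 n \<omega>))\<^sup>2) \<le> C * (1 - \<alpha> n ^ k)"
    using X_std_polynomial_increment[of F] by blast
  have "(\<lambda>n. real n powr (1 - \<beta>)) \<longlonglongrightarrow> 0"
    using beta by (intro tendsto_neg_powr filterlim_real_sequentially) auto
  then have "(\<lambda>n. C * (\<gamma> * real n powr (1 - \<beta>))) \<longlonglongrightarrow> C * (\<gamma> * 0)" by (intro tendsto_intros)
  then have "(\<lambda>n. C * (\<gamma> * real n powr (1 - \<beta>))) \<longlonglongrightarrow> 0" by simp
  from LIMSEQ_D[OF this, of "e / 8"] obtain n0 where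
    n0: "\<And>n. n0 \<le> n \<Longrightarrow> C * (\<gamma> * real n powr (1 - \<beta>)) < e / 8" using e by fastforce
  have "(LINT \<omega>|M. (G (X_std k n \<omega>) - G (X_std 0 n \<omega>))\<^sup>2) < e"
    if n: "n0 \<le> n" "1 \<le> n" and k: "1 \<le> k" "k \<le> n" for n k
  proof -
    note sq = sq_integrable_std_normal[OF X_std_distributed[OF n(2)]]
    have FG: "sq_integrable gauss (\<lambda>x. poly F x - G x)" by (intro sq_integrable_diff G sq_integrable_gauss_poly)
    have [measurable]: "G \<in> borel_measurable borel" using sq_integrable_measurable[OF G] by simp
    have FG_close: "(LINT \<omega>|M. (poly F (X_std i n \<omega>) - G (X_std i n \<omega>))\<^sup>2) < e / 12" for i
      using F integral_std_normal[OF X_std_distributed[OF n(2)], of "\<lambda>x. (poly F x - G x)\<^sup>2" i] by simp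
    have sqs: "sq_integrable M (\<lambda>\<omega>. poly F (X_std k n \<omega>) - poly F (X_std 0 n \<omega>))"
      "sq_integrable M (\<lambda>\<omega>. poly F (X_std 0 n \<omega>) - G (X_std 0 n \<omega>))"
      "sq_integrable M (\<lambda>\<omega>. - (poly F (X_std k n \<omega>) - G (X_std k n \<omega>)))"
      using sq_integrable_cmult[OF sq[OF FG, of k], of "-1"]
      by (auto intro!: sq_integrable_diff sq sq_integrable_gauss_poly G)
    have "(LINT \<omega>|M. (G (X_std k n \<omega>) - G (X_std 0 n \<omega>))\<^sup>2)
        = (LINT \<omega>|M. (- (poly F (X_std k n \<omega>) - G (X_std k n \<omega>)) +
            ((poly F (X_std 0 n \<omega>) - G (X_std 0 n \<omega>)) + (poly F (X_std k n \<omega>) - poly F (X_std 0 n \<omega>))))\<^sup>2)"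
      by (simp add: algebra_simps)
    also have "\<dots> \<le> 2 * (LINT \<omega>|M. (- (poly F (X_std k n \<omega>) - G (X_std k n \<omega>)))\<^sup>2)
        + 2 * (LINT \<omega>|M. ((poly F (X_std 0 n \<omega>) - G (X_std 0 n \<omega>)) + (poly F (X_std k n \<omega>) - poly F (X_std 0 n \<omega>)))\<^sup>2)"
      by (rule integral_square_triangle[OF sqs(3) sq_integrable_add[OF sqs(2,1)]])
    finally have 1: "(LINT \<omega>|M. (G (X_std k n \<omega>) - G (X_std 0 n \<omega>))\<^sup>2)
        \<le> 2 * (LINT \<omega>|M. (poly F (X_std k n \<omega>) - G (X_std k n \<omega>))\<^sup>2)
        + 2 * (LINT \<omega>|M. ((poly F (X_std 0 n \<omega>) - G (X_std 0 n \<omega>)) + (poly F (X_std k n \<omega>) - poly F (X_std 0 n \<omega>)))\<^sup>2)"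
      by (simp only: power2_minus)
    have 2: "(LINT \<omega>|M. ((poly F (X_std 0 n \<omega>) - G (X_std 0 n \<omega>)) + (poly F (X_std k n \<omega>) - poly F (X_std 0 n \<omega>)))\<^sup>2)
      \<le> 2 * (LINT \<omega>|M. (poly F (X_std 0 n \<omega>) - G (X_std 0 n \<omega>))\<^sup>2) + 2 * (LINT \<omega>|M. (poly F (X_std k n \<omega>) - poly F (X_std 0 n \<omega>))\<^sup>2)"
      by (rule integral_square_triangle[OF sqs(2,1)])
    have "(LINT \<omega>|M. (poly F (X_std k n \<omega>) - poly F (X_std 0 n \<omega>))\<^sup>2) \<le> C * (1 - \<alpha> n ^ k)"
      by (rule C(2)[OF n(2) k(1)])
    also have "\<dots> \<le> C * (\<gamma> * real n powr (1 - \<beta>))"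
      using C(1) ar_coeff_power_ge[OF n(2) k(2)] by (rule mult_left_mono[rotated])
    finally have 3: "(LINT \<omega>|M. (poly F (X_std k n \<omega>) - poly F (X_std 0 n \<omega>))\<^sup>2) < e / 8"
      using n0[OF n(1)] by linarith
    show ?thesis using 1 2 3 FG_close[of 0] FG_close[of k] by linarith
  qed
  then show ?thesis by blast
qed

section \<open>Convergence of the standardized functional\<close>

text \<open>Any normalization \<open>v n\<close> that produces a limit \<open>g\<close> of unit second moment is admissible, because the
  standardization by the variance of the full sum is invariant under scaling. With \<open>T n k\<close> the normalized summands, that variance is \<open>(v n)\<^sup>2 n\<^sup>2 Q n\<close> with \<open>Q n \<rightarrow> 1\<close>,
  and the uniform distance of the path from the line of slope \<open>g (X_std 0 n)\<close> is controlled by the mean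
  absolute deviation \<open>D n\<close> of the summands from that slope.\<close>

lemma standardized_functional_converges:
  fixes v :: "nat \<Rightarrow> real"
  assumes f: "f \<in> borel_measurable borel"
    and f_sq: "\<And>n. 1 \<le> n \<Longrightarrow> sq_integrable gauss (\<lambda>x. f (stationary_sd n * x))"
    and v: "\<And>n. 1 \<le> n \<Longrightarrow> 0 < v n"
    and g: "sq_integrable gauss g" "(LINT x|gauss. (g x)\<^sup>2) = 1"
    and lim: "(\<lambda>n. LINT x|gauss. ((f (stationary_sd n * x) - (LINT y|gauss. f (stationary_sd n * y))) / v n
        - g x)\<^sup>2) \<longlonglongrightarrow> 0"
    and N: "prob_space N" and Z: "distributed N lborel Z std_normal_density"
  shows "converges_in_distribution skorokhod_topology M (standardized_functional M X f)
    N (linear_path (\<lambda>\<omega>. g (Z \<omega>)))"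
proof -
  note [measurable] = f
  have g_meas [measurable]: "g \<in> borel_measurable borel" using sq_integrable_measurable[OF g(1)] by simp
  define \<mu> where "\<mu> n = (LINT y|gauss. f (stationary_sd n * y))" for n
  define G where "G n x = (f (stationary_sd n * x) - \<mu> n) / v n" for n x
  define T where "T n k \<omega> = (f (X k n \<omega>) - \<mu> n) / v n" for n k \<omega>
  have G_sq: "sq_integrable gauss (G n)" if "1 \<le> n" for n
    using sq_integrable_cmult[OF sq_integrable_diff[OF f_sq[OF that] gauss.sq_integrable_const[of "\<mu> n"]], of "1 / v n"]
    by (simp add: G_def[abs_def])
  have X_scaled: "X k n \<omega> = stationary_sd n * X_std k n \<omega>" if "1 \<le> n" for n k \<omega>
    using stationary_variance(1)[OF that] by (simp add: X_std_def)
  have T_G: "T n k \<omega> = G n (X_std k n \<omega>)" if "1 \<le> n" for n k \<omega>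
    using X_scaled[OF that] by (simp add: T_def G_def)
  have fX: "integrable M (\<lambda>\<omega>. f (X k n \<omega>))" "(LINT \<omega>|M. f (X k n \<omega>)) = \<mu> n" if n: "1 \<le> n" for n k
  proof -
    have "(\<lambda>x. f (stationary_sd n * x)) \<in> borel_measurable borel" by measurable
    note * = integrable_std_normal[OF X_std_distributed[OF n, of k] this]
      integral_std_normal[OF X_std_distributed[OF n, of k] this]
    show "integrable M (\<lambda>\<omega>. f (X k n \<omega>))"
      using * gauss.sq_integrable_imp_integrable[OF f_sq[OF n]] X_scaled[OF n] by simp
    show "(LINT \<omega>|M. f (X k n \<omega>)) = \<mu> n" using * X_scaled[OF n] by (simp add: \<mu>_def)
  qed
  have T_sq: "sq_integrable M (T n k)" if "1 \<le> n" for n k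
    using sq_integrable_std_normal[OF X_std_distributed[OF that] G_sq[OF that], of k]
    by (simp only: T_G[OF that, symmetric])
  have g_sq: "sq_integrable M (\<lambda>\<omega>. g (X_std k n \<omega>))" if "1 \<le> n" for n k
    by (rule sq_integrable_std_normal[OF X_std_distributed[OF that] g(1)])
  have g_norm: "(LINT \<omega>|M. (g (X_std 0 n \<omega>))\<^sup>2) = 1" if "1 \<le> n" for n
    using integral_std_normal[OF X_std_distributed[OF that], of "\<lambda>x. (g x)\<^sup>2"] g(2) by simp

  define D where "D n \<omega> = (1 / real n) * (\<Sum>k=1..n. \<bar>T n k \<omega> - g (X_std 0 n \<omega>)\<bar>)" for n \<omega>
  have abs_sq: "sq_integrable M (\<lambda>\<omega>. \<bar>T n k \<omega> - g (X_std 0 n \<omega>)\<bar>)" if "1 \<le> n" for n k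
    by (intro sq_integrable_abs sq_integrable_diff T_sq[OF that] g_sq[OF that])
  have D_sq: "sq_integrable M (D n)" if "1 \<le> n" for n
    unfolding D_def[abs_def] by (intro sq_integrable_cmult sq_integrable_sum abs_sq[OF that])
  have D_lim: "(\<lambda>n. LINT \<omega>|M. (D n \<omega>)\<^sup>2) \<longlonglongrightarrow> 0"
  proof (rule LIMSEQ_I)
    fix e :: real assume e: "0 < e"
    have "0 < e / 8" using e by simp
    from X_std_L2_increment[OF g(1) this] obtain n1 where n1: "\<And>n k. n1 \<le> n \<Longrightarrow> 1 \<le> n \<Longrightarrow> 1 \<le> k \<Longrightarrow> k \<le> n \<Longrightarrow>
        (LINT \<omega>|M. (g (X_std k n \<omega>) - g (X_std 0 n \<omega>))\<^sup>2) < e / 8"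
      by blast
    obtain n2 where n2: "\<And>n. n2 \<le> n \<Longrightarrow> (LINT x|gauss. (G n x - g x)\<^sup>2) < e / 8"
      using LIMSEQ_D[OF lim, of "e / 8"] e unfolding G_def \<mu>_def by auto
    have "(LINT \<omega>|M. (D n \<omega>)\<^sup>2) < e" if n: "max 1 (max n1 n2) \<le> n" for n
    proof -
      have n': "1 \<le> n" "n1 \<le> n" "n2 \<le> n" using n by auto
      have Gg: "sq_integrable gauss (\<lambda>x. G n x - g x)" by (rule sq_integrable_diff[OF G_sq[OF n'(1)] g(1)])
      have summand: "(LINT \<omega>|M. (\<bar>T n k \<omega> - g (X_std 0 n \<omega>)\<bar>)\<^sup>2) \<le> e / 2" if k: "k \<in> {1..n}" for k
      proof -
        have "(LINT \<omega>|M. (\<bar>T n k \<omega> - g (X_std 0 n \<omega>)\<bar>)\<^sup>2)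
            = (LINT \<omega>|M. ((G n (X_std k n \<omega>) - g (X_std k n \<omega>)) + (g (X_std k n \<omega>) - g (X_std 0 n \<omega>)))\<^sup>2)"
          by (simp add: T_G[OF n'(1)])
        also have "\<dots> \<le> 2 * (LINT \<omega>|M. (G n (X_std k n \<omega>) - g (X_std k n \<omega>))\<^sup>2)
            + 2 * (LINT \<omega>|M. (g (X_std k n \<omega>) - g (X_std 0 n \<omega>))\<^sup>2)"
          by (intro integral_square_triangle sq_integrable_diff g_sq[OF n'(1)]
              sq_integrable_std_normal[OF X_std_distributed[OF n'(1)] G_sq[OF n'(1)]])
        also have "(LINT \<omega>|M. (G n (X_std k n \<omega>) - g (X_std k n \<omega>))\<^sup>2) = (LINT x|gauss. (G n x - g x)\<^sup>2)"
          using integral_std_normal[OF X_std_distributed[OF n'(1), of k], of "\<lambda>x. (G n x - g x)\<^sup>2"]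
            sq_integrable_measurable[OF Gg] by simp
        finally show ?thesis using n1[OF n'(2,1), of k] n2[OF n'(3)] k by auto
      qed
      have "(LINT \<omega>|M. (D n \<omega>)\<^sup>2) = (1 / real n)\<^sup>2 * (LINT \<omega>|M. (\<Sum>k=1..n. \<bar>T n k \<omega> - g (X_std 0 n \<omega>)\<bar>)\<^sup>2)"
        unfolding D_def power_mult_distrib by (rule integral_mult_right_zero)
      also have "\<dots> \<le> (1 / real n)\<^sup>2 * (card {1..n} * (\<Sum>k=1..n. LINT \<omega>|M. (\<bar>T n k \<omega> - g (X_std 0 n \<omega>)\<bar>)\<^sup>2))"
        by (intro mult_left_mono integral_square_sum_le abs_sq[OF n'(1)]) auto
      also have "\<dots> \<le> (1 / real n)\<^sup>2 * (card {1..n} * (\<Sum>k=1..n. e / 2))"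
        by (intro mult_left_mono sum_mono summand) auto
      also have "\<dots> = e / 2" using n'(1) by (simp add: power2_eq_square)
      finally show ?thesis using e by simp
    qed
    then show "\<exists>no. \<forall>n\<ge>no. norm ((LINT \<omega>|M. (D n \<omega>)\<^sup>2) - 0) < e"
      by (intro exI[of _ "max 1 (max n1 n2)"]) auto
  qed

  define A where "A n \<omega> = (1 / real n) * (\<Sum>k=1..n. T n k \<omega>)" for n \<omega>
  define Q where "Q n = (LINT \<omega>|M. (A n \<omega>)\<^sup>2)" for n
  have A_sq: "sq_integrable M (A n)" if "1 \<le> n" for n
    unfolding A_def[abs_def] by (intro sq_integrable_cmult sq_integrable_sum T_sq[OF that])
  have A_D: "\<bar>A n \<omega> - g (X_std 0 n \<omega>)\<bar> \<le> D n \<omega>" if "1 \<le> n" for n \<omega>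
  proof -
    have "A n \<omega> - g (X_std 0 n \<omega>) = (1 / real n) * (\<Sum>k=1..n. T n k \<omega> - g (X_std 0 n \<omega>))"
      using that by (simp add: A_def sum_subtractf field_simps)
    then show ?thesis
      by (simp add: D_def abs_mult divide_right_mono sum_abs)
  qed
  have Q_lim: "Q \<longlonglongrightarrow> 1"
    unfolding Q_def[abs_def]
  proof (rule integral_square_tendsto[OF A_sq g_sq _ g_norm])
    show "(\<lambda>n. LINT \<omega>|M. (A n \<omega> - g (X_std 0 n \<omega>))\<^sup>2) \<longlonglongrightarrow> 0"
    proof (rule tendsto_sandwich[OF _ _ tendsto_const D_lim])
      show "\<forall>\<^sub>F n in sequentially. (LINT \<omega>|M. (A n \<omega> - g (X_std 0 n \<omega>))\<^sup>2) \<le> (LINT \<omega>|M. (D n \<omega>)\<^sup>2)"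
        using eventually_ge_at_top[of 1]
      proof eventually_elim
        case (elim n)
        show ?case
        proof (intro integral_mono sq_integrable_square D_sq[OF elim] sq_integrable_diff A_sq[OF elim] g_sq[OF elim])
          show "(A n \<omega> - g (X_std 0 n \<omega>))\<^sup>2 \<le> (D n \<omega>)\<^sup>2" for \<omega>
            using power_mono[OF A_D[OF elim], of \<omega> 2] by simp
        qed
      qed
    qed auto
  qed auto
  define r where "r n = 1 / sqrt (Q n)" for n
  have Q0: "0 \<le> Q n" for n by (simp add: Q_def)
  have r0: "0 \<le> r n" for n using Q0[of n] by (simp add: r_def)
  have "r \<longlonglongrightarrow> 1 / sqrt 1"
    unfolding r_def[abs_def] by (intro tendsto_intros Q_lim) auto
  then have r_lim: "r \<longlonglongrightarrow> 1" by simp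

  have path: "standardized_functional M X f n \<omega> t
      = r n * ((1 / real n) * (\<Sum>k=1..nat \<lfloor>real n * t\<rfloor>. T n k \<omega>))"
    if n: "1 \<le> n" and t: "t \<in> {0..1}" for n \<omega> t
  proof -
    have vT: "(\<Sum>k=1..j. f (X k n \<omega>)) - real j * \<mu> n = v n * (\<Sum>k=1..j. T n k \<omega>)" for j \<omega>
      using v[OF n] by (simp add: T_def sum_distrib_left sum_subtractf)
    have E: "expectation (\<lambda>\<omega>. \<Sum>k=1..j. f (X k n \<omega>)) = real j * \<mu> n" for j
      using fX[OF n] by simp
    have "variance (additive_functional X f n 1) = (LINT \<omega>|M. (v n * (\<Sum>k=1..n. T n k \<omega>))\<^sup>2)"
      unfolding additive_functional_def[abs_def] by (simp only: mult_1_right floor_of_nat nat_int E vT)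
    also have "\<dots> = (LINT \<omega>|M. (v n * real n)\<^sup>2 * (A n \<omega>)\<^sup>2)"
      using n by (simp add: A_def power_mult_distrib power_divide)
    also have "\<dots> = (v n * real n)\<^sup>2 * Q n" unfolding Q_def by (rule integral_mult_right_zero)
    finally have "sqrt (variance (additive_functional X f n 1)) = v n * real n * sqrt (Q n)"
      using v[OF n] by (simp add: real_sqrt_mult)
    then show ?thesis
      unfolding standardized_functional_def additive_functional_def[abs_def]
      using t v[OF n] by (simp only: restrict_apply if_True E vT) (simp add: r_def)
  qed

  have path_meas: "standardized_functional M X f n \<in> M \<rightarrow>\<^sub>M borel_of skorokhod_topology" for n
  proof (cases "n = 0")
    case True
    have "standardized_functional M X f n = (\<lambda>\<omega>. step_path n (\<lambda>_. 0))"
      by (rule ext) (simp add: standardized_functional_def additive_functional_def[abs_def] step_path_def True)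
    then show ?thesis using measurable_step_path[of "\<lambda>_ _. 0" M n] by simp
  next
    case False
    then have n: "1 \<le> n" by simp
    have [measurable]: "T n k \<in> borel_measurable M" for k by (rule sq_integrable_measurable[OF T_sq[OF n]])
    have "standardized_functional M X f n = (\<lambda>\<omega>. step_path n (\<lambda>j. r n * ((1 / real n) * (\<Sum>k=1..j. T n k \<omega>))))"
    proof (intro ext)
      fix \<omega> t
      show "standardized_functional M X f n \<omega> t = step_path n (\<lambda>j. r n * ((1 / real n) * (\<Sum>k=1..j. T n k \<omega>))) t"
      proof (cases "t \<in> {0..1}")
        case True
        then show ?thesis using path[OF n True] by (simp add: step_path_def)
      next
        case False
        then show ?thesis unfolding step_path_def standardized_functional_def by (simp only: restrict_apply if_False)
      qed
    qed
    then show ?thesis using measurable_step_path[of "\<lambda>\<omega> j. r n * ((1 / real n) * (\<Sum>k=1..j. T n k \<omega>))" M n] by simp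
  qed

  \<comment> \<open>The rows of the process start at \<open>n = 1\<close>; for \<open>n = 0\<close> the path is the zero function, with slope 0.\<close>
  define U where "U n \<omega> = (if n = 0 then 0 else g (X_std 0 n \<omega>))" for n \<omega>
  define R where "R n \<omega> = (if n = 0 then 0 else r n * D n \<omega> + (\<bar>r n - 1\<bar> + 1 / real n) * \<bar>g (X_std 0 n \<omega>)\<bar>)" for n \<omega>
  have abs_g_sq: "sq_integrable M (\<lambda>\<omega>. \<bar>g (X_std 0 n \<omega>)\<bar>)" if "1 \<le> n" for n
    by (rule sq_integrable_abs[OF g_sq[OF that]])
  have R_parts: "sq_integrable M (\<lambda>\<omega>. r n * D n \<omega>)"
    "sq_integrable M (\<lambda>\<omega>. (\<bar>r n - 1\<bar> + 1 / real n) * \<bar>g (X_std 0 n \<omega>)\<bar>)" if "1 \<le> n" for n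
    by (intro sq_integrable_cmult D_sq[OF that] abs_g_sq[OF that])+
  show ?thesis
  proof (rule converges_in_distribution_to_line[OF prob_space_axioms N path_meas])
    show "U n \<in> borel_measurable M" for n
      using sq_integrable_measurable[OF g_sq] by (cases "n = 0") (auto simp: U_def[abs_def])
    have [measurable]: "Z \<in> borel_measurable N" using Z by (simp add: distributed_def)
    show "(\<lambda>\<omega>. g (Z \<omega>)) \<in> borel_measurable N" by measurable
    show "\<forall>\<^sub>F n in sequentially. distr M borel (U n) = distr N borel (\<lambda>\<omega>. g (Z \<omega>))"
      using eventually_ge_at_top[of 1]
    proof eventually_elim
      case (elim n)
      have "distr M borel (U n) = distr (distr M borel (X_std 0 n)) borel g"
        using elim X_std_measurable[OF elim, of 0] by (subst distr_distr) (auto simp: U_def[abs_def] o_def)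
      also have "\<dots> = distr (distr N borel Z) borel g"
        by (simp only: distr_std_normal[OF X_std_distributed[OF elim]] distr_std_normal[OF Z])
      also have "\<dots> = distr N borel (\<lambda>\<omega>. g (Z \<omega>))"
        by (subst distr_distr) (auto simp: o_def)
      finally show ?case .
    qed
    show "\<forall>\<^sub>F n in sequentially. \<forall>\<omega>\<in>space M. \<forall>t\<in>{0..1}.
        \<bar>standardized_functional M X f n \<omega> t - t * U n \<omega>\<bar> \<le> R n \<omega>"
      using eventually_ge_at_top[of 1]
    proof (eventually_elim, intro ballI)
      fix n :: nat and \<omega> and t :: real
      assume n: "1 \<le> n" and t: "t \<in> {0..1}"
      define m where "m = nat \<lfloor>real n * t\<rfloor>"
      define \<Gamma> where "\<Gamma> = g (X_std 0 n \<omega>)"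
      have "0 \<le> real n * t" using t by simp
      moreover have "real n * t \<le> real n * 1" using t by (intro mult_left_mono) auto
      ultimately have m: "real m \<le> real n * t" "real n * t < real m + 1" "m \<le> n"
        unfolding m_def by linarith+
      have frac: "real m / real n \<le> t" "t \<le> real m / real n + 1 / real n"
        using m n by (simp_all add: field_simps)
      have "\<bar>(1 / real n) * (\<Sum>k=1..m. T n k \<omega> - \<Gamma>)\<bar> \<le> (1 / real n) * (\<Sum>k=1..m. \<bar>T n k \<omega> - \<Gamma>\<bar>)"
        unfolding abs_mult by (intro mult_mono sum_abs) auto
      also have "\<dots> \<le> D n \<omega>"
        unfolding D_def \<Gamma>_def using m by (intro mult_left_mono sum_mono2) auto
      finally have 1: "r n * \<bar>(1 / real n) * (\<Sum>k=1..m. T n k \<omega> - \<Gamma>)\<bar> \<le> r n * D n \<omega>"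
        using r0 by (rule mult_left_mono)
      have "\<bar>(real m / real n) * (r n - 1) + (real m / real n - t)\<bar> \<le> 1 * \<bar>r n - 1\<bar> + 1 / real n"
      proof (rule order_trans[OF abs_triangle_ineq add_mono])
        show "\<bar>(real m / real n) * (r n - 1)\<bar> \<le> 1 * \<bar>r n - 1\<bar>"
          unfolding abs_mult using m n by (intro mult_right_mono) auto
        show "\<bar>real m / real n - t\<bar> \<le> 1 / real n" using frac by linarith
      qed
      then have 2: "\<bar>((real m / real n) * (r n - 1) + (real m / real n - t)) * \<Gamma>\<bar> \<le> (\<bar>r n - 1\<bar> + 1 / real n) * \<bar>\<Gamma>\<bar>"
        unfolding abs_mult by (intro mult_right_mono) auto
      have "standardized_functional M X f n \<omega> t - t * U n \<omega>
          = r n * ((1 / real n) * (\<Sum>k=1..m. T n k \<omega> - \<Gamma>)) + ((real m / real n) * (r n - 1) + (real m / real n - t)) * \<Gamma>"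
        unfolding path[OF n t] m_def[symmetric] U_def \<Gamma>_def using n
        by (simp add: sum_subtractf field_simps)
      also have "\<bar>\<dots>\<bar> \<le> r n * \<bar>(1 / real n) * (\<Sum>k=1..m. T n k \<omega> - \<Gamma>)\<bar> + \<bar>((real m / real n) * (r n - 1) + (real m / real n - t)) * \<Gamma>\<bar>"
        by (rule order_trans[OF abs_triangle_ineq]) (simp add: abs_mult r0)
      also have "\<dots> \<le> R n \<omega>" using 1 2 n by (simp add: R_def \<Gamma>_def)
      finally show "\<bar>standardized_functional M X f n \<omega> t - t * U n \<omega>\<bar> \<le> R n \<omega>" .
    qed
    show "sq_integrable M (R n)" for n
      using sq_integrable_add[OF R_parts, of n] by (cases "n = 0") (auto simp: R_def[abs_def] sq_integrable_def)
    show "(\<lambda>n. LINT \<omega>|M. (R n \<omega>)\<^sup>2) \<longlonglongrightarrow> 0"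
    proof (rule tendsto_sandwich[OF _ _ tendsto_const])
      show "\<forall>\<^sub>F n in sequentially. (LINT \<omega>|M. (R n \<omega>)\<^sup>2)
          \<le> 2 * ((r n)\<^sup>2 * (LINT \<omega>|M. (D n \<omega>)\<^sup>2)) + 2 * (\<bar>r n - 1\<bar> + 1 / real n)\<^sup>2"
        using eventually_ge_at_top[of 1]
      proof eventually_elim
        case (elim n)
        have "(LINT \<omega>|M. (R n \<omega>)\<^sup>2) \<le> 2 * (LINT \<omega>|M. (r n * D n \<omega>)\<^sup>2)
            + 2 * (LINT \<omega>|M. ((\<bar>r n - 1\<bar> + 1 / real n) * \<bar>g (X_std 0 n \<omega>)\<bar>)\<^sup>2)"
          using integral_square_triangle[OF R_parts[OF elim]] elim by (simp add: R_def)
        then show ?case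
          unfolding power_mult_distrib integral_mult_right_zero power2_abs[of "g _"] g_norm[OF elim] by simp
      qed
      have "(\<lambda>n. 2 * ((r n)\<^sup>2 * (LINT \<omega>|M. (D n \<omega>)\<^sup>2)) + 2 * (\<bar>r n - 1\<bar> + 1 / real n)\<^sup>2)
          \<longlonglongrightarrow> 2 * (1\<^sup>2 * 0) + 2 * (\<bar>1 - 1\<bar> + 0)\<^sup>2"
        by (intro tendsto_intros r_lim D_lim lim_1_over_n)
      then show "(\<lambda>n. 2 * ((r n)\<^sup>2 * (LINT \<omega>|M. (D n \<omega>)\<^sup>2)) + 2 * (\<bar>r n - 1\<bar> + 1 / real n)\<^sup>2) \<longlonglongrightarrow> 0"
        by simp
    qed auto
  qed
qed

end

section \<open>The three regimes\<close>

lemma gauss_power_variance_pos: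
  assumes "1 \<le> w"
  shows "0 < (LINT x|gauss. (x ^ w - a)\<^sup>2)"
proof (rule ccontr)
  let ?P = "monom 1 w - [:a:] :: real poly"
  have sq: "sq_integrable gauss (\<lambda>x. x ^ w - a)"
    by (intro sq_integrable_diff sq_integrable_gauss_power gauss.sq_integrable_const)
  assume "\<not> 0 < (LINT x|gauss. (x ^ w - a)\<^sup>2)"
  then have "(LINT x|gauss. (x ^ w - a)\<^sup>2) = 0" by (simp add: not_less antisym)
  then have zero: "AE x in gauss. x ^ w - a = 0" using integral_square_eq_0_iff[OF sq] by blast
  have "coeff ?P w = 1" using assms by (cases w) (auto simp: coeff_pCons)
  then have "?P \<noteq> 0" by (metis coeff_0 zero_neq_one)
  then have "finite {x. poly ?P x = 0}" by (rule poly_roots_finite)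
  then have "AE x in lborel. x \<notin> {x. poly ?P x = 0}"
    by (intro AE_not_in finite_imp_null_set_lborel)
  then have "AE x in gauss. x ^ w - a \<noteq> 0"
    by (subst AE_density) (auto simp: poly_monom)
  with zero have "AE x in gauss. False" by eventually_elim simp
  then show False by simp
qed

lemma centred_power_hermite_expansion:
  "\<exists>a. \<forall>x::real. x ^ w - (LINT y|gauss. y ^ w) = (\<Sum>q=1..w. a q * hermite q x) \<and> (\<forall>q. odd (w + q) \<longrightarrow> a q = 0)"
proof -
  obtain a where a: "\<And>x::real. x ^ w = (\<Sum>q\<le>w. a q * hermite q x)" "\<And>q. odd (w + q) \<Longrightarrow> a q = 0"
    using power_hermite_expansion[of w] by blast
  have "(LINT y|gauss. y ^ w) = a 0"
    using gauss_hermite_sum_inner[where N = w and a = a and p = 0] by (simp add: a(1))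
  moreover have "(\<Sum>q\<le>w. a q * hermite q x) = a 0 + (\<Sum>q=1..w. a q * hermite q x)" for x
    by (simp add: atMost_atLeast0 sum.atLeast_Suc_atMost)
  ultimately show ?thesis using a by (intro exI[of _ a]) (auto simp: a(1))
qed

definition standardized_power :: "nat \<Rightarrow> real \<Rightarrow> real" where
  "standardized_power w x = (x ^ w - (LINT y|gauss. y ^ w)) / sqrt (LINT z|gauss. (z ^ w - (LINT y|gauss. y ^ w))\<^sup>2)"

lemma standardized_power_hermite:
  "\<exists>h. \<forall>x. s * standardized_power w x = (\<Sum>q=1..w. h q * (hermite q x / sqrt (fact q)))
    \<and> (\<forall>q. odd (w + q) \<longrightarrow> h q = 0)"
proof -
  obtain a where a: "\<And>x::real. x ^ w - (LINT y|gauss. y ^ w) = (\<Sum>q=1..w. a q * hermite q x)"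
    "\<And>q. odd (w + q) \<Longrightarrow> a q = 0"
    using centred_power_hermite_expansion[of w] by blast
  define \<kappa> where "\<kappa> = sqrt (LINT z|gauss. (z ^ w - (LINT y|gauss. y ^ w))\<^sup>2)"
  have "s * standardized_power w x = (\<Sum>q=1..w. (s / \<kappa> * a q * sqrt (fact q)) * (hermite q x / sqrt (fact q)))" for x
  proof -
    have "s * standardized_power w x = s / \<kappa> * (\<Sum>q=1..w. a q * hermite q x)"
      unfolding a(1)[symmetric] by (simp add: standardized_power_def \<kappa>_def)
    also have "\<dots> = (\<Sum>q=1..w. (s / \<kappa> * a q * sqrt (fact q)) * (hermite q x / sqrt (fact q)))"
      unfolding sum_distrib_left by (intro sum.cong refl) simp
    finally show ?thesis .
  qed
  then show ?thesis using a(2) by (intro exI[of _ "\<lambda>q. s / \<kappa> * a q * sqrt (fact q)"]) auto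
qed

text \<open>After division by the size of the dominating term, the remaining centred powers have coefficients
  that tend to 0. The constant coefficient is exempt from the hypothesis since centring removes it.\<close>

lemma (in nearly_unstable_ar1) dominant_power_converges:
  fixes F :: "real poly"
  assumes w: "1 \<le> w" "coeff F w \<noteq> 0"
    and small: "\<And>i. 1 \<le> i \<Longrightarrow> i \<noteq> w \<Longrightarrow> coeff F i \<noteq> 0 \<Longrightarrow>
        (\<lambda>n. stationary_sd n ^ i / stationary_sd n ^ w) \<longlonglongrightarrow> 0"
    and N: "prob_space N" and Z: "distributed N lborel Z std_normal_density"
  shows "converges_in_distribution skorokhod_topology M (standardized_functional M X (poly F))
    N (linear_path (\<lambda>\<omega>. sgn (coeff F w) * standardized_power w (Z \<omega>)))"
proof -
  define \<mu> where "\<mu> i = (LINT y|gauss. y ^ i)" for i :: nat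
  define \<kappa> where "\<kappa> = sqrt (LINT z|gauss. (z ^ w - \<mu> w)\<^sup>2)"
  have \<kappa>: "0 < \<kappa>" "\<kappa>\<^sup>2 = (LINT z|gauss. (z ^ w - \<mu> w)\<^sup>2)"
    using gauss_power_variance_pos[OF w(1), of "\<mu> w"] by (auto simp: \<kappa>_def)
  let ?b = "coeff F w"
  \<comment> \<open>The standard deviation of the dominating term.\<close>
  define v where "v n = \<bar>?b\<bar> * \<kappa> * stationary_sd n ^ w" for n
  define g where "g x = sgn ?b * standardized_power w x" for x
  have g_eq: "g x = sgn ?b / \<kappa> * (x ^ w - \<mu> w)" for x
    by (simp add: g_def standardized_power_def \<mu>_def \<kappa>_def)
  have pow_sq: "sq_integrable gauss (\<lambda>x. x ^ i - \<mu> i)" for i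
    by (intro sq_integrable_diff sq_integrable_gauss_power gauss.sq_integrable_const)
  have g_sq: "sq_integrable gauss g"
    unfolding g_eq[abs_def] by (rule sq_integrable_cmult[OF pow_sq])
  have g_norm: "(LINT x|gauss. (g x)\<^sup>2) = 1"
  proof -
    have "(sgn ?b)\<^sup>2 = 1" using w(2) by (simp add: sgn_if)
    then show ?thesis
      unfolding g_eq power_mult_distrib integral_mult_right_zero \<kappa>(2)[symmetric]
      using \<kappa>(1) by (simp add: power_divide)
  qed
  have scaled: "poly F (s * x) = (\<Sum>i\<le>degree F. (coeff F i * s ^ i) * x ^ i)" for s x
    by (simp add: poly_altdef power_mult_distrib mult.assoc)
  have mean: "(LINT y|gauss. poly F (s * y)) = (\<Sum>i\<le>degree F. (coeff F i * s ^ i) * \<mu> i)" for s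
    unfolding scaled \<mu>_def
    by (subst Bochner_Integration.integral_sum) (simp_all add: integrable_std_normal_distribution_moment)
  let ?I = "{..degree F} - {w}"
  have w_deg: "w \<le> degree F" using w(2) by (rule le_degree)
  define \<rho> where "\<rho> i n = coeff F i * stationary_sd n ^ i / v n" for i n
  have diff: "(poly F (stationary_sd n * x) - (LINT y|gauss. poly F (stationary_sd n * y))) / v n - g x
      = (\<Sum>i\<in>?I. \<rho> i n * (x ^ i - \<mu> i))" if n: "1 \<le> n" for n x
  proof -
    have "(poly F (stationary_sd n * x) - (LINT y|gauss. poly F (stationary_sd n * y))) / v n
        = (\<Sum>i\<le>degree F. \<rho> i n * (x ^ i - \<mu> i))"
      unfolding mean unfolding scaled sum_subtractf[symmetric] sum_divide_distrib
      by (intro sum.cong refl) (simp add: \<rho>_def algebra_simps diff_divide_distrib)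
    also have "\<dots> = \<rho> w n * (x ^ w - \<mu> w) + (\<Sum>i\<in>?I. \<rho> i n * (x ^ i - \<mu> i))"
      using w_deg by (subst sum.remove[of _ w]) auto
    also have "\<rho> w n = sgn ?b / \<kappa>"
      using stationary_variance(1)[OF n] w(2) \<kappa>(1) by (simp add: \<rho>_def v_def sgn_if)
    finally show ?thesis unfolding g_eq by simp
  qed
  have term_lim: "(\<lambda>n. (\<rho> i n)\<^sup>2 * (LINT x|gauss. (x ^ i - \<mu> i)\<^sup>2)) \<longlonglongrightarrow> 0" if i: "i \<in> ?I" for i
  proof (cases "i = 0 \<or> coeff F i = 0")
    case True
    then show ?thesis
    proof
      assume "i = 0"
      then show ?thesis using gauss.prob_space by (simp add: \<mu>_def)
    qed (simp add: \<rho>_def)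
  next
    case False
    then have "(\<lambda>n. stationary_sd n ^ i / stationary_sd n ^ w) \<longlonglongrightarrow> 0" using i by (intro small) auto
    then have "(\<lambda>n. (coeff F i / (\<bar>?b\<bar> * \<kappa>) * (stationary_sd n ^ i / stationary_sd n ^ w))\<^sup>2 * (LINT x|gauss. (x ^ i - \<mu> i)\<^sup>2))
        \<longlonglongrightarrow> (coeff F i / (\<bar>?b\<bar> * \<kappa>) * 0)\<^sup>2 * (LINT x|gauss. (x ^ i - \<mu> i)\<^sup>2)"
      by (intro tendsto_intros)
    then show ?thesis by (simp add: \<rho>_def v_def)
  qed
  have "converges_in_distribution skorokhod_topology M (standardized_functional M X (poly F)) N (linear_path (\<lambda>\<omega>. g (Z \<omega>)))"
  proof (rule standardized_functional_converges[OF borel_measurable_poly _ _ g_sq g_norm _ N Z])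
    show "sq_integrable gauss (\<lambda>x. poly F (stationary_sd n * x))" for n
      unfolding scaled by (intro sq_integrable_sum sq_integrable_cmult sq_integrable_gauss_power)
    show "0 < v n" if "1 \<le> n" for n
      using stationary_variance(1)[OF that] w(2) \<kappa>(1) by (simp add: v_def)
    show "(\<lambda>n. LINT x|gauss. ((poly F (stationary_sd n * x) - (LINT y|gauss. poly F (stationary_sd n * y))) / v n - g x)\<^sup>2) \<longlonglongrightarrow> 0"
    proof (rule tendsto_sandwich[OF _ _ tendsto_const])
      show "\<forall>\<^sub>F n in sequentially.
          (LINT x|gauss. ((poly F (stationary_sd n * x) - (LINT y|gauss. poly F (stationary_sd n * y))) / v n - g x)\<^sup>2)
          \<le> real (card ?I) * (\<Sum>i\<in>?I. (\<rho> i n)\<^sup>2 * (LINT x|gauss. (x ^ i - \<mu> i)\<^sup>2))"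
        using eventually_ge_at_top[of 1]
      proof eventually_elim
        case (elim n)
        have "(LINT x|gauss. (\<Sum>i\<in>?I. \<rho> i n * (x ^ i - \<mu> i))\<^sup>2)
            \<le> real (card ?I) * (\<Sum>i\<in>?I. LINT x|gauss. (\<rho> i n * (x ^ i - \<mu> i))\<^sup>2)"
          by (intro integral_square_sum_le sq_integrable_cmult pow_sq) auto
        then show ?case
          unfolding diff[OF elim] power_mult_distrib[of "\<rho> _ n"] integral_mult_right_zero .
      qed
      have "(\<lambda>n. real (card ?I) * (\<Sum>i\<in>?I. (\<rho> i n)\<^sup>2 * (LINT x|gauss. (x ^ i - \<mu> i)\<^sup>2)))
          \<longlonglongrightarrow> real (card ?I) * (\<Sum>i\<in>?I. 0)"
        by (intro tendsto_intros term_lim)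
      then show "(\<lambda>n. real (card ?I) * (\<Sum>i\<in>?I. (\<rho> i n)\<^sup>2 * (LINT x|gauss. (x ^ i - \<mu> i)\<^sup>2))) \<longlonglongrightarrow> 0"
        by simp
    qed auto
  qed
  then show ?thesis unfolding g_def .
qed

lemma (in nearly_unstable_ar1) large_variance_converges:
  assumes c: "1 \<le> p" "m \<le> p" "c p \<noteq> 0"
    and large: "(\<lambda>n. 1 - (\<alpha> n)\<^sup>2) \<in> o(\<lambda>n. (\<sigma> n)\<^sup>2)"
    and N: "prob_space N" and Z: "distributed N lborel Z std_normal_density"
  shows "converges_in_distribution skorokhod_topology M (standardized_functional M X (hermite_poly c m p))
    N (linear_path (\<lambda>\<omega>. sgn (c p) * standardized_power p (Z \<omega>)))"
proof -
  have top: "coeff (hermite_sum c m p) p = c p" by (rule coeff_hermite_sum_top[OF c(2)])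
  have "(\<lambda>n. sqrt ((1 - (\<alpha> n)\<^sup>2) / (\<sigma> n)\<^sup>2)) \<longlonglongrightarrow> sqrt 0"
    by (intro tendsto_intros smalloD_tendsto[OF large])
  moreover have "sqrt ((1 - (\<alpha> n)\<^sup>2) / (\<sigma> n)\<^sup>2) = inverse (stationary_sd n)" for n
    by (simp add: stationary_sd_def real_sqrt_inverse[symmetric])
  ultimately have inv: "(\<lambda>n. inverse (stationary_sd n)) \<longlonglongrightarrow> 0" by simp
  have "converges_in_distribution skorokhod_topology M (standardized_functional M X (poly (hermite_sum c m p)))
    N (linear_path (\<lambda>\<omega>. sgn (coeff (hermite_sum c m p) p) * standardized_power p (Z \<omega>)))"
  proof (rule dominant_power_converges[OF c(1) _ _ N Z])
    fix i assume i: "1 \<le> i" "i \<noteq> p" "coeff (hermite_sum c m p) i \<noteq> 0"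
    then have "i < p" using degree_hermite_sum[of c m p] le_degree[OF i(3)] by simp
    have "(\<lambda>n. inverse (stationary_sd n) ^ (p - i)) \<longlonglongrightarrow> 0 ^ (p - i)"
      by (intro tendsto_intros inv)
    then have "(\<lambda>n. inverse (stationary_sd n) ^ (p - i)) \<longlonglongrightarrow> 0" using \<open>i < p\<close> by (simp add: power_0_left)
    moreover have "\<forall>\<^sub>F n in sequentially. inverse (stationary_sd n) ^ (p - i) = stationary_sd n ^ i / stationary_sd n ^ p"
      using eventually_ge_at_top[of 1]
    proof eventually_elim
      case (elim n)
      show ?case using stationary_variance(1)[OF elim] \<open>i < p\<close>
        by (simp add: power_diff field_simps)
    qed
    ultimately show "(\<lambda>n. stationary_sd n ^ i / stationary_sd n ^ p) \<longlonglongrightarrow> 0"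
      by (rule Lim_transform_eventually)
  qed (use top c in simp)
  then show ?thesis unfolding top poly_hermite_sum .
qed

lemma (in nearly_unstable_ar1) small_variance_converges:
  assumes c: "1 \<le> p" "m \<le> p" "c p \<noteq> 0"
    and small: "(\<lambda>n. (\<sigma> n)\<^sup>2) \<in> o(\<lambda>n. 1 - (\<alpha> n)\<^sup>2)"
    and N: "prob_space N" and Z: "distributed N lborel Z std_normal_density"
  shows "converges_in_distribution skorokhod_topology M (standardized_functional M X (hermite_poly c m p))
    N (linear_path (\<lambda>\<omega>. sgn (coeff (hermite_sum c m p) (m_star c m p)) * standardized_power (m_star c m p) (Z \<omega>)))"
proof -
  let ?w = "m_star c m p"
  have "(\<lambda>n. sqrt ((\<sigma> n)\<^sup>2 / (1 - (\<alpha> n)\<^sup>2))) \<longlonglongrightarrow> sqrt 0"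
    by (intro tendsto_intros smalloD_tendsto[OF small])
  then have sd: "stationary_sd \<longlonglongrightarrow> 0" by (simp add: stationary_sd_def[abs_def])
  have "converges_in_distribution skorokhod_topology M (standardized_functional M X (poly (hermite_sum c m p)))
    N (linear_path (\<lambda>\<omega>. sgn (coeff (hermite_sum c m p) ?w) * standardized_power ?w (Z \<omega>)))"
  proof (rule dominant_power_converges[OF m_star_lowest_coeff(1,3)[where c = c, OF c] _ N Z])
    fix i assume i: "1 \<le> i" "i \<noteq> ?w" "coeff (hermite_sum c m p) i \<noteq> 0"
    then have "?w < i" using m_star_lowest_coeff(4)[where c = c and w = i, OF c] by (meson linorder_neqE_nat)
    have "(\<lambda>n. stationary_sd n ^ (i - ?w)) \<longlonglongrightarrow> 0 ^ (i - ?w)"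
      by (intro tendsto_intros sd)
    then have "(\<lambda>n. stationary_sd n ^ (i - ?w)) \<longlonglongrightarrow> 0" using \<open>?w < i\<close> by (simp add: power_0_left)
    moreover have "\<forall>\<^sub>F n in sequentially. stationary_sd n ^ (i - ?w) = stationary_sd n ^ i / stationary_sd n ^ ?w"
      using eventually_ge_at_top[of 1]
    proof eventually_elim
      case (elim n)
      show ?case using stationary_variance(1)[OF elim] \<open>?w < i\<close> by (simp add: power_diff)
    qed
    ultimately show "(\<lambda>n. stationary_sd n ^ i / stationary_sd n ^ ?w) \<longlonglongrightarrow> 0"
      by (rule Lim_transform_eventually)
  qed
  then show ?thesis unfolding poly_hermite_sum .
qed

lemma (in nearly_unstable_ar1) unit_variance_converges:
  assumes f: "sq_integrable gauss f" and var: "0 < (LINT x|gauss. (f x - (LINT y|gauss. f y))\<^sup>2)"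
    and unit: "\<And>n. 1 \<le> n \<Longrightarrow> (\<sigma> n)\<^sup>2 = 1 - (\<alpha> n)\<^sup>2"
    and N: "prob_space N" and Z: "distributed N lborel Z std_normal_density"
  shows "converges_in_distribution skorokhod_topology M (standardized_functional M X f)
    N (linear_path (\<lambda>\<omega>. (f (Z \<omega>) - (LINT y|gauss. f y)) / sqrt (LINT x|gauss. (f x - (LINT y|gauss. f y))\<^sup>2)))"
proof -
  define \<kappa> where "\<kappa> = sqrt (LINT x|gauss. (f x - (LINT y|gauss. f y))\<^sup>2)"
  have \<kappa>: "0 < \<kappa>" "\<kappa>\<^sup>2 = (LINT x|gauss. (f x - (LINT y|gauss. f y))\<^sup>2)" using var by (auto simp: \<kappa>_def)
  define g where "g x = (f x - (LINT y|gauss. f y)) / \<kappa>" for x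
  have sd: "stationary_sd n = 1" if "1 \<le> n" for n
    using stationary_variance(1)[OF that] unit[OF that] unfolding stationary_sd_def
    by (cases "1 - (\<alpha> n)\<^sup>2 = 0") auto
  have g_eq: "g = (\<lambda>x. (1 / \<kappa>) * (f x - (LINT y|gauss. f y)))" by (simp add: g_def[abs_def])
  have g_sq: "sq_integrable gauss g"
    unfolding g_eq by (intro sq_integrable_cmult sq_integrable_diff f gauss.sq_integrable_const)
  have g_norm: "(LINT x|gauss. (g x)\<^sup>2) = 1"
    unfolding g_eq power_mult_distrib integral_mult_right_zero \<kappa>(2)[symmetric]
    using \<kappa>(1) by (simp add: power_divide)
  have "converges_in_distribution skorokhod_topology M (standardized_functional M X f) N (linear_path (\<lambda>\<omega>. g (Z \<omega>)))"
  proof (rule standardized_functional_converges[OF _ _ _ g_sq g_norm _ N Z])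
    show "f \<in> borel_measurable borel" using sq_integrable_measurable[OF f] by simp
    show "sq_integrable gauss (\<lambda>x. f (stationary_sd n * x))" if "1 \<le> n" for n
      using f sd[OF that] by simp
    show "0 < \<kappa>" by fact
    have "\<forall>\<^sub>F n in sequentially. (LINT x|gauss. ((f (stationary_sd n * x) - (LINT y|gauss. f (stationary_sd n * y))) / \<kappa> - g x)\<^sup>2) = 0"
      using eventually_ge_at_top[of 1] by eventually_elim (simp add: sd g_def)
    then show "(\<lambda>n. LINT x|gauss. ((f (stationary_sd n * x) - (LINT y|gauss. f (stationary_sd n * y))) / \<kappa> - g x)\<^sup>2) \<longlonglongrightarrow> 0"
      by (rule tendsto_eventually)
  qed
  then show ?thesis unfolding g_def \<kappa>_def .
qed

text \<open>The partial sums of the standardized series start at the Hermite rank, whereas the expansion of \<open>f\<close>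
  starts at order 0; they agree after centring because the coefficients in between vanish. This
  requires the rank to be at least 1, that is, some coefficient of positive order to be
  nonzero, which holds because \<open>f\<close> is not constant.\<close>

lemma standardized_hermite_series:
  assumes f: "sq_integrable gauss f" and nonconst: "\<not> (\<exists>k. AE x in gauss. f x = k)"
  defines "\<mu> \<equiv> (LINT y|gauss. f y)"
  defines "\<kappa> \<equiv> sqrt (LINT x|gauss. (f x - \<mu>)\<^sup>2)"
  defines "h \<equiv> \<lambda>q. hermite_coeffs f q * sqrt (fact q) / \<kappa>"
  shows "0 < (LINT x|gauss. (f x - \<mu>)\<^sup>2)"
    and "L2_tendsto gauss (\<lambda>K x. \<Sum>q=hermite_rank (hermite_coeffs f)..K. h q * (hermite q x / sqrt (fact q)))
      (\<lambda>x. (f x - \<mu>) / \<kappa>)"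
proof -
  let ?c = "hermite_coeffs f"
  define m where "m = hermite_rank ?c"
  have c0: "?c 0 = \<mu>" by (simp add: hermite_coeffs_eq[OF f] \<mu>_def)
  have f\<mu>: "sq_integrable gauss (\<lambda>x. f x - \<mu>)" by (intro sq_integrable_diff f gauss.sq_integrable_const)
  have "(LINT x|gauss. (f x - \<mu>)\<^sup>2) \<noteq> 0"
    using nonconst integral_square_eq_0_iff[OF f\<mu>] by auto
  moreover have "0 \<le> (LINT x|gauss. (f x - \<mu>)\<^sup>2)" by simp
  ultimately show pos: "0 < (LINT x|gauss. (f x - \<mu>)\<^sup>2)" by linarith
  define S where "S K x = (\<Sum>q\<le>K. ?c q * hermite q x)" for K x
  have S: "L2_tendsto gauss S f" unfolding S_def[abs_def] by (rule hermite_coeffs_expansion[OF f])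
  have S_eq: "S K x = \<mu> + (\<Sum>q=1..K. ?c q * hermite q x)" for K x
    by (simp add: S_def atMost_atLeast0 sum.atLeast_Suc_atMost c0)
  have "\<exists>q. 1 \<le> q \<and> ?c q \<noteq> 0"
  proof (rule ccontr)
    assume "\<not> ?thesis"
    then have "S K x = \<mu>" for K x unfolding S_eq by (auto intro!: sum.neutral)
    then have "(\<lambda>K::nat. LINT x|gauss. (\<mu> - f x)\<^sup>2) \<longlonglongrightarrow> 0"
      using S by (simp add: L2_tendsto_def)
    then show False using pos by (simp add: LIMSEQ_const_iff power2_commute)
  qed
  then obtain q0 where q0: "1 \<le> q0 \<and> ?c q0 \<noteq> 0" by blast
  have m: "1 \<le> m" using LeastI[of "\<lambda>q. 1 \<le> q \<and> ?c q \<noteq> 0", OF q0] by (simp add: m_def hermite_rank_def)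
  have below: "?c q = 0" if "1 \<le> q" "q < m" for q
    using not_less_Least[of q "\<lambda>q. 1 \<le> q \<and> ?c q \<noteq> 0"] that by (auto simp: m_def hermite_rank_def)
  have partial: "(\<Sum>q=m..K. h q * (hermite q x / sqrt (fact q))) = (1 / \<kappa>) * (S K x - \<mu>)" for K x
  proof -
    have "(\<Sum>q=1..K. ?c q * hermite q x) = (\<Sum>q=m..K. ?c q * hermite q x)"
      by (rule sum.mono_neutral_right) (use m below in auto)
    then show ?thesis
      by (simp add: S_eq h_def sum_divide_distrib)
  qed
  have "(\<lambda>K. (1 / \<kappa>)\<^sup>2 * (LINT x|gauss. (S K x - f x)\<^sup>2)) \<longlonglongrightarrow> (1 / \<kappa>)\<^sup>2 * 0"
    using S by (intro tendsto_intros) (simp add: L2_tendsto_def)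
  moreover have "(LINT x|gauss. ((1 / \<kappa>) * (S K x - \<mu>) - (1 / \<kappa>) * (f x - \<mu>))\<^sup>2)
      = (1 / \<kappa>)\<^sup>2 * (LINT x|gauss. (S K x - f x)\<^sup>2)" for K
    unfolding right_diff_distrib[symmetric] power_mult_distrib integral_mult_right_zero by simp
  ultimately have "L2_tendsto gauss (\<lambda>K x. (1 / \<kappa>) * (S K x - \<mu>)) (\<lambda>x. (1 / \<kappa>) * (f x - \<mu>))"
    using S f sq_integrable_cmult[OF sq_integrable_diff[OF _ gauss.sq_integrable_const[of \<mu>]], of _ "1 / \<kappa>"]
    unfolding L2_tendsto_def by auto
  then show "L2_tendsto gauss (\<lambda>K x. \<Sum>q=hermite_rank ?c..K. h q * (hermite q x / sqrt (fact q))) (\<lambda>x. (f x - \<mu>) / \<kappa>)"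
    unfolding m_def[symmetric] partial by simp
qed

lemma L2_tendsto_std_normal:
  assumes Z: "distributed N lborel Z std_normal_density" and F: "L2_tendsto gauss F g"
  shows "L2_tendsto N (\<lambda>K \<omega>. F K (Z \<omega>)) (\<lambda>\<omega>. g (Z \<omega>))"
proof -
  have sq: "sq_integrable gauss (F K)" "sq_integrable gauss g" for K using F by (auto simp: L2_tendsto_def)
  have "(LINT \<omega>|N. (F K (Z \<omega>) - g (Z \<omega>))\<^sup>2) = (LINT x|gauss. (F K x - g x)\<^sup>2)" for K
    using integral_std_normal[OF Z, of "\<lambda>x. (F K x - g x)\<^sup>2"] sq_integrable_measurable[OF sq(1)[of K]]
      sq_integrable_measurable[OF sq(2)] by simp
  then show ?thesis using F sq_integrable_std_normal[OF Z] by (simp add: L2_tendsto_def)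
qed

lemma hermite_rank_le: "1 \<le> p \<Longrightarrow> c p \<noteq> 0 \<Longrightarrow> hermite_rank c \<le> p"
  unfolding hermite_rank_def by (rule Least_le) simp

lemma sum_parity_reindex:
  fixes p :: nat
  assumes "\<And>q. odd (p + q) \<Longrightarrow> T q = (0 :: real)" and "1 \<le> p"
  shows "(\<Sum>q=1..p. T q) = (\<Sum>l=0..(p - 1) div 2. T (p - 2 * l))"
proof -
  let ?J = "(\<lambda>l. p - 2 * l) ` {0..(p - 1) div 2}"
  have "(\<Sum>q=1..p. T q) = (\<Sum>q\<in>?J. T q)"
  proof (rule sum.mono_neutral_right)
    show "?J \<subseteq> {1..p}" using assms(2) by auto
    show "\<forall>q\<in>{1..p} - ?J. T q = 0"
    proof (intro ballI assms(1))
      fix q assume q: "q \<in> {1..p} - ?J"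
      show "odd (p + q)"
      proof
        assume "even (p + q)"
        then have "even (p - q)" using q by auto
        then obtain l where "p - q = 2 * l" by (elim evenE)
        then have "q = p - 2 * l" "l \<in> {0..(p - 1) div 2}" using q by auto
        then show False using q by blast
      qed
    qed
  qed simp
  also have "\<dots> = (\<Sum>l=0..(p - 1) div 2. T (p - 2 * l))"
    by (subst sum.reindex) (auto simp: inj_on_def)
  finally show ?thesis .
qed

theorem theorem5p2:
  shows
    "(\<forall>(c :: nat \<Rightarrow> real) m p. 1 \<le> p \<and> c p \<noteq> 0 \<and> m = hermite_rank c \<longrightarrow>
        (\<exists>a :: nat \<Rightarrow> real.
          \<forall>(M :: 'a measure) \<gamma> \<beta> \<sigma> \<epsilon> X (N :: 'b measure) Z.
            nearly_unstable_ar1 M \<gamma> \<beta> \<sigma> \<epsilon> X \<and>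
            (\<lambda>n. 1 - (ar_coeff \<gamma> \<beta> n)\<^sup>2) \<in> o(\<lambda>n. (\<sigma> n)\<^sup>2) \<and>
            prob_space N \<and> distributed N lborel Z std_normal_density \<longrightarrow>
            converges_in_distribution skorokhod_topology
              M (standardized_functional M X (hermite_poly c m p))
              N (linear_path (\<lambda>\<omega>. \<Sum>l=0..(p - 1) div 2.
                   a (p - 2 * l) * (hermite (p - 2 * l) (Z \<omega>) / sqrt (fact (p - 2 * l)))))))
   \<and>
     (\<forall>(f :: real \<Rightarrow> real) m.
        sq_integrable std_normal_distribution f \<and>
        \<not> (\<exists>k. AE x in std_normal_distribution. f x = k) \<and>
        m = hermite_rank (hermite_coeffs f) \<longrightarrow>
        (\<exists>h :: nat \<Rightarrow> real.
          \<forall>(M :: 'a measure) \<gamma> \<beta> \<sigma> \<epsilon> X (N :: 'b measure) Z.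
            nearly_unstable_ar1 M \<gamma> \<beta> \<sigma> \<epsilon> X \<and>
            (\<forall>n\<ge>1. (\<sigma> n)\<^sup>2 = 1 - (ar_coeff \<gamma> \<beta> n)\<^sup>2) \<and>
            prob_space N \<and> distributed N lborel Z std_normal_density \<longrightarrow>
            (\<exists>W :: 'b \<Rightarrow> real.
              L2_tendsto N (\<lambda>K \<omega>. \<Sum>q=m..K. h q * (hermite q (Z \<omega>) / sqrt (fact q))) W \<and>
              converges_in_distribution skorokhod_topology
                M (standardized_functional M X f)
                N (linear_path W))))
   \<and>
     (\<forall>(c :: nat \<Rightarrow> real) m p. 1 \<le> p \<and> c p \<noteq> 0 \<and> m = hermite_rank c \<and>
        \<not> hermite_poly c m p constant_on UNIV \<longrightarrow>
        (\<exists>b :: nat \<Rightarrow> real.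
          \<forall>(M :: 'a measure) \<gamma> \<beta> \<sigma> \<epsilon> X (N :: 'b measure) Z.
            nearly_unstable_ar1 M \<gamma> \<beta> \<sigma> \<epsilon> X \<and>
            (\<lambda>n. (\<sigma> n)\<^sup>2) \<in> o(\<lambda>n. 1 - (ar_coeff \<gamma> \<beta> n)\<^sup>2) \<and>
            prob_space N \<and> distributed N lborel Z std_normal_density \<longrightarrow>
            converges_in_distribution skorokhod_topology
              M (standardized_functional M X (hermite_poly c m p))
              N (linear_path (\<lambda>\<omega>. \<Sum>q=1..m_star c m p.
                   b q * (hermite q (Z \<omega>) / sqrt (fact q))))))"
proof (intro conjI allI impI, goal_cases)
  case (1 c m p)
  then have p: "1 \<le> p" "c p \<noteq> 0" and m: "m \<le> p" using hermite_rank_le by auto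
  obtain h where h: "\<And>x. sgn (c p) * standardized_power p x = (\<Sum>q=1..p. h q * (hermite q x / sqrt (fact q)))"
    "\<And>q. odd (p + q) \<Longrightarrow> h q = 0"
    using standardized_power_hermite[of "sgn (c p)" p] by blast
  have h': "sgn (c p) * standardized_power p x
      = (\<Sum>l=0..(p - 1) div 2. h (p - 2 * l) * (hermite (p - 2 * l) x / sqrt (fact (p - 2 * l))))" for x
    unfolding h(1) by (rule sum_parity_reindex[OF _ p(1)]) (simp add: h(2))
  show ?case
  proof (intro exI[of _ h] allI impI, elim conjE)
    fix M :: "'a measure" and \<gamma> \<beta> \<sigma> \<epsilon> X and N :: "'b measure" and Z
    assume "nearly_unstable_ar1 M \<gamma> \<beta> \<sigma> \<epsilon> X"
      and large: "(\<lambda>n. 1 - (ar_coeff \<gamma> \<beta> n)\<^sup>2) \<in> o(\<lambda>n. (\<sigma> n)\<^sup>2)"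
      and N: "prob_space N" "distributed N lborel Z std_normal_density"
    then interpret nearly_unstable_ar1 M \<gamma> \<beta> \<sigma> \<epsilon> X by simp
    show "converges_in_distribution skorokhod_topology M (standardized_functional M X (hermite_poly c m p))
        N (linear_path (\<lambda>\<omega>. \<Sum>l=0..(p - 1) div 2.
          h (p - 2 * l) * (hermite (p - 2 * l) (Z \<omega>) / sqrt (fact (p - 2 * l)))))"
      using large_variance_converges[where c = c, OF p(1) m p(2) large N] unfolding h' .
  qed
next
  case (2 f m)
  then have f: "sq_integrable gauss f" and nonconst: "\<not> (\<exists>k. AE x in gauss. f x = k)"
    and m: "m = hermite_rank (hermite_coeffs f)" by auto
  define \<mu> where "\<mu> = (LINT y|gauss. f y)"
  define \<kappa> where "\<kappa> = sqrt (LINT x|gauss. (f x - \<mu>)\<^sup>2)"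
  define h where "h q = hermite_coeffs f q * sqrt (fact q) / \<kappa>" for q
  note series = standardized_hermite_series[OF f nonconst, folded \<mu>_def, folded \<kappa>_def, folded h_def m]
  show ?case
  proof (intro exI[of _ h] allI impI, elim conjE)
    fix M :: "'a measure" and \<gamma> \<beta> \<sigma> \<epsilon> X and N :: "'b measure" and Z
    assume "nearly_unstable_ar1 M \<gamma> \<beta> \<sigma> \<epsilon> X"
      and unit: "\<forall>n\<ge>1. (\<sigma> n)\<^sup>2 = 1 - (ar_coeff \<gamma> \<beta> n)\<^sup>2"
      and N: "prob_space N" "distributed N lborel Z std_normal_density"
    then interpret nearly_unstable_ar1 M \<gamma> \<beta> \<sigma> \<epsilon> X by simp
    let ?W = "\<lambda>\<omega>. (f (Z \<omega>) - \<mu>) / \<kappa>"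
    have "L2_tendsto N (\<lambda>K \<omega>. \<Sum>q=m..K. h q * (hermite q (Z \<omega>) / sqrt (fact q))) ?W"
      by (rule L2_tendsto_std_normal[OF N(2) series(2)])
    moreover have "converges_in_distribution skorokhod_topology M (standardized_functional M X f) N (linear_path ?W)"
      using unit_variance_converges[OF f series(1)[unfolded \<mu>_def] _ N] unit unfolding \<mu>_def \<kappa>_def by blast
    ultimately show "\<exists>W. L2_tendsto N (\<lambda>K \<omega>. \<Sum>q=m..K. h q * (hermite q (Z \<omega>) / sqrt (fact q))) W \<and>
        converges_in_distribution skorokhod_topology M (standardized_functional M X f) N (linear_path W)"
      by blast
  qed
next
  case (3 c m p)
  then have p: "1 \<le> p" "c p \<noteq> 0" and m: "m \<le> p" using hermite_rank_le by auto
  let ?s = "sgn (coeff (hermite_sum c m p) (m_star c m p))"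
  obtain h where h: "\<And>x. ?s * standardized_power (m_star c m p) x
      = (\<Sum>q=1..m_star c m p. h q * (hermite q x / sqrt (fact q)))"
    using standardized_power_hermite[of ?s "m_star c m p"] by blast
  show ?case
  proof (intro exI[of _ h] allI impI, elim conjE)
    fix M :: "'a measure" and \<gamma> \<beta> \<sigma> \<epsilon> X and N :: "'b measure" and Z
    assume "nearly_unstable_ar1 M \<gamma> \<beta> \<sigma> \<epsilon> X"
      and small: "(\<lambda>n. (\<sigma> n)\<^sup>2) \<in> o(\<lambda>n. 1 - (ar_coeff \<gamma> \<beta> n)\<^sup>2)"
      and N: "prob_space N" "distributed N lborel Z std_normal_density"
    then interpret nearly_unstable_ar1 M \<gamma> \<beta> \<sigma> \<epsilon> X by simp
    show "converges_in_distribution skorokhod_topology M (standardized_functional M X (hermite_poly c m p))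
        N (linear_path (\<lambda>\<omega>. \<Sum>q=1..m_star c m p. h q * (hermite q (Z \<omega>) / sqrt (fact q))))"
      using small_variance_converges[where c = c, OF p(1) m p(2) small N] unfolding h .
  qed
qed

end
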